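(* In each of the types $E_6^{(1)}$, $E_7^{(1)}$ and $E_8^{(1)}$, every reduced Young wall is built on top of the ground state wall, i.e. it contains every block of the ground state wall.
   Context: **Notation.** $\hat{\mathfrak g}$ is the untwisted affine Kac–Moody algebra of type $E_6^{(1)},E_7^{(1)}$ or $E_8^{(1)}$, with index set $I=\{0,\dots,n\}$ ($n=6,7,8$) and fundamental weights $\Lambda_i$. Dynkin diagrams (Bourbaki): $E_6^{(1)}$: chain $1-3-4-5-6$ together with $4-2-0$; $E_7^{(1)}$: chain $0-1-3-4-5-6-7$ together with $4-2$; $E_8^{(1)}$: chain $0-8-7-6-5-4-3-1$ together with $4-2$. **Tensor product of crystals.** $\tilde f_i(b\otimes b')=\tilde f_ib\otimes b'$ if $\varphi_i(b)>\varepsilon_i(b')$ and $b\otimes\tilde f_ib'$ otherwise; $\tilde e_i(b\otimes b')=\tilde e_ib\otimes b'$ if $\varphi_i(b)\ge\varepsilon_i(b')$ and $b\otimes\tilde e_ib'$ otherwise. **Young column patterns.** A Young column pattern is an infinite vertical strip of unit cubes indexed by $k\in\mathbb Z$ (height increasing with $k$), each cut by vertical cuts into blocks coloured by $I$. The horizontal cross-section of every cube is a grid with $w$ columns of cells (numbered $1,\dots,w$ from left to right) and two rows (upper, lower), $w=2,3,6$ in types $E_6^{(1)},E_7^{(1)},E_8^{(1)}$. A block is the full-height prism over a union of cells. Write $u/l$ for a cross-section whose upper row has colours $u$ and lower row has colours $l$ (just $u$ if both rows agree); equally coloured cells of one cube form a single block, except that in type $E_8^{(1)}$ a cube $444444$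 consists of two $4$-blocks, one over cell columns $1$–$3$ and one over cell columns $4$–$6$. Rotation by $180^\circ$ sends $u/l$ to $\mathrm{rev}(l)/\mathrm{rev}(u)$, where rev reverses a word. - $E_6^{(1)}$ (period 12): cubes $1,\dots,6$ are $44/04$; $25$; $46/44$; $35$; $44/14$; $32$; cube $k+6$ is the rotation of cube $k$ for all $k$. - $E_7^{(1)}$ (period 8): cubes $1,\dots,8$ are $332/032$; $144$; $355/335$; $446$; $257/255$; $446$; $355/335$; $144$. - $E_8^{(1)}$ (period 20): cubes $1,\dots,10$ are $775522/075552$; $866444$; $755533/775533$; $664441$; $552233/555233$; $444444$; $332555/332255$; $144466$; $335577/335557$; $444668$; cube $k+10$ is the rotation of cube $k$ for all $k$. **Young columns.** A Young column is a nonempty collection of blocks of the pattern of bounded height with no empty space below any block: if a block of cube $k$ belongs to it, so does every block of cube $k-1$ lying below at least one of its cells. Young columns are equivalent if obtained from one another by vertical translation and/or rotation by $180^\circ$ about the vertical axis. In type $E_8^{(1)}$ two further equivalence classes of collections also count as Young columns, those of: (S1) all blocks of cubes $k\le4$, the $5$- and $3$-blocks of cube 5, and the $4$-block over cell columns 4–6 of cube 6; (S2) all blocks of cubes $k\le5$, the $4$-block over cell columns 4–6 of cube 6, and the $2$-block of cube 7. An $i$-block of a Young column is removable if removing it leaves a Young column; an $i$-block not in it is addable if adding it gives a Young column. $\tilde f_i$ adds an addable $i$-block if one exists and gives $0$ otherwise; $\tilde e_i$ removes a removable $i$-block if one exists and gives $0$ otherwise; in type $E_8^{(1)}$ with these rules: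 (a) if there are two addable $i$-blocks, $\tilde f_i$ adds the higher one if $i\ne4$ and the one lying on top of a $5$-block if $i=4$; if there are two removable $i$-blocks, $\tilde e_i$ removes the lower one if $i\neq4$ and the one lying on top of a $3$-block if $i=4$; (b) if a Young column $y$ is obtained by adding (resp. removing) an $i$-block to (from) another Young column by these rules and $y$ itself has an addable (resp. removable) $i$-block, then $\tilde f_j(y)=\tilde e_j(y)=0$ for all $j\neq i$. Put $\varphi_i(y)=\max\{m:\tilde f_i^my\ne0\}$, $\varepsilon_i(y)=\max\{m:\tilde e_i^my\neq0\}$. The set $C$ of equivalence classes becomes a classical crystal with $\mathrm{wt}(y)=\sum_i(\varphi_i(y)-\varepsilon_i(y))\Lambda_i$. **Energy function.** $H:C\otimes C\to\mathbb Z$ is the function with $H(\tilde f_i(b\otimes b'))=H(b\otimes b')$ for $i\ne0$, and, when $\tilde f_0(b\otimes b')\neq0$, $H(\tilde f_0(b\otimes b'))=H(b\otimes b')+1$ if $\tilde f_0(b\otimes b')=\tilde f_0b\otimes b'$ and $H(b\otimes b')-1$ if $\tilde f_0(b\otimes b')=b\otimes\tilde f_0b'$; normalised by $H(c\otimes c)=0$ for extremal $c$ (all $c$ in types $E_6^{(1)},E_7^{(1)}$; all $c$ of nonzero weight in type $E_8^{(1)}$). **Young walls.** The Young wall pattern has columns indexed $r=0,1,2,\dots$ from right to left. In type $E_6^{(1)}$, cube $k$ of column $r$ is cube $k+8r$ of the Young column pattern; in type $E_7^{(1)}$, column $r$ is the Young column pattern for $r$ even, and for $r$ odd its cube $k$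 is the rotation of cube $k+4$ of the Young column pattern; in type $E_8^{(1)}$ every column is the Young column pattern. Each column pattern is thus a translated/rotated copy of the Young column pattern, so Young columns in column $r$ and their classes in $C$ make sense; the positions of the blocks (not their colours) are the same in all columns. The ground state wall consists in every column $r$ of all blocks of cubes $k\le0$ together with: ($E_6^{(1)}$) the three-cell block of cube 1, the block over cell column 2 of cube 2, the one-cell block of cube 3; ($E_7^{(1)}$) all blocks of cube 1 except the one-cell block, the block over cell columns 2–3 of cube 2, the block of cube 3 containing cell column 3, the block over cell column 3 of cube 4, the one-cell block of cube 5; ($E_8^{(1)}$) the blocks of colours $7,5,2$ in cube 1; $6,4$ in cube 2; $5,3$ in cube 3; $4,1$ in cube 4; $2,3$ in cube 5; the $4$-block over cell columns 4–6 in cube 6; and the blocks of colours $5,6,7,8,0$ in cubes $7,8,9,10,11$ respectively. Let $b_r\in C$ be the class of column $r$ of the ground state wall. A Young wall is a collection of blocks of the Young wall pattern which differs from the ground state wall in finitely many blocks and each of whose columns is a Young column. **Reduced Young walls.** Write a Young wall as $Y=(y_r)_{r\ge0}$ with $y_r\in C$ the class of column $r$, and let $|y_r|_0$ be the (signed) difference in the number of $0$-blocks between $Y$ and the ground state wall in column $r$. The pair $(y_{r+1},y_r)$ is reduced if $H(y_{r+1}\otimes y_r)-|y_{r+1}|_0+|y_r|_0=H(b_{r+1}\otimes b_r)$; $Y$ is reduced if all pairs $(y_{r+1},y_r)$, $r\ge0$, are. *)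

theory Defs
  imports Main
begin

section \<open>Young column patterns\<close>

datatype affine_type = E6 | E7 | E8

definition index_set :: "affine_type \<Rightarrow> nat set" where
  "index_set T = (case T of E6 \<Rightarrow> {0..6} | E7 \<Rightarrow> {0..7} | E8 \<Rightarrow> {0..8})"

datatype row = Upper | Lower

text \<open>A cell is a pair of a row and a column number, the columns being numbered \<open>1, \<dots>, w\<close>.\<close>

type_synonym cell = "row \<times> nat"

text \<open>A cross-section \<open>u/l\<close> is the pair \<open>(u, l)\<close> of its rows of colours.\<close>

type_synonym cross_section = "nat list \<times> nat list"

definition width :: "affine_type \<Rightarrow> nat" where
  "width T = (case T of E6 \<Rightarrow> 2 | E7 \<Rightarrow> 3 | E8 \<Rightarrow> 6)"

definition rotate_section :: "cross_section \<Rightarrow> cross_section" where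
  "rotate_section X = (rev (snd X), rev (fst X))"

definition sections :: "affine_type \<Rightarrow> cross_section list" where
  "sections T = (case T of
     E6 \<Rightarrow> [([4,4],[0,4]), ([2,5],[2,5]), ([4,6],[4,4]), ([3,5],[3,5]), ([4,4],[1,4]), ([3,2],[3,2])]
   | E7 \<Rightarrow> [([3,3,2],[0,3,2]), ([1,4,4],[1,4,4]), ([3,5,5],[3,3,5]), ([4,4,6],[4,4,6]),
            ([2,5,7],[2,5,5]), ([4,4,6],[4,4,6]), ([3,5,5],[3,3,5]), ([1,4,4],[1,4,4])]
   | E8 \<Rightarrow> [([7,7,5,5,2,2],[0,7,5,5,5,2]), ([8,6,6,4,4,4],[8,6,6,4,4,4]),
            ([7,5,5,5,3,3],[7,7,5,5,3,3]), ([6,6,4,4,4,1],[6,6,4,4,4,1]),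
            ([5,5,2,2,3,3],[5,5,5,2,3,3]), ([4,4,4,4,4,4],[4,4,4,4,4,4]),
            ([3,3,2,5,5,5],[3,3,2,2,5,5]), ([1,4,4,4,6,6],[1,4,4,4,6,6]),
            ([3,3,5,5,7,7],[3,3,5,5,5,7]), ([4,4,4,6,6,8],[4,4,4,6,6,8])])"

text \<open>
  The cross-section of cube \<open>k\<close>.  The listed sections are those of the cubes \<open>1, 2, \<dots>\<close>; in types
  \<open>E6\<close> and \<open>E8\<close> they are alternately repeated rotated and unrotated, in type \<open>E7\<close> unrotated.
\<close>

definition cube_section :: "affine_type \<Rightarrow> int \<Rightarrow> cross_section" where
  "cube_section T k =
     (let p = int (length (sections T)); X = sections T ! nat ((k - 1) mod p)
      in if T = E7 \<or> even ((k - 1) div p) then X else rotate_section X)"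

datatype block = Block (cube: int) (cells: "cell set") (colour: nat)

definition section_cells :: "cross_section \<Rightarrow> cell set" where
  "section_cells X = UNIV \<times> {1..length (fst X)}"

definition cell_colour :: "cross_section \<Rightarrow> cell \<Rightarrow> nat" where
  "cell_colour X c = (case c of (Upper, j) \<Rightarrow> fst X ! (j - 1) | (Lower, j) \<Rightarrow> snd X ! (j - 1))"

text \<open>Only type \<open>E8\<close> has a cube with the section \<open>444444\<close>, which is cut into two blocks.\<close>

definition section_blocks :: "cross_section \<Rightarrow> (cell set \<times> nat) set" where
  "section_blocks X =
     (if X = (replicate 6 4, replicate 6 4)
      then {(UNIV \<times> {1..3}, 4), (UNIV \<times> {4..6}, 4)}
      else {(S, i). S = {c \<in> section_cells X. cell_colour X c = i} \<and> S \<noteq> {}})"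

definition pattern :: "(int \<Rightarrow> cross_section) \<Rightarrow> block set" where
  "pattern Q = {b. (cells b, colour b) \<in> section_blocks (Q (cube b))}"

definition column_pattern :: "affine_type \<Rightarrow> block set" where
  "column_pattern T = pattern (cube_section T)"


section \<open>Young columns\<close>

definition lies_on :: "block \<Rightarrow> block \<Rightarrow> bool" where
  "lies_on b b' \<longleftrightarrow> cube b' = cube b - 1 \<and> cells b \<inter> cells b' \<noteq> {}"

definition supported_column :: "block set \<Rightarrow> block set \<Rightarrow> bool" where
  "supported_column P y \<longleftrightarrow>
     y \<noteq> {} \<and> y \<subseteq> P \<and> (\<exists>K. \<forall>b\<in>y. cube b \<le> K) \<and>
     (\<forall>b\<in>y. \<forall>b'\<in>P. lies_on b b' \<longrightarrow> b' \<in> y)"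

definition translate_block :: "int \<Rightarrow> block \<Rightarrow> block" where
  "translate_block t b = Block (cube b + t) (cells b) (colour b)"

definition rotate_cell :: "affine_type \<Rightarrow> cell \<Rightarrow> cell" where
  "rotate_cell T c = (if fst c = Upper then Lower else Upper, width T + 1 - snd c)"

definition rotate_block :: "affine_type \<Rightarrow> block \<Rightarrow> block" where
  "rotate_block T b = Block (cube b) (rotate_cell T ` cells b) (colour b)"

text \<open>Blocks carry their colours, so the motions below are required to preserve colours.\<close>

definition equiv_columns :: "affine_type \<Rightarrow> block set \<Rightarrow> block set \<Rightarrow> bool" where
  "equiv_columns T y y' \<longleftrightarrow>
     (\<exists>t. y' = translate_block t ` y \<or> y' = translate_block t ` rotate_block T ` y)"

definition special1 :: "block set" where
  "special1 = {b \<in> column_pattern E8.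
     cube b \<le> 4 \<or> cube b = 5 \<and> colour b \<in> {5, 3} \<or> cube b = 6 \<and> cells b = UNIV \<times> {4..6}}"

definition special2 :: "block set" where
  "special2 = {b \<in> column_pattern E8.
     cube b \<le> 5 \<or> cube b = 6 \<and> cells b = UNIV \<times> {4..6} \<or> cube b = 7 \<and> colour b = 2}"

text \<open>
  The pattern \<open>P\<close> is a parameter because the columns of the Young wall pattern are moved copies of
  the Young column pattern.
\<close>

definition young_column :: "affine_type \<Rightarrow> block set \<Rightarrow> block set \<Rightarrow> bool" where
  "young_column T P y \<longleftrightarrow>
     supported_column P y \<or>
     T = E8 \<and> y \<subseteq> P \<and> (equiv_columns T special1 y \<or> equiv_columns T special2 y)"

text \<open>
  The element of \<open>C\<close> represented by a Young column \<open>y\<close> of any column of the Young wall pattern: all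
  Young columns of the Young column pattern that are equivalent to \<open>y\<close>.
\<close>

definition column_class :: "affine_type \<Rightarrow> block set \<Rightarrow> block set set" where
  "column_class T y = {z. young_column T (column_pattern T) z \<and> equiv_columns T y z}"

definition classes :: "affine_type \<Rightarrow> block set set set" where
  "classes T = column_class T ` {y. young_column T (column_pattern T) y}"


section \<open>The crystal of Young columns\<close>

definition addable :: "affine_type \<Rightarrow> nat \<Rightarrow> block set \<Rightarrow> block set" where
  "addable T i y = {b \<in> column_pattern T. colour b = i \<and> b \<notin> y \<and>
                      young_column T (column_pattern T) (insert b y)}"

definition removable :: "affine_type \<Rightarrow> nat \<Rightarrow> block set \<Rightarrow> block set" where
  "removable T i y = {b \<in> y. colour b = i \<and> young_column T (column_pattern T) (y - {b})}"

definition on_top_of_colour :: "affine_type \<Rightarrow> nat \<Rightarrow> block \<Rightarrow> bool" where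
  "on_top_of_colour T i b \<longleftrightarrow> (\<exists>b'\<in>column_pattern T. colour b' = i \<and> lies_on b b')"

text \<open>
  The block that is added or removed under rule (a).  Outside type \<open>E8\<close> a Young column has at most one
  addable and at most one removable \<open>i\<close>-block.
\<close>

definition to_add :: "affine_type \<Rightarrow> nat \<Rightarrow> block set \<Rightarrow> block \<Rightarrow> bool" where
  "to_add T i y b \<longleftrightarrow> b \<in> addable T i y \<and>
     (T = E8 \<and> card (addable T i y) = 2 \<longrightarrow>
        (if i = 4 then on_top_of_colour T 5 b else (\<forall>b'\<in>addable T i y. cube b' \<le> cube b)))"

definition to_remove :: "affine_type \<Rightarrow> nat \<Rightarrow> block set \<Rightarrow> block \<Rightarrow> bool" where
  "to_remove T i y b \<longleftrightarrow> b \<in> removable T i y \<and>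
     (T = E8 \<and> card (removable T i y) = 2 \<longrightarrow>
        (if i = 4 then on_top_of_colour T 3 b else (\<forall>b'\<in>removable T i y. cube b \<le> cube b')))"

text \<open>
  The operators before rule (b) is applied; \<open>None\<close> stands for the value \<open>0\<close> of a crystal operator.
\<close>

definition add_block :: "affine_type \<Rightarrow> nat \<Rightarrow> block set \<Rightarrow> block set option" where
  "add_block T i y = (if \<exists>b. to_add T i y b then Some (insert (SOME b. to_add T i y b) y) else None)"

definition remove_block :: "affine_type \<Rightarrow> nat \<Rightarrow> block set \<Rightarrow> block set option" where
  "remove_block T i y =
     (if \<exists>b. to_remove T i y b then Some (y - {SOME b. to_remove T i y b}) else None)"

text \<open>Rule (b): \<open>y\<close> lies in the middle of a \<open>j\<close>-string, so all other operators vanish on it.\<close>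

definition mid_string :: "affine_type \<Rightarrow> nat \<Rightarrow> block set \<Rightarrow> bool" where
  "mid_string T j y \<longleftrightarrow>
     (\<exists>y'. young_column T (column_pattern T) y' \<and>
        (add_block T j y' = Some y \<and> addable T j y \<noteq> {} \<or>
         remove_block T j y' = Some y \<and> removable T j y \<noteq> {}))"

definition f_column :: "affine_type \<Rightarrow> nat \<Rightarrow> block set \<Rightarrow> block set option" where
  "f_column T i y = (if T = E8 \<and> (\<exists>j. j \<noteq> i \<and> mid_string T j y) then None else add_block T i y)"

definition e_column :: "affine_type \<Rightarrow> nat \<Rightarrow> block set \<Rightarrow> block set option" where
  "e_column T i y = (if T = E8 \<and> (\<exists>j. j \<noteq> i \<and> mid_string T j y) then None else remove_block T i y)"

text \<open>The operators commute with equivalence of columns, so any representative may be used.\<close>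

definition f_op :: "affine_type \<Rightarrow> nat \<Rightarrow> block set set \<Rightarrow> block set set option" where
  "f_op T i c = map_option (column_class T) (f_column T i (SOME y. y \<in> c))"

definition e_op :: "affine_type \<Rightarrow> nat \<Rightarrow> block set set \<Rightarrow> block set set option" where
  "e_op T i c = map_option (column_class T) (e_column T i (SOME y. y \<in> c))"

definition iterate :: "('a \<Rightarrow> 'a option) \<Rightarrow> nat \<Rightarrow> 'a \<Rightarrow> 'a option" where
  "iterate f m x = ((\<lambda>z. Option.bind z f) ^^ m) (Some x)"

definition phi :: "affine_type \<Rightarrow> nat \<Rightarrow> block set set \<Rightarrow> nat" where
  "phi T i c = Max {m. iterate (f_op T i) m c \<noteq> None}"

definition eps :: "affine_type \<Rightarrow> nat \<Rightarrow> block set set \<Rightarrow> nat" where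
  "eps T i c = Max {m. iterate (e_op T i) m c \<noteq> None}"

text \<open>A weight is given by its coefficients with respect to the fundamental weights.\<close>

definition weight :: "affine_type \<Rightarrow> block set set \<Rightarrow> nat \<Rightarrow> int" where
  "weight T c = (\<lambda>i. if i \<in> index_set T then int (phi T i c) - int (eps T i c) else 0)"

definition f_tensor ::
  "affine_type \<Rightarrow> nat \<Rightarrow> block set set \<times> block set set \<Rightarrow> (block set set \<times> block set set) option" where
  "f_tensor T i x = (case x of (b, b') \<Rightarrow>
     if phi T i b > eps T i b' then map_option (\<lambda>d. (d, b')) (f_op T i b)
     else map_option (\<lambda>d. (b, d)) (f_op T i b'))"

text \<open>
  The conditions determine the function uniquely on \<open>C \<times> C\<close>; its values elsewhere are irrelevant.
\<close>

definition energy_function ::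
  "affine_type \<Rightarrow> (block set set \<times> block set set \<Rightarrow> int) \<Rightarrow> bool" where
  "energy_function T H \<longleftrightarrow>
     (\<forall>b\<in>classes T. \<forall>b'\<in>classes T.
        (\<forall>i\<in>index_set T - {0}. \<forall>x. f_tensor T i (b, b') = Some x \<longrightarrow> H x = H (b, b')) \<and>
        (\<forall>d. f_op T 0 b = Some d \<and> f_tensor T 0 (b, b') = Some (d, b')
               \<longrightarrow> H (d, b') = H (b, b') + 1) \<and>
        (\<forall>d. f_op T 0 b' = Some d \<and> f_tensor T 0 (b, b') = Some (b, d)
               \<longrightarrow> H (b, d) = H (b, b') - 1)) \<and>
     (\<forall>c\<in>classes T. (T = E8 \<longrightarrow> weight T c \<noteq> (\<lambda>i. 0)) \<longrightarrow> H (c, c) = 0)"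


section \<open>Young walls\<close>

definition wall_section :: "affine_type \<Rightarrow> nat \<Rightarrow> int \<Rightarrow> cross_section" where
  "wall_section T r k = (case T of
     E6 \<Rightarrow> cube_section E6 (k + 8 * int r)
   | E7 \<Rightarrow> if even r then cube_section E7 k else rotate_section (cube_section E7 (k + 4))
   | E8 \<Rightarrow> cube_section E8 k)"

definition wall_pattern :: "affine_type \<Rightarrow> nat \<Rightarrow> block set" where
  "wall_pattern T r = pattern (wall_section T r)"

text \<open>
  The blocks of the ground state wall above cube 0.  In types \<open>E6\<close> and \<open>E7\<close> they are described by their
  positions, since their colours depend on the column.
\<close>

definition ground_upper :: "affine_type \<Rightarrow> block \<Rightarrow> bool" where
  "ground_upper T b \<longleftrightarrow> (case T of
     E6 \<Rightarrow> cube b = 1 \<and> card (cells b) = 3 \<or>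
           cube b = 2 \<and> cells b = UNIV \<times> {2} \<or>
           cube b = 3 \<and> card (cells b) = 1
   | E7 \<Rightarrow> cube b = 1 \<and> card (cells b) \<noteq> 1 \<or>
           cube b = 2 \<and> cells b = UNIV \<times> {2..3} \<or>
           cube b = 3 \<and> UNIV \<times> {3} \<subseteq> cells b \<or>
           cube b = 4 \<and> cells b = UNIV \<times> {3} \<or>
           cube b = 5 \<and> card (cells b) = 1
   | E8 \<Rightarrow> cube b = 1 \<and> colour b \<in> {7, 5, 2} \<or>
           cube b = 2 \<and> colour b \<in> {6, 4} \<or>
           cube b = 3 \<and> colour b \<in> {5, 3} \<or>
           cube b = 4 \<and> colour b \<in> {4, 1} \<or>
           cube b = 5 \<and> colour b \<in> {2, 3} \<or>
           cube b = 6 \<and> cells b = UNIV \<times> {4..6} \<or>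
           cube b = 7 \<and> colour b = 5 \<or>
           cube b = 8 \<and> colour b = 6 \<or>
           cube b = 9 \<and> colour b = 7 \<or>
           cube b = 10 \<and> colour b = 8 \<or>
           cube b = 11 \<and> colour b = 0)"

definition ground :: "affine_type \<Rightarrow> nat \<Rightarrow> block set" where
  "ground T r = {b \<in> wall_pattern T r. cube b \<le> 0 \<or> ground_upper T b}"

text \<open>A wall is the function sending \<open>r\<close> to its set of blocks in column \<open>r\<close>.\<close>

definition young_wall :: "affine_type \<Rightarrow> (nat \<Rightarrow> block set) \<Rightarrow> bool" where
  "young_wall T Y \<longleftrightarrow>
     (\<forall>r. young_column T (wall_pattern T r) (Y r)) \<and>
     finite {(r, b). b \<in> (Y r - ground T r) \<union> (ground T r - Y r)}"

definition zero_content :: "affine_type \<Rightarrow> (nat \<Rightarrow> block set) \<Rightarrow> nat \<Rightarrow> int" where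
  "zero_content T Y r =
     int (card {b \<in> Y r - ground T r. colour b = 0}) - int (card {b \<in> ground T r - Y r. colour b = 0})"

definition reduced_wall ::
  "affine_type \<Rightarrow> (block set set \<times> block set set \<Rightarrow> int) \<Rightarrow> (nat \<Rightarrow> block set) \<Rightarrow> bool" where
  "reduced_wall T H Y \<longleftrightarrow>
     (\<forall>r. H (column_class T (Y (Suc r)), column_class T (Y r))
            - zero_content T Y (Suc r) + zero_content T Y r
          = H (column_class T (ground T (Suc r)), column_class T (ground T r)))"

end

theory Submission
  imports Defs
begin

text \<open>
  Reducedness of a wall is preserved when a crystal operator of the tensor product removes a block:
  the change of the energy function compensates the change of the number of \<open>0\<close>-blocks.  As the
  classes form a perfect crystal, the ground state wall is the only reduced wall from which no block
  can be removed in this way: if \<open>r\<close> is the last column differing from the ground state, some \<open>i\<close>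
  satisfies \<open>eps\<^sub>i(y\<^sub>r) > phi\<^sub>i(b\<^sub>r\<^sub>+\<^sub>1)\<close>, and the operator acts on the first column \<open>s\<close> with
  \<open>eps\<^sub>i(y\<^sub>s) > phi\<^sub>i(y\<^sub>s\<^sub>+\<^sub>1)\<close>.  There are only finitely many reduced walls with a given tail, so every
  reduced wall arises from the ground state wall by adding blocks.

  The blocks of the Young column pattern are numbered by the integers from bottom to top, such that
  the motions of the pattern become the translations by multiples of 12, 18 or 30.  A Young column is
  then a set of integers closed under an explicit periodic relation.  In types E6 and E7 blocks
  of the same colour are always comparable; in type E8 there are, up to translation, just eight
  incomparable pairs, which together with the two special columns account for the strings of length 2.
\<close>

section \<open>Blocks as integers\<close>

text \<open>A column has no bottom, so a descending sequence of removals need not stop by itself;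
  finiteness of the set of reduced walls with a fixed tail takes the place of termination. It comes
  from the \<open>0\<close>-blocks: the class of a column and the column to its left fix, through
  the reducedness equation, how many of them the column has, whereas a translation of the column
  changes this number.

  The numbers 12, 18 and 30 are the Coxeter numbers: one step of the numbering contains as many
  blocks of colour \<open>i\<close> as the coefficient of the simple root \<open>i\<close> in the
  null root, hence a single \<open>0\<close>-block, and the \<open>0\<close>-blocks mark the steps.

  The delicate point in type E8 is that an \<open>f\<close> operator has to undo the corresponding
  \<open>e\<close> operator although rule (a) chooses between two blocks and rule (b) switches
  operators off. The columns concerned by rule (b) turn out to be, up to translation, nine explicit
  ones, one for each colour. Adding the two blocks of a pair in the wrong order would lead into the
  middle column of another colour, from which the block cannot be removed again.\<close>

definition cell_list :: "cross_section \<Rightarrow> cell list" where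
  "cell_list X = List.product [Upper, Lower] (map Suc [0..<length (fst X)])"

definition section_block_list :: "cross_section \<Rightarrow> (cell set \<times> nat) list" where
  "section_block_list X =
     (if X = (replicate 6 4, replicate 6 4)
      then [(set (filter (\<lambda>c. snd c \<le> 3) (cell_list X)), 4), (set (filter (\<lambda>c. 3 < snd c) (cell_list X)), 4)]
      else map (\<lambda>i. (set (filter (\<lambda>c. cell_colour X c = i) (cell_list X)), i))
             (filter (\<lambda>i. \<exists>c\<in>set (cell_list X). cell_colour X c = i) [0..<9]))"

text \<open>The order is by cube and then by colour, with the two \<open>4\<close>-blocks of the
  cube 444444 from left to right. All later numerical data refer to positions in this list.\<close>

definition base :: "affine_type \<Rightarrow> (int \<times> cell set \<times> nat) list" where
  "base T = concat (map (\<lambda>k. map (\<lambda>(S, i). (int k + 1, S, i)) (section_block_list (sections T ! k)))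
     [0..<length (sections T)])"

definition cubes :: "affine_type \<Rightarrow> int" where
  "cubes T = (case T of E6 \<Rightarrow> 6 | E7 \<Rightarrow> 8 | E8 \<Rightarrow> 10)"

definition step :: "affine_type \<Rightarrow> int" where
  "step T = (case T of E6 \<Rightarrow> 12 | E7 \<Rightarrow> 18 | E8 \<Rightarrow> 30)"

text \<open>One step is half a period in types E6 and E8, so an odd number of steps includes a
  rotation; in type E7 it is a full period.\<close>

definition twisted :: "affine_type \<Rightarrow> int \<Rightarrow> bool" where
  "twisted T q \<longleftrightarrow> T \<noteq> E7 \<and> odd q"

definition blk :: "affine_type \<Rightarrow> int \<Rightarrow> block" where
  "blk T n = (let q = n div step T in case base T ! nat (n mod step T) of (k, S, i) \<Rightarrow>
     Block (k + cubes T * q) (if twisted T q then rotate_cell T ` S else S) i)"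

text \<open>Entry \<open>n\<close> holds the offsets from block \<open>n\<close> to the blocks
  directly below it. The table is precomputed and checked against the cells in
  \<open>lies_on_table\<close>.\<close>

definition low_table :: "affine_type \<Rightarrow> int list list" where
  "low_table T = (case T of
    E6 \<Rightarrow> [[-2], [-3, -2], [-2, -1], [-2], [-2, -1], [-2], [-2], [-3, -2], [-2], [-3, -2], [-1], [-3, -2]]
  | E7 \<Rightarrow> [[-2], [-2], [-4, -3], [-3, -1], [-3, -2], [-2, -1], [-2], [-2, -1], [-2], [-2], [-3, -2], [-3], [-3, -2], [-3, -2], [-2], [-3, -2], [-2], [-3, -2]]
  | E8 \<Rightarrow> [[-1], [-4], [-5, -4], [-5, -4], [-3, -2], [-3, -2], [-6, -3], [-3], [-4, -3], [-4, -3], [-3], [-4, -3], [-4, -3], [-2], [-4, -3], [-4, -3], [-3, -1], [-4, -3], [-2, -1], [-3], [-3], [-2], [-4, -3, -2], [-3], [-3, -2], [-3, -2], [-3], [-3, -2], [-3, -2], [-3]])"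

definition colour_table :: "affine_type \<Rightarrow> nat list" where
  "colour_table T = (case T of
    E6 \<Rightarrow> [0, 4, 2, 5, 4, 6, 3, 5, 1, 4, 2, 3]
  | E7 \<Rightarrow> [0, 2, 3, 1, 4, 3, 5, 4, 6, 2, 5, 7, 4, 6, 3, 5, 1, 4]
  | E8 \<Rightarrow> [0, 2, 5, 7, 4, 6, 8, 3, 5, 7, 1, 4, 6, 2, 3, 5, 4, 4, 2, 3, 5, 1, 4, 6, 3, 5, 7, 4, 6, 8])"

definition low :: "affine_type \<Rightarrow> int \<Rightarrow> int list" where
  "low T n = map (\<lambda>d. n + d) (low_table T ! nat (n mod step T))"

definition col :: "affine_type \<Rightarrow> int \<Rightarrow> nat" where
  "col T n = colour_table T ! nat (n mod step T)"


section \<open>The tables of one step, confirmed by evaluation\<close>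

lemma base_colours: "map (snd \<circ> snd) (base T) = colour_table T"
  by (cases T; hypsubst; code_simp)

lemma base_distinct: "distinct (base T)"
  by (cases T; hypsubst; code_simp)


lemma base_cubes: "\<forall>(k, S, i)\<in>set (base T). 1 \<le> k \<and> k \<le> cubes T \<and> (\<forall>c\<in>S. snd c \<in> set [1..<Suc (width T)])"
  by (cases T; hypsubst; code_simp)

text \<open>A block directly below one of the current step sits one cube lower, hence in the same
  step or in the preceding one; this is the range of the second index.\<close>

lemma lies_on_table:
  "\<forall>m\<in>set [0..step T - 1]. \<forall>n\<in>set [- step T..step T - 1]. lies_on (blk T m) (blk T n) \<longleftrightarrow> n \<in> set (low T m)"
  by (cases T; hypsubst; code_simp)

lemma length_base: "length (base T) = nat (step T)"
  using arg_cong[OF base_colours, of length] by (cases T; simp add: colour_table_def step_def)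

lemma length_sections: "length (sections T) = nat (cubes T)"
  by (cases T; simp add: sections_def cubes_def)

lemma step_pos: "0 < step T" and cubes_pos: "0 < cubes T"
  by (cases T; simp add: step_def cubes_def)+

section \<open>Rotations and translations of numbered blocks\<close>

definition grid :: "affine_type \<Rightarrow> cell set" where
  "grid T = UNIV \<times> {1..width T}"

lemma rotate_cell_grid: "c \<in> grid T \<Longrightarrow> rotate_cell T c \<in> grid T"
  by (cases c) (auto simp: grid_def rotate_cell_def)

lemma rotate_cell_rotate_cell: "c \<in> grid T \<Longrightarrow> rotate_cell T (rotate_cell T c) = c"
  by (cases c; cases "fst c") (auto simp: grid_def rotate_cell_def)

lemma rotate_cells_rotate_cells: "S \<subseteq> grid T \<Longrightarrow> rotate_cell T ` rotate_cell T ` S = S"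
  by (force simp: image_image rotate_cell_rotate_cell)

lemma inj_on_rotate_cell: "inj_on (rotate_cell T) (grid T)"
  by (metis inj_on_inverseI rotate_cell_rotate_cell)

lemma base_nth:
  assumes "0 \<le> m" "m < step T"
  shows "base T ! nat m \<in> set (base T)"
  using assms by (intro nth_mem) (simp add: length_base)

lemma base_bounds:
  assumes "base T ! nat (n mod step T) = (k, S, i)"
  shows "1 \<le> k" "k \<le> cubes T" "S \<subseteq> grid T" "i = col T n"
proof -
  have m: "0 \<le> n mod step T" "n mod step T < step T"
    using step_pos[of T] by auto
  have "(k, S, i) \<in> set (base T)"
    using base_nth[OF m] assms by simp
  from bspec[OF base_cubes this] show "1 \<le> k" "k \<le> cubes T" "S \<subseteq> grid T"
    by (auto simp: grid_def simp del: upt_Suc)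
  show "i = col T n"
    unfolding col_def base_colours[symmetric]
    using assms m by (simp add: length_base nat_less_iff)
qed

lemma colour_blk [simp]: "colour (blk T n) = col T n"
  using base_bounds[of T n] by (auto simp: blk_def Let_def split: prod.splits)

lemma cells_blk: "cells (blk T n) \<subseteq> grid T"
proof -
  obtain k S i where b: "base T ! nat (n mod step T) = (k, S, i)"
    by (cases "base T ! nat (n mod step T)") auto
  have "S \<subseteq> grid T" "rotate_cell T ` S \<subseteq> grid T"
    using base_bounds(3)[OF b] rotate_cell_grid by blast+
  then show ?thesis
    unfolding blk_def Let_def b by simp
qed

lemma cube_blk_bounds:
  "cubes T * (n div step T) < cube (blk T n)" "cube (blk T n) \<le> cubes T * (n div step T) + cubes T"
  using base_bounds[of T n] by (auto simp: blk_def Let_def split: prod.splits)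

definition move :: "affine_type \<Rightarrow> int \<Rightarrow> block \<Rightarrow> block" where
  "move T k b = translate_block (cubes T * k) (if twisted T k then rotate_block T b else b)"

lemma blk_shift: "blk T (n + step T * k) = move T k (blk T n)"
proof -
  obtain l S i where b: "base T ! nat (n mod step T) = (l, S, i)"
    by (cases "base T ! nat (n mod step T)") auto
  have S: "S \<subseteq> grid T"
    using base_bounds[OF b] by simp
  have d: "(n + step T * k) div step T = k + n div step T"
    using step_pos[of T] by simp
  show ?thesis
    using b rotate_cells_rotate_cells[OF S]
    unfolding blk_def Let_def d mod_mult_self2
    by (auto simp: move_def translate_block_def rotate_block_def twisted_def algebra_simps)
qed

lemma lies_on_move:
  assumes "cells b \<subseteq> grid T" "cells b' \<subseteq> grid T"
  shows "lies_on (move T k b) (move T k b') \<longleftrightarrow> lies_on b b'"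
proof -
  have "rotate_cell T ` cells b \<inter> rotate_cell T ` cells b' = rotate_cell T ` (cells b \<inter> cells b')"
    using inj_on_rotate_cell assms by (metis inj_on_image_Int)
  then show ?thesis
    by (auto simp: lies_on_def move_def translate_block_def rotate_block_def)
qed

lemma low_shift: "set (low T (n + step T * k)) = (+) (step T * k) ` set (low T n)"
  by (auto simp: low_def image_image algebra_simps)

text \<open>Moving both blocks by the same number of steps brings \<open>n\<close> into the range of
  the table. If \<open>m\<close> then falls outside the range, both sides fail: the cubes are too
  far apart, and the tabulated offsets do not reach that far.\<close>

lemma lies_on_blk: "lies_on (blk T n) (blk T m) \<longleftrightarrow> m \<in> set (low T n)"
proof -
  define k where "k = n div step T"
  define n0 where "n0 = n mod step T"
  define m0 where "m0 = m - step T * k"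
  have n: "n = n0 + step T * k" and m: "m = m0 + step T * k"
    by (auto simp: k_def n0_def m0_def)
  have n0: "0 \<le> n0" "n0 < step T"
    using step_pos[of T] by (auto simp: n0_def)
  have "lies_on (blk T n) (blk T m) \<longleftrightarrow> lies_on (blk T n0) (blk T m0)"
    unfolding n m blk_shift by (intro lies_on_move cells_blk)
  also have "\<dots> \<longleftrightarrow> m0 \<in> set (low T n0)"
  proof (cases "m0 \<in> {- step T..step T - 1}")
    case True
    then show ?thesis
      using lies_on_table[of T] n0 by simp
  next
    case False
    have "set (low T n0) \<subseteq> {- step T..step T - 1}"
    proof -
      have "\<forall>n\<in>set [0..step T - 1]. set (low T n) \<subseteq> set [- step T..step T - 1]" for T
        by (cases T; hypsubst; code_simp)
      then show ?thesis
        using n0 by auto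
    qed
    moreover have "\<not> lies_on (blk T n0) (blk T m0)"
    proof
      assume "lies_on (blk T n0) (blk T m0)"
      then have c: "cube (blk T m0) = cube (blk T n0) - 1"
        by (simp add: lies_on_def)
      have "n0 div step T = 0"
        using n0 by simp
      then have "0 < cube (blk T n0)" "cube (blk T n0) \<le> cubes T"
        using cube_blk_bounds[of T n0] by auto
      then have "cubes T * (m0 div step T) < cubes T * 1" "cubes T * (- 1) \<le> cubes T * (m0 div step T)"
        using c cube_blk_bounds[of T m0] by linarith+
      then have "m0 div step T < 1" "- 1 \<le> m0 div step T"
        by (simp_all only: mult_less_cancel_left_pos[OF cubes_pos] mult_le_cancel_left_pos[OF cubes_pos])
      then have "m0 div step T = 0 \<or> m0 div step T = - 1"
        by linarith
      moreover have "m0 = m0 div step T * step T + m0 mod step T" "0 \<le> m0 mod step T" "m0 mod step T < step T"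
        using step_pos[of T] by auto
      ultimately have "m0 \<in> {- step T..step T - 1}"
        by (elim disjE) simp_all
      with False show False by simp
    qed
    ultimately show ?thesis
      using False by blast
  qed
  also have "\<dots> \<longleftrightarrow> m \<in> set (low T n)"
    unfolding n m low_shift by auto
  finally show ?thesis .
qed

text \<open>Different steps occupy disjoint intervals of cubes, so the cube determines the quotient
  by \<open>step T\<close>. Within a step the rotation can be undone and \<open>base\<close> has
  distinct entries.\<close>

lemma inj_blk: "inj (blk T)"
proof (rule injI)
  fix n m assume eq: "blk T n = blk T m"
  obtain k S i where n: "base T ! nat (n mod step T) = (k, S, i)"
    by (cases "base T ! nat (n mod step T)") auto
  obtain k' S' i' where m: "base T ! nat (m mod step T) = (k', S', i')"
    by (cases "base T ! nat (m mod step T)") auto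
  have "cubes T * (n div step T) < cubes T * (m div step T + 1)"
    "cubes T * (m div step T) < cubes T * (n div step T + 1)"
    using cube_blk_bounds[of T n] cube_blk_bounds[of T m] unfolding eq by (simp_all add: distrib_left)
  then have q: "n div step T = m div step T"
    unfolding mult_less_cancel_left_pos[OF cubes_pos] by simp
  have e: "k = k'" "i = i'"
    "(if twisted T (m div step T) then rotate_cell T ` S else S) = 
     (if twisted T (m div step T) then rotate_cell T ` S' else S')"
    using eq unfolding blk_def Let_def n m by (simp_all add: q)
  moreover have "S = S'"
  proof (cases "twisted T (m div step T)")
    case True
    then have "rotate_cell T ` S = rotate_cell T ` S'"
      using e(3) by simp
    then have "rotate_cell T ` rotate_cell T ` S = rotate_cell T ` rotate_cell T ` S'"
      by (rule arg_cong)
    then show ?thesis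
      unfolding rotate_cells_rotate_cells[OF base_bounds(3)[OF n]] rotate_cells_rotate_cells[OF base_bounds(3)[OF m]] .
  qed (use e(3) in simp)
  ultimately have "base T ! nat (n mod step T) = base T ! nat (m mod step T)"
    unfolding n m by simp
  moreover have "nat (n mod step T) < length (base T)" "nat (m mod step T) < length (base T)"
    unfolding length_base using step_pos[of T] by (simp_all add: nat_less_iff)
  ultimately have "nat (n mod step T) = nat (m mod step T)"
    using nth_eq_iff_index_eq[OF base_distinct] by blast
  moreover have "0 \<le> n mod step T" "0 \<le> m mod step T"
    using step_pos[of T] by simp_all
  ultimately have "n mod step T = m mod step T"
    by (simp only: eq_nat_nat_iff)
  with q have "n div step T * step T + n mod step T = m div step T * step T + m mod step T"
    by simp
  then show "n = m"
    by simp
qed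

section \<open>The numbered blocks are all blocks of the pattern\<close>

lemma row_UNIV: "(UNIV :: row set) = {Upper, Lower}"
  using row.exhaust by auto

lemma set_cell_list: "set (cell_list X) = section_cells X"
proof -
  have "Suc ` {0..<n} = {1..n}" for n
    by (metis One_nat_def atLeastLessThanSuc_atLeastAtMost image_Suc_atLeastLessThan)
  then have "section_cells X = {Upper, Lower} \<times> Suc ` {0..<length (fst X)}"
    by (simp only: section_cells_def row_UNIV)
  also have "\<dots> = set (cell_list X)"
    by (auto simp: cell_list_def simp del: image_Suc_atLeastLessThan)
  finally show ?thesis ..
qed

lemma section_blocks_list:
  assumes "\<forall>c\<in>set (cell_list X). cell_colour X c < 9"
  shows "section_blocks X = set (section_block_list X)"
proof (cases "X = (replicate 6 4, replicate 6 4)")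
  case True
  have "set (filter (\<lambda>c. snd c \<le> 3) (cell_list X)) = UNIV \<times> {1..3}"
    "set (filter (\<lambda>c. 3 < snd c) (cell_list X)) = UNIV \<times> {4..6}"
    by (auto simp: set_cell_list section_cells_def True)
  with True show ?thesis
    by (simp add: section_blocks_def section_block_list_def)
next
  case False
  show ?thesis
    using assms False by (auto simp: section_blocks_def section_block_list_def set_cell_list)
qed

text \<open>The bound 9 justifies the range of colours searched in
  \<open>section_block_list\<close>. The last conjunct says that cutting a cube into blocks commutes
  with rotation, also for the cube 444444, whose halves are exchanged.\<close>

lemma sections_colours:
  "\<forall>X\<in>set (sections T). (\<forall>c\<in>set (cell_list X). cell_colour X c < 9) \<and>
     (\<forall>c\<in>set (cell_list (rotate_section X)). cell_colour (rotate_section X) c < 9) \<and>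
     set (section_block_list (rotate_section X)) = set (map (\<lambda>(S, i). (rotate_cell T ` S, i)) (section_block_list X))"
  by (cases T; hypsubst; code_simp)

lemma section_blocks_rotate:
  assumes "X \<in> set (sections T)"
  shows "section_blocks (rotate_section X) = (\<lambda>(S, i). (rotate_cell T ` S, i)) ` section_blocks X"
  using sections_colours[of T] assms by (simp add: section_blocks_list)

lemma in_base_iff:
  "(k, S, i) \<in> set (base T) \<longleftrightarrow>
     1 \<le> k \<and> k \<le> cubes T \<and> (S, i) \<in> section_blocks (sections T ! nat (k - 1))"
proof -
  have *: "section_blocks (sections T ! j) = set (section_block_list (sections T ! j))" if "j < nat (cubes T)" for j
  proof -
    have "sections T ! j \<in> set (sections T)"
      using that by (simp add: length_sections)
    from bspec[OF sections_colours this] show ?thesis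
      by (simp add: section_blocks_list)
  qed
  have "(k, S, i) \<in> set (base T) \<longleftrightarrow>
     (\<exists>j<nat (cubes T). k = int j + 1 \<and> (S, i) \<in> section_blocks (sections T ! j))"
    using * by (force simp: base_def length_sections)
  also have "\<dots> \<longleftrightarrow> 1 \<le> k \<and> k \<le> cubes T \<and> (S, i) \<in> section_blocks (sections T ! nat (k - 1))"
    by (auto intro!: exI[of _ "nat (k - 1)"])
  finally show ?thesis .
qed

lemma range_blk: "range (blk T) = column_pattern T"
proof -
  have "b \<in> range (blk T) \<longleftrightarrow> b \<in> column_pattern T" for b
  proof -
    define q where "q = (cube b - 1) div cubes T"
    define j where "j = (cube b - 1) mod cubes T"
    define X where "X = sections T ! nat j"
    have j: "0 \<le> j" "j < cubes T" and k: "cube b = j + 1 + cubes T * q"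
      using cubes_pos[of T] by (auto simp: j_def q_def)
    have X: "X \<in> set (sections T)"
      using j by (auto simp: X_def length_sections intro!: nth_mem)
    have "b \<in> column_pattern T \<longleftrightarrow>
      (cells b, colour b) \<in> section_blocks (if twisted T q then rotate_section X else X)"
      using cubes_pos[of T]
      by (auto simp: column_pattern_def pattern_def cube_section_def Let_def length_sections twisted_def
        q_def j_def X_def)
    also have "\<dots> \<longleftrightarrow> (\<exists>S. (S, colour b) \<in> section_blocks X \<and> cells b = (if twisted T q then rotate_cell T ` S else S))"
      using section_blocks_rotate[OF X] by (auto simp: image_iff intro: rev_bexI)
    also have "\<dots> \<longleftrightarrow> (\<exists>S. (j + 1, S, colour b) \<in> set (base T) \<and> cells b = (if twisted T q then rotate_cell T ` S else S))"
      unfolding in_base_iff using j by (simp add: X_def)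
    also have "\<dots> \<longleftrightarrow> b \<in> range (blk T)"
    proof
      assume "\<exists>S. (j + 1, S, colour b) \<in> set (base T) \<and> cells b = (if twisted T q then rotate_cell T ` S else S)"
      then obtain S m where "m < nat (step T)" "base T ! m = (j + 1, S, colour b)"
        and S: "cells b = (if twisted T q then rotate_cell T ` S else S)"
        by (metis in_set_conv_nth length_base)
      then have m: "int m < step T" "base T ! nat (int m) = (j + 1, S, colour b)"
        by auto
      have "blk T (int m + step T * q) = b"
        using m S k step_pos[of T] by (cases b) (simp add: blk_def)
      then show "b \<in> range (blk T)"
        by blast
    next
      assume "b \<in> range (blk T)"
      then obtain n where n: "b = blk T n"
        by blast
      obtain l S i where b: "base T ! nat (n mod step T) = (l, S, i)"
        by (cases "base T ! nat (n mod step T)") auto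
      have l: "1 \<le> l" "l \<le> cubes T"
        using base_bounds[OF b] by auto
      have c: "cube b - 1 = (l - 1) + n div step T * cubes T"
        unfolding n blk_def Let_def b by simp
      have "j = l - 1" "q = n div step T"
        unfolding j_def q_def c using l by auto
      moreover have "(l, S, i) \<in> set (base T)"
        using base_nth[of "n mod step T" T] b step_pos[of T] by simp
      ultimately show "\<exists>S. (j + 1, S, colour b) \<in> set (base T) \<and> cells b = (if twisted T q then rotate_cell T ` S else S)"
        unfolding n blk_def Let_def b by auto
    qed
    finally show ?thesis by blast
  qed
  then show ?thesis by blast
qed

section \<open>Columns as sets of integers\<close>

definition closed :: "affine_type \<Rightarrow> int set \<Rightarrow> bool" where
  "closed T y \<longleftrightarrow> (\<forall>n\<in>y. set (low T n) \<subseteq> y)"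

definition ideal :: "affine_type \<Rightarrow> int set \<Rightarrow> bool" where
  "ideal T y \<longleftrightarrow> y \<noteq> {} \<and> (\<exists>N. y \<subseteq> {..N}) \<and> closed T y"

definition shift :: "affine_type \<Rightarrow> int \<Rightarrow> int set \<Rightarrow> int set" where
  "shift T k y = (\<lambda>n. n + step T * k) ` y"

text \<open>In type E8 the cubes up to 4 end at number 12, and cubes 5, 6 and 7 consist of 13 to 15,
  16 and 17, 18 to 20. Number 17 is the right \<open>4\<close>-block of cube 6; 18 is the
  \<open>2\<close>-block of cube 7.\<close>

definition spec1 :: "int set" where "spec1 = {..12} \<union> {14, 15, 17}"
definition spec2 :: "int set" where "spec2 = {..15} \<union> {17, 18}"

definition special :: "int set \<Rightarrow> bool" where
  "special y \<longleftrightarrow> (\<exists>k. y = shift E8 k spec1 \<or> y = shift E8 k spec2)"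

definition young :: "affine_type \<Rightarrow> int set \<Rightarrow> bool" where
  "young T y \<longleftrightarrow> ideal T y \<or> T = E8 \<and> special y"

text \<open>Everything reachable downwards in at most \<open>l\<close> steps, as an executable list;
  the numbers 13, 15 and 20 used as \<open>l\<close> below are depths at which the evaluations
  succeed.\<close>

fun down :: "affine_type \<Rightarrow> nat \<Rightarrow> int list \<Rightarrow> int list" where
  "down T 0 ns = ns"
| "down T (Suc l) ns = ns @ down T l (remdups (concat (map (low T) ns)))"

lemma down_subset: "closed T y \<Longrightarrow> set ns \<subseteq> y \<Longrightarrow> set (down T l ns) \<subseteq> y"
proof (induction l arbitrary: ns)
  case (Suc l)
  have "set (remdups (concat (map (low T) ns))) \<subseteq> y"
    using Suc.prems by (auto simp: closed_def)
  then show ?case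
    using Suc by simp
qed simp

lemma down_mem: "closed T y \<Longrightarrow> n \<in> y \<Longrightarrow> m \<in> set (down T l [n]) \<Longrightarrow> m \<in> y"
  using down_subset[of T y "[n]" l] by auto

lemma mem_shift: "n \<in> shift T k y \<longleftrightarrow> n - step T * k \<in> y"
  unfolding shift_def by (auto intro: image_eqI[of _ _ "n - step T * k"])

lemma shift_shift [simp]: "shift T k (shift T l y) = shift T (k + l) y"
  by (auto simp: mem_shift algebra_simps)

lemma shift_0 [simp]: "shift T 0 y = y"
  by (auto simp: mem_shift)

lemma shift_eq_iff: "shift T k x = y \<longleftrightarrow> x = shift T (- k) y"
  by auto

lemma shift_insert: "shift T k (insert n y) = insert (n + step T * k) (shift T k y)"
  by (simp add: shift_def)

lemma shift_Diff: "shift T k (y - {n}) = shift T k y - {n + step T * k}"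
  by (auto simp: mem_shift algebra_simps)

lemma shift_subset_iff: "shift T k x \<subseteq> shift T k y \<longleftrightarrow> x \<subseteq> y"
  by (auto simp: shift_def)

lemma col_shift [simp]: "col T (n + step T * k) = col T n"
  by (simp add: col_def)

lemma col_shift_diff [simp]: "col T (n - step T * k) = col T n"
  using col_shift[of T n "- k"] by (simp del: col_shift)

lemma closed_shift: "closed T (shift T k y) \<longleftrightarrow> closed T y"
proof -
  have *: "closed T (shift T k y)" if "closed T y" for k y
    unfolding closed_def shift_def using that low_shift[of T _ k] by (auto simp: closed_def add.commute)
  from *[of y k] *[of "shift T k y" "- k"] show ?thesis
    by auto
qed

lemma ideal_shift: "ideal T (shift T k y) \<longleftrightarrow> ideal T y"
proof -
  have *: "\<exists>N. shift T k y \<subseteq> {..N}" if "y \<subseteq> {..N}" for k N y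
    using that by (intro exI[of _ "N + step T * k"]) (auto simp: shift_def)
  from *[of y _ k] *[of "shift T k y" _ "- k"] show ?thesis
    by (auto simp: ideal_def closed_shift) (auto simp: shift_def)
qed

lemma special_shift: "special (shift E8 k y) \<longleftrightarrow> special y"
proof -
  have *: "special (shift E8 k y)" if "special y" for k y
    using that by (auto simp: special_def)
  from *[of y k] *[of "shift E8 k y" "- k"] show ?thesis
    by auto
qed

lemma young_shift: "young T (shift T k y) \<longleftrightarrow> young T y"
  by (auto simp: young_def ideal_shift special_shift)

lemma table_shift:
  assumes "\<forall>n\<in>set [0..step T - 1]. P n" "\<And>n k. P n \<Longrightarrow> P (n + step T * k)"
  shows "P n"
proof -
  have "P (n mod step T)"
    using step_pos[of T] by (intro bspec[OF assms(1)]) simp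
  from assms(2)[OF this, of "n div step T"] show ?thesis
    by simp
qed

section \<open>How far a block forces the blocks below it\<close>

lemma low_bounds: "low T n \<noteq> [] \<and> set (low T n) \<subseteq> {n - 6..n - 1} \<and> (\<forall>m\<in>set (low T n). col T m \<noteq> col T n)"
proof (rule table_shift[where T = T])
  have "\<forall>n\<in>set [0..step T - 1]. low T n \<noteq> [] \<and> set (low T n) \<subseteq> set [n - 6..n - 1] \<and> (\<forall>m\<in>set (low T n). col T m \<noteq> col T n)"
    by (cases T; hypsubst; code_simp)
  then show "\<forall>n\<in>set [0..step T - 1]. low T n \<noteq> [] \<and> set (low T n) \<subseteq> {n - 6..n - 1} \<and> (\<forall>m\<in>set (low T n). col T m \<noteq> col T n)"
    by simp
next
  fix n k
  assume "low T n \<noteq> [] \<and> set (low T n) \<subseteq> {n - 6..n - 1} \<and> (\<forall>m\<in>set (low T n). col T m \<noteq> col T n)"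
  then show "low T (n + step T * k) \<noteq> [] \<and> set (low T (n + step T * k)) \<subseteq> {n + step T * k - 6..n + step T * k - 1} \<and>
    (\<forall>m\<in>set (low T (n + step T * k)). col T m \<noteq> col T (n + step T * k))"
    using low_shift[of T n k] by (auto simp: low_def add.commute[of "step T * k"])
qed

text \<open>The bound 6 matches the largest offset in \<open>low_table\<close>. It makes six
  consecutive elements sufficient for filling a closed set downwards.\<close>

lemma covered: "\<exists>m\<in>{n + 1..n + 6}. n \<in> set (low T m)"
proof (rule table_shift[where T = T])
  have "\<forall>n\<in>set [0..step T - 1]. \<exists>m\<in>set [n + 1..n + 6]. n \<in> set (low T m)"
    by (cases T; hypsubst; code_simp)
  then show "\<forall>n\<in>set [0..step T - 1]. \<exists>m\<in>{n + 1..n + 6}. n \<in> set (low T m)"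
    by simp
next
  fix n k
  assume "\<exists>m\<in>{n + 1..n + 6}. n \<in> set (low T m)"
  then obtain m where "m \<in> {n + 1..n + 6}" "n \<in> set (low T m)"
    by blast
  then show "\<exists>m\<in>{n + step T * k + 1..n + step T * k + 6}. n + step T * k \<in> set (low T m)"
    using low_shift[of T m k] by (intro bexI[of _ "m + step T * k"]) (auto simp: image_iff)
qed

lemma col_index: "col T n \<in> index_set T"
proof (rule table_shift[where T = T])
  have "\<forall>i\<in>set (colour_table T). i \<in> index_set T"
    by (cases T) (auto simp: colour_table_def index_set_def)
  moreover have "length (colour_table T) = nat (step T)"
    by (simp add: length_base flip: base_colours)
  ultimately show "\<forall>n\<in>set [0..step T - 1]. col T n \<in> index_set T"
    by (auto simp: col_def)
qed simp

lemma col_eq_0_iff: "col T n = 0 \<longleftrightarrow> step T dvd n"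
proof (rule table_shift[where T = T])
  have "\<forall>n\<in>set [0..step T - 1]. col T n = 0 \<longleftrightarrow> n = 0"
    by (cases T; hypsubst; code_simp)
  then show "\<forall>n\<in>set [0..step T - 1]. col T n = 0 \<longleftrightarrow> step T dvd n"
    by (auto simp: dvd_eq_mod_eq_0)
qed (simp add: dvd_add_left_iff)

text \<open>The distance below a block beyond which that block forces all others. In type E8 it has
  to be at least a whole step, since the \<open>0\<close>-blocks 0 and 30 are incomparable.\<close>

definition gap :: "affine_type \<Rightarrow> int" where
  "gap T = (case T of E6 \<Rightarrow> 5 | E7 \<Rightarrow> 11 | E8 \<Rightarrow> 30)"

lemma gap_le: "0 < gap T" "gap T \<le> 30"
  by (cases T; simp add: gap_def)+

lemma window_table:
  "\<forall>n\<in>set [0..step T - 1]. set [n - gap T - 6..n - gap T - 1] \<subseteq> set (down T 15 [n])"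
  by (cases T; hypsubst; code_simp)

text \<open>The integer just below the part already filled is directly below one of the six integers
  above it, so the filling descends one integer at a time.\<close>

lemma closed_below:
  assumes "closed T y" "{a..a + 5} \<subseteq> y" "m \<le> a"
  shows "m \<in> y"
proof -
  have "{a - int d..a + 5} \<subseteq> y" for d
  proof (induction d)
    case (Suc d)
    obtain l where l: "l \<in> {a - int d..a - int d + 5}" "a - int d - 1 \<in> set (low T l)"
      using covered[of "a - int d - 1" T] by (auto simp: algebra_simps)
    with Suc have "l \<in> y"
      by auto
    with l assms(1) have "a - int d - 1 \<in> y"
      by (auto simp: closed_def)
    moreover have "{a - int (Suc d)..a + 5} = insert (a - int d - 1) {a - int d..a + 5}"
      by auto
    ultimately show ?case
      using Suc by simp
  qed (use assms in simp)
  from this[of "nat (a - m)"] assms(3) show ?thesis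
    by auto
qed

text \<open>After a translation \<open>n\<close> lies in the tabulated step. Evaluation finds six
  consecutive integers under \<open>n\<close>, just below \<open>n - gap T\<close>, and from there
  \<open>closed_below\<close> takes over.\<close>

lemma closed_window:
  assumes "closed T y" "n \<in> y" "m < n - gap T"
  shows "m \<in> y"
proof -
  define k where "k = n div step T"
  define n0 where "n0 = n mod step T"
  define z where "z = shift T (- k) y"
  have n: "n = n0 + step T * k"
    by (simp add: k_def n0_def)
  have z: "n0 \<in> z" "closed T z"
    using assms by (simp_all add: mem_shift closed_shift n z_def)
  then have "set (down T 15 [n0]) \<subseteq> z"
    by (intro down_subset) auto
  moreover have "set [n0 - gap T - 6..n0 - gap T - 1] \<subseteq> set (down T 15 [n0])"
    using step_pos[of T] by (intro bspec[OF window_table]) (simp add: n0_def)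
  ultimately have w: "{n0 - gap T - 6..n0 - gap T - 1} \<subseteq> z"
    by simp
  have "m - step T * k \<in> z"
  proof (cases "m - step T * k \<le> n0 - gap T - 6")
    case True
    with closed_below[OF z(2)] w show ?thesis
      by fastforce
  next
    case False
    with w assms(3) n show ?thesis
      by auto
  qed
  then show ?thesis
    by (simp add: mem_shift z_def)
qed

section \<open>Incomparable blocks of the same colour\<close>

text \<open>In \<open>(i, P, Q, b, xs)\<close> the blocks \<open>P\<close> and \<open>Q\<close> are
  incomparable of colour \<open>i\<close>, and \<open>upto_set b xs\<close> is the column to which
  both can be added. The order matters: \<open>P\<close> is the block that rule (a) adds first,
  \<open>Q\<close> the one it removes first. The number \<open>b\<close> is the smaller of the two,
  hence the first block missing from the column.\<close>

definition pairs :: "(nat \<times> int \<times> int \<times> int \<times> int list) list" where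
  "pairs = [(0, 30, 0, 0, [1, 2, 3, 4, 5, 7, 8, 10, 11, 13, 14, 17, 20, 23, 26, 29]),
     (8, 29, 6, 6, [7, 8, 10, 11, 13, 14, 17, 20, 23, 26]),
     (7, 26, 9, 9, [10, 11, 13, 14, 17, 20, 23]),
     (6, 23, 12, 12, [13, 14, 17, 20]),
     (5, 20, 15, 15, [17]),
     (4, 16, 17, 16, []),
     (3, 19, 14, 14, [15, 16]),
     (1, 21, 10, 10, [11, 12, 13, 15, 16, 19])]"

definition incomparable :: "affine_type \<Rightarrow> int \<Rightarrow> int \<Rightarrow> bool" where
  "incomparable T p q \<longleftrightarrow> T = E8 \<and> (\<exists>(i, P, Q, b, xs)\<in>set pairs.
     min P Q - p = max P Q - q \<and> (max P Q - q) mod step T = 0)"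

text \<open>Blocks more than \<open>gap T\<close> below \<open>q\<close> are forced by
  \<open>q\<close> anyway, so only this window can contain a block incomparable to
  \<open>q\<close>.\<close>

lemma incomparable_table:
  "\<forall>q\<in>set [0..step T - 1]. set (filter (\<lambda>p. col T p = col T q \<and> \<not> incomparable T p q) [q - gap T..q - 1])
     \<subseteq> set (down T 13 [q])"
  by (cases T; hypsubst; code_simp)

lemma pairs_table:
  "\<forall>(i, P, Q, b, xs)\<in>set pairs. P \<noteq> Q \<and> col E8 P = i \<and> col E8 Q = i \<and> b = min P Q \<and> max P Q \<le> b + 30 \<and>
     (\<forall>x\<in>set xs. b \<le> x \<and> x \<le> b + 30 \<and> x \<noteq> P \<and> x \<noteq> Q) \<and>
     set (filter (\<lambda>n. n < b \<or> n \<in> set xs) [b - 31..b + 30]) \<subseteq> set (down E8 20 [P, Q]) \<and> 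
     (\<forall>n\<in>set [b..b + 31]. n \<in> set xs \<or> P \<in> set (down E8 13 [n]) \<or> Q \<in> set (down E8 13 [n]))"
  by code_simp

text \<open>The block \<open>q\<close> does not force \<open>p\<close>, so \<open>p\<close> lies in
  the window of length \<open>gap T\<close> below \<open>q\<close> and is missing from the tabulated
  downward closure; a translation makes the table applicable.\<close>

lemma same_colour_cases:
  assumes "closed T y" "q \<in> y" "p \<notin> y" "p < q" "col T p = col T q"
  shows "T = E8 \<and> (\<exists>i P Q b xs k. (i, P, Q, b, xs) \<in> set pairs \<and> p = min P Q + step T * k \<and> q = max P Q + step T * k)"
proof -
  define k where "k = q div step T"
  define q0 where "q0 = q mod step T"
  define p0 where "p0 = p - step T * k"
  define z where "z = shift T (- k) y"
  have q: "q = q0 + step T * k" and p: "p = p0 + step T * k"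
    by (simp_all add: k_def q0_def p0_def)
  have z: "closed T z" "q0 \<in> z" "p0 \<notin> z"
    using assms by (simp_all add: mem_shift closed_shift p q z_def)
  have "\<not> p0 < q0 - gap T"
    using closed_window[OF z(1,2)] z(3) by blast
  then have "p0 \<in> set [q0 - gap T..q0 - 1]"
    using assms(4) by (simp add: p q)
  moreover have "col T p0 = col T q0"
    using assms(5) by (simp add: p q)
  moreover have "p0 \<notin> set (down T 13 [q0])"
    using down_mem[OF z(1,2)] z(3) by blast
  moreover have "set (filter (\<lambda>p. col T p = col T q0 \<and> \<not> incomparable T p q0) [q0 - gap T..q0 - 1])
     \<subseteq> set (down T 13 [q0])"
    using step_pos[of T] by (intro bspec[OF incomparable_table]) (simp add: q0_def)
  ultimately have "p0 \<notin> set (filter (\<lambda>p. col T p = col T q0 \<and> \<not> incomparable T p q0) [q0 - gap T..q0 - 1])"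
    by blast
  with \<open>p0 \<in> _\<close> \<open>col T p0 = col T q0\<close> have "incomparable T p0 q0"
    unfolding set_filter mem_Collect_eq by blast
  then obtain t where "T = E8" and t: "t \<in> set pairs"
    "case t of (i, P, Q, b, xs) \<Rightarrow> min P Q - p0 = max P Q - q0 \<and> (max P Q - q0) mod step T = 0"
    unfolding incomparable_def by (elim conjE bexE)
  obtain i P Q b xs where "t = (i, P, Q, b, xs)"
    by (rule prod_cases5)
  with t have i: "(i, P, Q, b, xs) \<in> set pairs"
    and *: "min P Q - p0 = max P Q - q0" "(max P Q - q0) mod step T = 0"
    by (simp_all only: prod.case)
  from *(2) have "step T dvd max P Q - q0"
    by (simp add: dvd_eq_mod_eq_0)
  then obtain l where "max P Q - q0 = step T * l" ..
  with *(1) have "p0 = min P Q - step T * l" "q0 = max P Q - step T * l"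
    by linarith+
  then have "p = min P Q + step T * (k - l)" "q = max P Q + step T * (k - l)"
    unfolding p q by (simp_all add: right_diff_distrib)
  with \<open>T = E8\<close> i show ?thesis
    by (intro conjI exI)
qed

text \<open>A column contains all sufficiently low blocks, so a cutoff and a finite list describe
  it. This is the form in which concrete columns enter evaluations.\<close>

definition upto_set :: "int \<Rightarrow> int list \<Rightarrow> int set" where
  "upto_set b xs = {..<b} \<union> set xs"

lemma pairsD:
  assumes "(i, P, Q, b, xs) \<in> set pairs"
  shows "P \<noteq> Q" "col E8 P = i" "col E8 Q = i" "b = min P Q" "b \<le> P \<and> b \<le> Q" "P \<le> b + 30" "Q \<le> b + 30"
    "\<forall>x\<in>set xs. b \<le> x \<and> x \<le> b + 30" "P \<notin> set xs" "Q \<notin> set xs"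
    "P \<notin> upto_set b xs" "Q \<notin> upto_set b xs"
    "set (filter (\<lambda>n. n < b \<or> n \<in> set xs) [b - 31..b + 30]) \<subseteq> set (down E8 20 [P, Q])"
    "\<forall>n\<in>set [b..b + 31]. n \<in> set xs \<or> P \<in> set (down E8 13 [n]) \<or> Q \<in> set (down E8 13 [n])"
proof -
  note * = bspec[OF pairs_table assms, unfolded prod.case]
  show 1: "P \<noteq> Q" "col E8 P = i" "col E8 Q = i" "b = min P Q"
    "set (filter (\<lambda>n. n < b \<or> n \<in> set xs) [b - 31..b + 30]) \<subseteq> set (down E8 20 [P, Q])"
    "\<forall>n\<in>set [b..b + 31]. n \<in> set xs \<or> P \<in> set (down E8 13 [n]) \<or> Q \<in> set (down E8 13 [n])"
    using * by - (elim conjE, assumption)+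
  then show "b \<le> P \<and> b \<le> Q"
    by simp
  have "max P Q \<le> b + 30"
    using * by blast
  then show "P \<le> b + 30" "Q \<le> b + 30"
    by simp_all
  have "\<forall>x\<in>set xs. b \<le> x \<and> x \<le> b + 30 \<and> x \<noteq> P \<and> x \<noteq> Q"
    using * by - (elim conjE, assumption)+
  then show 2: "\<forall>x\<in>set xs. b \<le> x \<and> x \<le> b + 30" "P \<notin> set xs" "Q \<notin> set xs"
    by blast+
  show "P \<notin> upto_set b xs" "Q \<notin> upto_set b xs"
    using 1(4) 2(2,3) by (simp_all add: upto_set_def)
qed

text \<open>Every block below \<open>P\<close> or \<open>Q\<close> must be present and every block
  above one of them must be absent. Within about a step around \<open>b\<close> the table shows that
  these two conditions leave no freedom; further away \<open>closed_window\<close> decides.\<close>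

lemma pair_determines:
  assumes pr: "(i, P, Q, b, xs) \<in> set pairs"
    and z: "P \<notin> z" "Q \<notin> z" "closed E8 (insert P z)" "closed E8 (insert Q z)"
  shows "z = upto_set b xs"
proof -
  note pr = pairsD[OF pr]
  have cz: "closed E8 z"
    using z(3,4) pr(1) z(1,2) unfolding closed_def by fast
  have cl: "closed E8 (insert P (insert Q z))"
    using z(3,4) by (auto simp: closed_def)
  have dn: "set (down E8 20 [P, Q]) \<subseteq> insert P (insert Q z)"
    by (rule down_subset[OF cl]) auto
  have up: "n \<notin> z" if "P \<in> set (down E8 13 [n]) \<or> Q \<in> set (down E8 13 [n])" for n
    using down_mem[OF cz] that z(1,2) by blast
  have w: "m \<in> z" if "n \<in> z" "m < n - 30" for m n
    using closed_window[OF cz that(1), of m] that(2) gap_le(2)[of E8] by linarith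
  have w': "m \<in> insert P z" if "m < P - 30" for m
    using closed_window[OF z(3), of P m] that gap_le(2)[of E8] by force
  show ?thesis
  proof (intro set_eqI iffI)
    fix n assume n: "n \<in> z"
    show "n \<in> upto_set b xs"
    proof (rule ccontr)
      assume *: "n \<notin> upto_set b xs"
      have "n \<le> b + 31"
      proof (rule ccontr)
        assume "\<not> n \<le> b + 31"
        then have "b \<in> z"
          using w[OF n] by simp
        with z(1,2) pr(4) show False by (auto simp: min_def split: if_splits)
      qed
      with * pr(14) have "P \<in> set (down E8 13 [n]) \<or> Q \<in> set (down E8 13 [n])"
        by (auto simp: upto_set_def)
      with up n show False by blast
    qed
  next
    fix n assume n: "n \<in> upto_set b xs"
    show "n \<in> z"
    proof (cases "b - 31 \<le> n")
      case True
      then have "n \<in> set (down E8 20 [P, Q])"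
        using n pr(8,13) by (auto simp: upto_set_def)
      with dn n pr(11,12) show ?thesis by blast
    next
      case False
      with w'[of n] n pr(5,11) show ?thesis by auto
    qed
  qed
qed

definition pair :: "nat \<Rightarrow> int \<Rightarrow> int \<Rightarrow> int set \<Rightarrow> bool" where
  "pair i P Q y \<longleftrightarrow> (\<exists>b xs. (i, P, Q, b, xs) \<in> set pairs \<and> y = upto_set b xs)"

definition paired :: "affine_type \<Rightarrow> int set \<Rightarrow> int \<Rightarrow> int \<Rightarrow> bool" where
  "paired T x p q \<longleftrightarrow>
     T = E8 \<and> (\<exists>k P Q. pair (col T p) P Q (shift T k x) \<and> {p + step T * k, q + step T * k} = {P, Q})"

text \<open>Only in type E8 can a column have two addable blocks of the same colour, and then it is known.\<close>

lemma two_addable_ideal: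
  assumes "closed T (insert p x)" "closed T (insert q x)" "p \<notin> x" "q \<notin> x" "p \<noteq> q" "col T p = col T q"
  shows "paired T x p q"
  using assms unfolding paired_def
proof (induction p q rule: linorder_wlog)
  case (le p q)
  then have "p < q"
    by simp
  then have "T = E8 \<and> (\<exists>i P Q b xs k. (i, P, Q, b, xs) \<in> set pairs \<and> p = min P Q + step T * k \<and> q = max P Q + step T * k)"
    using le by (intro same_colour_cases[of T "insert q x"]) auto
  then obtain i P Q b xs k where T: "T = E8" and i: "(i, P, Q, b, xs) \<in> set pairs"
    and pq: "p = min P Q + step T * k" "q = max P Q + step T * k"
    by (elim conjE exE)
  define z where "z = shift T (- k) x"
  have PQ: "{p + step T * - k, q + step T * - k} = {P, Q}"
    by (auto simp: pq min_def max_def)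
  have ins: "shift T (- k) (insert p x) = insert (min P Q) z" "shift T (- k) (insert q x) = insert (max P Q) z"
    by (simp_all add: shift_insert z_def pq)
  have "closed E8 (insert (min P Q) z)" "closed E8 (insert (max P Q) z)"
    using le(2,3) T closed_shift[of T "- k"] unfolding ins[symmetric] by simp_all
  then have cl: "closed E8 (insert P z)" "closed E8 (insert Q z)"
    by (auto simp: min_def max_def split: if_splits)
  have "min P Q \<notin> z" "max P Q \<notin> z"
    using le(4,5) by (simp_all add: z_def mem_shift pq)
  then have "P \<notin> z" "Q \<notin> z"
    by (auto simp: min_def max_def split: if_splits)
  from pair_determines[OF i this cl] have "pair i P Q z"
    using i unfolding pair_def by blast
  moreover have "col T p = i"
    using pairsD(2,3)[OF i] T by (simp add: pq min_def)
  ultimately show ?case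
    using T PQ unfolding z_def by metis
next
  case (sym p q)
  then show ?case
    by (metis insert_commute)
qed

lemma pairD:
  assumes "pair i P Q y"
  shows "P \<noteq> Q" "P \<notin> y" "Q \<notin> y" "col E8 P = i" "col E8 Q = i"
proof -
  obtain b xs where i: "(i, P, Q, b, xs) \<in> set pairs" and y: "y = upto_set b xs"
    using assms unfolding pair_def by blast
  show "P \<noteq> Q" "P \<notin> y" "Q \<notin> y" "col E8 P = i" "col E8 Q = i"
    unfolding y by (rule pairsD[OF i])+
qed

section \<open>Addable and removable blocks of explicit columns\<close>

text \<open>An added block rests on one at most 6 below it, which is already present; hence the
  upper end of the search. Nothing below \<open>b\<close> is missing.\<close>

definition added :: "affine_type \<Rightarrow> int \<Rightarrow> int list \<Rightarrow> int list" where
  "added T b xs = filter (\<lambda>n. n \<notin> set xs \<and> list_all (\<lambda>m. m < b \<or> m \<in> set xs) (low T n)) [b..fold max xs b + 6]"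

text \<open>A block below \<open>b - 6\<close> carries another block that is still below
  \<open>b\<close> and therefore present, so the search may start at \<open>b - 6\<close>.\<close>

definition removed :: "affine_type \<Rightarrow> int \<Rightarrow> int list \<Rightarrow> int list" where
  "removed T b xs = filter (\<lambda>n. (n < b \<or> n \<in> set xs) \<and>
     list_all (\<lambda>m. m < b \<or> m \<in> set xs \<longrightarrow> n \<notin> set (low T m)) [n + 1..n + 6]) [b - 6..fold max xs b]"

lemma upto_set_le:
  assumes "n \<in> upto_set b xs"
  shows "n \<le> fold max xs b"
proof -
  have "fold max xs b = Max (set (b # xs))"
    by (rule Max.set_eq_fold[symmetric])
  moreover have "b \<le> Max (set (b # xs))" "n \<in> set xs \<Longrightarrow> n \<le> Max (set (b # xs))"
    by simp_all
  moreover have "n < b \<or> n \<in> set xs"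
    using assms by (simp add: upto_set_def)
  ultimately show ?thesis
    by linarith
qed

lemma closed_insert_upto:
  assumes "closed T (insert n (upto_set b xs))" "n \<notin> upto_set b xs"
  shows "n \<in> set (added T b xs)"
proof -
  have l: "set (low T n) \<subseteq> upto_set b xs"
    using assms(1) low_bounds[of T n] unfolding closed_def by fastforce
  obtain m where m: "m \<in> set (low T n)" "n - 6 \<le> m"
    using low_bounds[of T n] by (cases "low T n") auto
  with l have "m \<le> fold max xs b"
    using upto_set_le by blast
  with m l assms(2) show ?thesis
    by (auto simp: added_def list_all_iff upto_set_def)
qed

lemma closed_remove_upto:
  assumes "closed T (upto_set b xs - {n})" "n \<in> upto_set b xs"
  shows "n \<in> set (removed T b xs)"
proof -
  have c: "n \<notin> set (low T m)" if "m \<in> upto_set b xs" "n < m" for m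
    using assms(1) that unfolding closed_def by fastforce
  have "b - 6 \<le> n"
  proof (rule ccontr)
    assume *: "\<not> b - 6 \<le> n"
    obtain m where "m \<in> {n + 1..n + 6}" "n \<in> set (low T m)"
      using covered[of n T] by blast
    with c[of m] * show False
      by (simp add: upto_set_def)
  qed
  moreover have "n \<le> fold max xs b"
    using assms(2) by (rule upto_set_le)
  ultimately show ?thesis
    using c assms(2) by (auto simp: removed_def list_all_iff upto_set_def)
qed

lemma shift_eqD: "shift T k x = y \<Longrightarrow> x = shift T (- k) y"
  by auto

section \<open>Steps through the special columns\<close>

lemma spec1_upto: "spec1 = upto_set 13 [14, 15, 17]" and spec2_upto: "spec2 = upto_set 16 [17, 18]"
  by (auto simp: spec1_def spec2_def upto_set_def)

text \<open>The four insertions that start or end at a special column, up to translation. The first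
  two are the \<open>2\<close>-string from \<open>spec1\<close> to \<open>spec2\<close>; the third
  enters \<open>spec1\<close> and the fourth leaves \<open>spec2\<close>, both by a
  \<open>4\<close>-block.\<close>

definition special_steps :: "(int set \<times> int) list" where
  "special_steps = [(upto_set 13 [14, 15, 17], 13), (upto_set 16 [17], 18), (upto_set 13 [14, 15], 17), (upto_set 16 [17, 18], 16)]"

lemma not_closed_special: "\<not> closed E8 (upto_set 13 [14, 15, 17])" "\<not> closed E8 (upto_set 16 [17, 18])"
proof -
  have "13 \<in> set (low E8 17)" "16 \<in> set (low E8 18)"
    by code_simp+
  moreover have "17 \<in> upto_set 13 [14, 15, 17]" "13 \<notin> upto_set 13 [14, 15, 17]"
    "18 \<in> upto_set 16 [17, 18]" "16 \<notin> upto_set 16 [17, 18]"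
    by (auto simp: upto_set_def)
  ultimately show "\<not> closed E8 (upto_set 13 [14, 15, 17])" "\<not> closed E8 (upto_set 16 [17, 18])"
    unfolding closed_def by blast+
qed

lemma least_missing:
  assumes "{..<a} \<subseteq> x" "a \<notin> x" "{..<b} \<subseteq> x" "b \<notin> (x :: int set)"
  shows "a = b"
  using assms by (metis lessThan_iff linorder_neqE subsetD)

lemma shift_upto_missing:
  assumes "a \<notin> set xs" 
  shows "{..<a + step T * k} \<subseteq> shift T k (upto_set a xs)" "a + step T * k \<notin> shift T k (upto_set a xs)"
  using assms by (auto simp: mem_shift upto_set_def)

lemma shift_upto_eqD:
  assumes "shift T k (upto_set a xs) = shift T l (upto_set b ys)" "a \<notin> set xs" "b \<notin> set ys"
  shows "a + step T * k = b + step T * l"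
  using assms shift_upto_missing[of a xs T k] shift_upto_missing[of b ys T l]
  by (intro least_missing[of _ "shift T k (upto_set a xs)"]) auto

text \<open>Adding a block different from the first missing one cannot turn a special column into a special column.\<close>

lemma special_insert:
  assumes "young E8 (insert n x)" "n \<notin> x"
  shows "x = spec1 \<Longrightarrow> n = 13" "x = spec2 \<Longrightarrow> n = 16"
proof -
  have low: "13 \<in> set (low E8 17)" "16 \<in> set (low E8 18)"
    by code_simp+
  \<comment> \<open>Inserting a block other than the first missing one leaves the first missing
    block unchanged, and this block determines the translation.\<close>
  have *: "a + 30 * k = b" if "insert n (upto_set b ys) = shift E8 k (upto_set a xs)" "n \<noteq> b"
    "a \<notin> set xs" "b \<notin> set ys" for a b k xs ys
    using that shift_upto_missing[of a xs E8 k]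
    by (intro least_missing[of _ "insert n (upto_set b ys)"]) (auto simp: upto_set_def step_def)
  show "n = 13" if x: "x = spec1"
  proof (rule ccontr)
    assume n: "n \<noteq> 13"
    have "17 \<in> insert n x" "13 \<notin> insert n x"
      using n by (auto simp: x spec1_def)
    with low have "\<not> ideal E8 (insert n x)"
      unfolding ideal_def closed_def by blast
    with assms(1) obtain k where "insert n x = shift E8 k spec1 \<or> insert n x = shift E8 k spec2"
      by (auto simp: young_def special_def)
    then have "13 + 30 * k = 13 \<and> insert n x = shift E8 k spec1 \<or> 16 + 30 * k = 13"
      using *[of 13 "[14, 15, 17]" k 13 "[14, 15, 17]"] *[of 13 "[14, 15, 17]" k 16 "[17, 18]"] n
      unfolding x spec1_upto spec2_upto by auto
    then have "16 + 30 * k = 13 \<or> insert n x = x"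
      by (auto simp: x)
    with assms(2) show False
      by (auto simp: insert_absorb) presburger
  qed
  show "n = 16" if x: "x = spec2"
  proof (rule ccontr)
    assume n: "n \<noteq> 16"
    have "18 \<in> insert n x" "16 \<notin> insert n x"
      using n by (auto simp: x spec2_def)
    with low have "\<not> ideal E8 (insert n x)"
      unfolding ideal_def closed_def by blast
    with assms(1) obtain k where "insert n x = shift E8 k spec1 \<or> insert n x = shift E8 k spec2"
      by (auto simp: young_def special_def)
    then have "16 + 30 * k = 16 \<and> insert n x = shift E8 k spec2 \<or> 13 + 30 * k = 16"
      using *[of 16 "[17, 18]" k 13 "[14, 15, 17]"] *[of 16 "[17, 18]" k 16 "[17, 18]"] n
      unfolding x spec1_upto spec2_upto by auto
    then have "13 + 30 * k = 16 \<or> insert n x = x"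
      by (auto simp: x)
    with assms(2) show False
      by (auto simp: insert_absorb) presburger
  qed
qed

text \<open>Each special column has one unsupported block: 17 rests on the missing 13, or 18 on the
  missing 16. If the column was closed before the insertion, the inserted block must be the
  unsupported one.\<close>

lemma ideal_insert_special:
  assumes "closed E8 x" "n \<notin> x"
  shows "insert n x = spec1 \<Longrightarrow> n = 17 \<and> x = upto_set 13 [14, 15]"
    "insert n x = spec2 \<Longrightarrow> n = 18 \<and> x = upto_set 16 [17]"
proof -
  have low: "13 \<in> set (low E8 17)" "16 \<in> set (low E8 18)"
    by code_simp+
  show "n = 17 \<and> x = upto_set 13 [14, 15]" if i: "insert n x = spec1"
  proof -
    have "13 \<notin> insert n x" "17 \<in> insert n x"
      unfolding i by (simp_all add: spec1_def)
    with low assms have "n = 17"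
      unfolding closed_def by blast
    moreover have "x = spec1 - {n}"
      using i assms(2) by blast
    ultimately show ?thesis
      by (auto simp: spec1_def upto_set_def)
  qed
  show "n = 18 \<and> x = upto_set 16 [17]" if i: "insert n x = spec2"
  proof -
    have "16 \<notin> insert n x" "18 \<in> insert n x"
      unfolding i by (simp_all add: spec2_def)
    with low assms have "n = 18"
      unfolding closed_def by blast
    moreover have "x = spec2 - {n}"
      using i assms(2) by blast
    ultimately show ?thesis
      by (auto simp: spec2_def upto_set_def)
  qed
qed

lemma young_insert_cases:
  assumes "young E8 x" "n \<notin> x" "young E8 (insert n x)"
  obtains "closed E8 x" "closed E8 (insert n x)"
  | k where "(shift E8 k x, n + step E8 * k) \<in> set special_steps"
proof -
  consider "ideal E8 x" "ideal E8 (insert n x)" | "special x" | "ideal E8 x" "special (insert n x)"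
    using assms by (auto simp: young_def)
  then show ?thesis
  proof cases
    case 1
    then show ?thesis
      by (intro that(1)) (auto simp: ideal_def)
  next
    case 2
    then obtain k where k: "x = shift E8 k spec1 \<or> x = shift E8 k spec2"
      by (auto simp: special_def)
    have ins: "young E8 (insert (n + step E8 * - k) (shift E8 (- k) x))" "n + step E8 * - k \<notin> shift E8 (- k) x"
      using assms young_shift[of E8 "- k" "insert n x"] by (simp_all add: shift_insert mem_shift)
    have "shift E8 (- k) x = spec1 \<or> shift E8 (- k) x = spec2"
      using k by auto
    with special_insert[OF ins] show ?thesis
      by (intro that(2)[of "- k"]) (auto simp: special_steps_def spec1_upto spec2_upto)
  next
    case 3
    then obtain k where k: "insert n x = shift E8 k spec1 \<or> insert n x = shift E8 k spec2"
      by (auto simp: special_def)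
    have c: "closed E8 (shift E8 (- k) x)" "n + step E8 * - k \<notin> shift E8 (- k) x"
      using 3(1) assms(2) by (simp_all add: closed_shift ideal_def mem_shift)
    have "insert (n + step E8 * - k) (shift E8 (- k) x) = shift E8 (- k) (insert n x)"
      by (simp add: shift_insert)
    with k have "insert (n + step E8 * - k) (shift E8 (- k) x) = spec1 \<or> insert (n + step E8 * - k) (shift E8 (- k) x) = spec2"
      by auto
    with ideal_insert_special[OF c] show ?thesis
      by (intro that(2)[of "- k"]) (auto simp: special_steps_def)
  qed
qed

section \<open>Addable and removable blocks of equal colours\<close>

definition special_results :: "(int set \<times> int) list" where
  "special_results = [(upto_set 16 [17], 13), (upto_set 16 [17, 18], 18), (upto_set 13 [14, 15, 17], 17), (upto_set 19 [], 16)]"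

lemma special_insert_eqs:
  "insert 13 (upto_set 13 [14, 15, 17]) = upto_set 16 [17]" "insert 18 (upto_set 16 [17]) = upto_set 16 [17, 18]"
  "insert 17 (upto_set 13 [14, 15]) = upto_set 13 [14, 15, 17]" "insert 16 (upto_set 16 [17, 18]) = upto_set 19 []"
  unfolding upto_set_def by (rule set_eqI, simp, linarith)+

lemma special_results: "(u, n) \<in> set special_steps \<Longrightarrow> (insert n u, n) \<in> set special_results"
  unfolding special_steps_def special_results_def list.set insert_iff prod.inject empty_iff
  by (elim disjE conjE FalseE; hypsubst; simp only: special_insert_eqs simp_thms)

lemma special_step_young: "(u, n) \<in> set special_steps \<Longrightarrow> n \<notin> u"
  by (auto simp: special_steps_def upto_set_def)

text \<open>The first missing block moves along with a translation. It therefore recognises by how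
  much a known column has been translated.\<close>

definition missing :: "int set \<Rightarrow> int \<Rightarrow> bool" where
  "missing x a \<longleftrightarrow> {..<a} \<subseteq> x \<and> a \<notin> x"

lemma missing_unique: "missing x a \<Longrightarrow> missing x b \<Longrightarrow> a = b"
  unfolding missing_def by (elim conjE) (rule least_missing)

lemma missing_shiftI:
  assumes "missing x a"
  shows "missing (shift T k x) (a + step T * k)"
proof -
  have "n - step T * k \<in> x" if "n < a + step T * k" for n
  proof -
    have "n - step T * k \<in> {..<a}"
      using that by simp
    then show ?thesis
      using assms unfolding missing_def by blast
  qed
  then show ?thesis
    using assms by (simp add: missing_def mem_shift subset_iff)
qed

lemma missing_shift: "missing (shift T k x) a \<longleftrightarrow> missing x (a - step T * k)"
  using missing_shiftI[of x "a - step T * k" T k] missing_shiftI[of "shift T k x" a T "- k"] by auto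

lemma missing_upto: "b \<notin> set xs \<Longrightarrow> missing (upto_set b xs) b"
  by (auto simp: missing_def upto_set_def)

lemma upto_set_eq_iff [simp]:
  assumes "b \<notin> set xs" "c \<notin> set ys"
  shows "upto_set b xs = upto_set c ys \<longleftrightarrow>
    b = c \<and> (\<forall>x\<in>set xs. x < c \<or> x \<in> set ys) \<and> (\<forall>x\<in>set ys. x < b \<or> x \<in> set xs)"
proof
  assume eq: "upto_set b xs = upto_set c ys"
  have "b = c"
    using missing_unique[of "upto_set b xs" b c] missing_upto[OF assms(1)] missing_upto[OF assms(2)] eq by simp
  moreover have "x < c \<or> x \<in> set ys" if "x \<in> set xs" for x
  proof -
    have "x \<in> upto_set c ys"
      using that unfolding eq[symmetric] by (simp add: upto_set_def)
    then show ?thesis by (simp add: upto_set_def)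
  qed
  moreover have "x < b \<or> x \<in> set xs" if "x \<in> set ys" for x
  proof -
    have "x \<in> upto_set b xs"
      using that unfolding eq by (simp add: upto_set_def)
    then show ?thesis by (simp add: upto_set_def)
  qed
  ultimately show "b = c \<and> (\<forall>x\<in>set xs. x < c \<or> x \<in> set ys) \<and> (\<forall>x\<in>set ys. x < b \<or> x \<in> set xs)"
    by blast
qed (auto simp: upto_set_def)

lemma missing_special:
  assumes "(u, n) \<in> set special_steps"
  shows "\<exists>a\<in>{13, 16}. missing u a" "\<exists>a\<in>{13, 16, 19}. missing (insert n u) a"
proof -
  show "\<exists>a\<in>{13, 16}. missing u a"
    using assms missing_upto by (auto simp: special_steps_def)
  have "\<exists>a\<in>{13, 16, 19}. missing v a" if "(v, n) \<in> set special_results" for v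
    using that missing_upto by (auto simp: special_results_def)
  from this[OF special_results[OF assms]] show "\<exists>a\<in>{13, 16, 19}. missing (insert n u) a" .
qed

text \<open>The numbers 13, 16 and 19 are pairwise incongruent modulo 30, so equal first missing
  blocks exclude different translations.\<close>

lemma same_shift:
  assumes "missing (shift E8 k x) a" "missing (shift E8 l x) b" "a \<in> {13, 16, 19}" "b \<in> {13, 16, 19}"
  shows "k = l"
proof -
  have "a - 30 * k = b - 30 * l"
    using missing_unique assms(1,2) unfolding missing_shift by (simp add: step_def)
  with assms(3,4) show ?thesis
    by auto
qed

lemma special_steps_closed:
  "(u, n) \<in> set special_steps \<Longrightarrow> closed E8 u \<Longrightarrow> u = upto_set 16 [17] \<and> n = 18 \<or> u = upto_set 13 [14, 15] \<and> n = 17"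
  using not_closed_special by (auto simp: special_steps_def)

lemma special_results_closed:
  "(u, n) \<in> set special_results \<Longrightarrow> closed E8 u \<Longrightarrow> u = upto_set 16 [17] \<and> n = 13 \<or> u = upto_set 19 [] \<and> n = 16"
  using not_closed_special by (auto simp: special_results_def)

lemma special_steps_unique:
  assumes "(shift E8 k x, n + step E8 * k) \<in> set special_steps" "(shift E8 l x, m + step E8 * l) \<in> set special_steps"
  shows "n = m"
proof -
  have "k = l"
    using missing_special(1)[OF assms(1)] missing_special(1)[OF assms(2)] same_shift by blast
  then have "(shift E8 k x, m + step E8 * k) \<in> set special_steps"
    using assms(2) by simp
  with assms(1) have "n + step E8 * k = m + step E8 * k"
    by (auto simp: special_steps_def)
  then show ?thesis by simp
qed

lemma special_results_unique:
  assumes "(shift E8 k (y - {n}), n + step E8 * k) \<in> set special_steps"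
    "(shift E8 l (y - {m}), m + step E8 * l) \<in> set special_steps" "n \<in> y" "m \<in> y"
  shows "n = m"
proof -
  have ins: "insert (n + step E8 * k) (shift E8 k (y - {n})) = shift E8 k y"
    "insert (m + step E8 * l) (shift E8 l (y - {m})) = shift E8 l y"
    using assms(3,4) by (metis insert_Diff shift_insert)+
  have "k = l"
    using missing_special(2)[OF assms(1)] missing_special(2)[OF assms(2)] same_shift unfolding ins by blast
  then have "(shift E8 k y, m + step E8 * k) \<in> set special_results"
    using special_results[OF assms(2)] ins by simp
  moreover have "(shift E8 k y, n + step E8 * k) \<in> set special_results"
    using special_results[OF assms(1)] ins by simp
  ultimately have "n + step E8 * k = m + step E8 * k"
    unfolding special_results_def by auto
  then show ?thesis by simp
qed

text \<open>With the analogous table for removals this separates the two kinds of steps: at a closed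
  column an exceptional step has no ordinary competitor of the same colour.\<close>

lemma added_colours:
  "\<forall>p\<in>set (added E8 16 [17]). col E8 p \<noteq> col E8 18 \<and> col E8 p \<noteq> col E8 13" "\<forall>p\<in>set (added E8 13 [14, 15]). col E8 p \<noteq> col E8 17"
  "\<forall>p\<in>set (added E8 19 []). col E8 p \<noteq> col E8 16"
  by code_simp+

lemma removed_colours:
  "\<forall>p\<in>set (removed E8 16 [17]). col E8 p \<noteq> col E8 18 \<and> col E8 p \<noteq> col E8 13" "\<forall>p\<in>set (removed E8 13 [14, 15]). col E8 p \<noteq> col E8 17"
  "\<forall>p\<in>set (removed E8 19 []). col E8 p \<noteq> col E8 16"
  by code_simp+

lemma special_steps_add:
  assumes "(u, p) \<in> set special_steps" "closed E8 u" "q \<notin> u" "closed E8 (insert q u)"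
  shows "col E8 q \<noteq> col E8 p"
  using special_steps_closed[OF assms(1,2)]
proof (elim disjE conjE)
  assume "u = upto_set 16 [17]" "p = 18"
  with closed_insert_upto assms(3,4) added_colours(1) show ?thesis by blast
next
  assume "u = upto_set 13 [14, 15]" "p = 17"
  with closed_insert_upto assms(3,4) added_colours(2) show ?thesis by blast
qed

lemma special_results_add:
  assumes "(u, p) \<in> set special_results" "closed E8 u" "q \<notin> u" "closed E8 (insert q u)"
  shows "col E8 q \<noteq> col E8 p"
  using special_results_closed[OF assms(1,2)]
proof (elim disjE conjE)
  assume "u = upto_set 16 [17]" "p = 13"
  with closed_insert_upto assms(3,4) added_colours(1) show ?thesis by blast
next
  assume "u = upto_set 19 []" "p = 16"
  with closed_insert_upto assms(3,4) added_colours(3) show ?thesis by blast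
qed

lemma special_steps_remove:
  assumes "(u, p) \<in> set special_steps" "closed E8 u" "q \<in> u" "closed E8 (u - {q})"
  shows "col E8 q \<noteq> col E8 p"
  using special_steps_closed[OF assms(1,2)]
proof (elim disjE conjE)
  assume "u = upto_set 16 [17]" "p = 18"
  with closed_remove_upto assms(3,4) removed_colours(1) show ?thesis by blast
next
  assume "u = upto_set 13 [14, 15]" "p = 17"
  with closed_remove_upto assms(3,4) removed_colours(2) show ?thesis by blast
qed

lemma special_results_remove:
  assumes "(u, p) \<in> set special_results" "closed E8 u" "q \<in> u" "closed E8 (u - {q})"
  shows "col E8 q \<noteq> col E8 p"
  using special_results_closed[OF assms(1,2)]
proof (elim disjE conjE)
  assume "u = upto_set 16 [17]" "p = 13"
  with closed_remove_upto assms(3,4) removed_colours(1) show ?thesis by blast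
next
  assume "u = upto_set 19 []" "p = 16"
  with closed_remove_upto assms(3,4) removed_colours(3) show ?thesis by blast
qed

lemma special_colours:
  "col E8 18 \<noteq> col E8 16" "col E8 17 \<noteq> col E8 13"
  by code_simp+

text \<open>Of the consecutive exceptional insertions, 17 then 13 and 18 then 16 combine the colours
  4 and 2; only 13 then 18 repeats a colour.\<close>

lemma special_chain:
  assumes "(u, p) \<in> set special_steps" "(insert p u, q) \<in> set special_steps" "col E8 p = col E8 q"
  shows "u = upto_set 13 [14, 15, 17] \<and> p = 13 \<and> q = 18"
  using assms(1)
  unfolding special_steps_def list.set insert_iff prod.inject empty_iff
proof (elim disjE conjE FalseE)
  assume "u = upto_set 13 [14, 15, 17]" "p = 13"
  then show ?thesis
    using assms(2,3) special_insert_eqs(1) by (simp add: special_steps_def)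
next
  assume "u = upto_set 16 [17]" "p = 18"
  then show ?thesis
    using assms(2,3) special_insert_eqs(2) special_colours by (simp add: special_steps_def)
next
  assume "u = upto_set 13 [14, 15]" "p = 17"
  then show ?thesis
    using assms(2,3) special_insert_eqs(3) special_colours by (simp add: special_steps_def)
next
  assume "u = upto_set 16 [17, 18]" "p = 16"
  then show ?thesis
    using assms(2,3) special_insert_eqs(4) special_colours by (simp add: special_steps_def)
qed

lemma young_closed: "young T y \<Longrightarrow> T \<noteq> E8 \<Longrightarrow> closed T y"
  by (auto simp: young_def ideal_def)

lemma young_insert_disj:
  assumes "young E8 x" "n \<notin> x" "young E8 (insert n x)"
  shows "closed E8 x \<and> closed E8 (insert n x) \<or> (\<exists>k. (shift E8 k x, n + step E8 * k) \<in> set special_steps)"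
  using assms by (rule young_insert_cases) blast+

text \<open>In type E8 each of the two insertions is ordinary or exceptional. Two exceptional ones
  coincide, and a mixture contradicts the colours; two ordinary ones are the case of ideals.\<close>

lemma two_addable:
  assumes "young T x" "p \<notin> x" "q \<notin> x" "p \<noteq> q" "young T (insert p x)" "young T (insert q x)" "col T p = col T q"
  shows "paired T x p q"
proof (cases "T = E8")
  case False
  with assms show ?thesis
    by (intro two_addable_ideal young_closed)
next
  case T: True
  have mixed: False if "closed E8 (insert p x)" "(shift E8 k x, q + step E8 * k) \<in> set special_steps"
    "closed E8 x" "p \<notin> x" "col E8 p = col E8 q" for k p q
  proof -
    have p: "closed E8 (insert (p + step E8 * k) (shift E8 k x))" "p + step E8 * k \<notin> shift E8 k x"
      using that closed_shift[of E8 k "insert p x"] by (simp_all add: shift_insert mem_shift)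
    have c: "col E8 (p + step E8 * k) = col E8 (q + step E8 * k)"
      using that(5) by simp
    have "closed E8 (shift E8 k x)"
      using that(3) by (simp add: closed_shift)
    from special_steps_add[OF that(2) this p(2,1)] c show False
      by simp
  qed
  have E: "young E8 x" "young E8 (insert p x)" "young E8 (insert q x)" "col E8 p = col E8 q"
    using assms T by auto
  show ?thesis
    using young_insert_disj[OF E(1) assms(2) E(2)] young_insert_disj[OF E(1) assms(3) E(3)]
  proof (elim disjE exE)
    fix k assume "closed E8 x \<and> closed E8 (insert p x)" "(shift E8 k x, q + step E8 * k) \<in> set special_steps"
    with mixed[of p k q] assms(2) E(4) show ?thesis by blast
  next
    fix k assume "(shift E8 k x, p + step E8 * k) \<in> set special_steps" "closed E8 x \<and> closed E8 (insert q x)"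
    with mixed[of q k p] assms(3) E(4) show ?thesis by simp
  next
    fix k l assume "(shift E8 k x, p + step E8 * k) \<in> set special_steps" "(shift E8 l x, q + step E8 * l) \<in> set special_steps"
    with special_steps_unique assms(4) show ?thesis by blast
  next
    assume "closed E8 x \<and> closed E8 (insert p x)" "closed E8 x \<and> closed E8 (insert q x)"
    with assms T show ?thesis
      by (intro two_addable_ideal) auto
  qed
qed

text \<open>In the ordinary case the column without both blocks has them as addable blocks, so the
  classification of addable pairs applies. The exceptional cases are excluded as for
  additions.\<close>

lemma two_removable:
  assumes "young T y" "p \<in> y" "q \<in> y" "p \<noteq> q" "young T (y - {p})" "young T (y - {q})" "col T p = col T q"
  shows "paired T (y - {p, q}) p q"
proof -
  have eq: "insert q (y - {p, q}) = y - {p}" "insert p (y - {p, q}) = y - {q}"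
    using assms by auto
  have both: "paired T (y - {p, q}) p q" if "closed T (y - {p})" "closed T (y - {q})"
    using that assms by (intro two_addable_ideal) (simp_all add: eq)
  show ?thesis
  proof (cases "T = E8")
    case False
    with assms show ?thesis
      by (intro both young_closed)
  next
    case T: True
    have mixed: False if "closed E8 (y - {p})" "(shift E8 k (y - {q}), q + step E8 * k) \<in> set special_steps"
      "closed E8 y" "p \<in> y" "q \<in> y" "col E8 p = col E8 q" for k p q
    proof -
      have p: "closed E8 (shift E8 k y - {p + step E8 * k})" "p + step E8 * k \<in> shift E8 k y"
        using that closed_shift[of E8 k "y - {p}"] by (simp_all add: shift_Diff mem_shift)
      have c: "col E8 (p + step E8 * k) = col E8 (q + step E8 * k)"
        using that(6) by simp
      have "insert (q + step E8 * k) (shift E8 k (y - {q})) = shift E8 k y"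
        using that(5) by (metis insert_Diff shift_insert)
      with special_results[OF that(2)] have r: "(shift E8 k y, q + step E8 * k) \<in> set special_results"
        by simp
      have "closed E8 (shift E8 k y)"
        using that(3) by (simp add: closed_shift)
      from special_results_remove[OF r this p(2,1)] c show False
        by simp
    qed
    have ins: "insert p (y - {p}) = y" "insert q (y - {q}) = y"
      using assms by auto
    have E: "young E8 y" "young E8 (y - {p})" "young E8 (y - {q})" "col E8 p = col E8 q" "p \<notin> y - {p}" "q \<notin> y - {q}"
      using assms T by auto
    show ?thesis
      using young_insert_disj[OF E(2) E(5), unfolded ins, OF E(1)] young_insert_disj[OF E(3) E(6), unfolded ins, OF E(1)]
    proof (elim disjE exE)
      fix k assume "closed E8 (y - {p}) \<and> closed E8 y" "(shift E8 k (y - {q}), q + step E8 * k) \<in> set special_steps"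
      with mixed[of p k q] assms(2,3) E(4) show ?thesis by blast
    next
      fix k assume "(shift E8 k (y - {p}), p + step E8 * k) \<in> set special_steps" "closed E8 (y - {q}) \<and> closed E8 y"
      with mixed[of q k p] assms(2,3) E(4) show ?thesis by simp
    next
      fix k l assume "(shift E8 k (y - {p}), p + step E8 * k) \<in> set special_steps" "(shift E8 l (y - {q}), q + step E8 * l) \<in> set special_steps"
      with special_results_unique assms(2-4) show ?thesis by blast
    next
      assume "closed E8 (y - {p}) \<and> closed E8 y" "closed E8 (y - {q}) \<and> closed E8 y"
      with both T show ?thesis by simp
    qed
  qed
qed

text \<open>The second alternative is the 2-string through the special columns.\<close>

lemma two_in_a_row:
  assumes "young T x" "p \<notin> x" "young T (insert p x)" "q \<notin> insert p x" "young T (insert q (insert p x))"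
    "col T p = col T q"
  shows "paired T x p q \<or>
    T = E8 \<and> (\<exists>k. shift E8 k x = upto_set 13 [14, 15, 17] \<and> p + step E8 * k = 13 \<and> q + step E8 * k = 18)"
proof -
  have both: "paired T x p q" if c: "closed T x" "closed T (insert p x)" "closed T (insert q (insert p x))"
  proof -
    \<comment> \<open>Blocks of equal colours never touch, so \<open>q\<close> could equally well
      have been added before \<open>p\<close>.\<close>
    have "p \<notin> set (low T q)"
      using low_bounds[of T q] assms(6) by blast
    with c have "closed T (insert q x)"
      unfolding closed_def by blast
    with c(2) assms show ?thesis
      by (intro two_addable_ideal) auto
  qed
  show ?thesis
  proof (cases "T = E8")
    case False
    with assms both show ?thesis
      by (blast intro: young_closed)
  next
    case T: True
    have c: "col E8 (p + step E8 * k) = col E8 (q + step E8 * k)" for k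
      using assms(6) T by simp
    have E: "young E8 x" "young E8 (insert p x)" "young E8 (insert q (insert p x))"
      using assms T by auto
    show ?thesis
      using young_insert_disj[OF E(1) assms(2) E(2)] young_insert_disj[OF E(2) assms(4) E(3)]
    proof (elim disjE exE)
      assume "closed E8 x \<and> closed E8 (insert p x)" "closed E8 (insert p x) \<and> closed E8 (insert q (insert p x))"
      with both T show ?thesis by simp
    next
      fix k assume cp: "closed E8 x \<and> closed E8 (insert p x)" and k: "(shift E8 k (insert p x), q + step E8 * k) \<in> set special_steps"
      have "shift E8 k (insert p x) - {p + step E8 * k} = shift E8 k x"
        using assms(2) by (auto simp: shift_insert mem_shift)
      then have p: "closed E8 (shift E8 k (insert p x) - {p + step E8 * k})" "p + step E8 * k \<in> shift E8 k (insert p x)"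
        using cp by (simp_all add: closed_shift mem_shift)
      have "closed E8 (shift E8 k (insert p x))"
        using cp by (simp only: closed_shift)
      from special_steps_remove[OF k this p(2,1)] c[of k] show ?thesis
        by simp
    next
      fix k assume k: "(shift E8 k x, p + step E8 * k) \<in> set special_steps"
        and cq: "closed E8 (insert p x) \<and> closed E8 (insert q (insert p x))"
      have r: "(shift E8 k (insert p x), p + step E8 * k) \<in> set special_results"
        using special_results[OF k] by (simp add: shift_insert)
      have q: "closed E8 (insert (q + step E8 * k) (shift E8 k (insert p x)))" "q + step E8 * k \<notin> shift E8 k (insert p x)"
        using cq assms(4) closed_shift[of E8 k "insert q (insert p x)"] by (simp_all add: shift_insert mem_shift)
      have "closed E8 (shift E8 k (insert p x))"
        using cq by (simp only: closed_shift)
      from special_results_add[OF r this q(2,1)] c[of k] show ?thesis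
        by simp
    next
      fix k l assume k: "(shift E8 k x, p + step E8 * k) \<in> set special_steps"
        and l: "(shift E8 l (insert p x), q + step E8 * l) \<in> set special_steps"
      have r: "(shift E8 k (insert p x), p + step E8 * k) \<in> set special_results"
        using special_results[OF k] by (simp add: shift_insert)
      have "k = l"
        using missing_special(2)[OF k] missing_special(1)[OF l] same_shift[of k "insert p x" _ l]
        by (auto simp: shift_insert)
      with l have l: "(shift E8 k (insert p x), q + step E8 * k) \<in> set special_steps"
        by simp
      have "shift E8 k x = upto_set 13 [14, 15, 17] \<and> p + step E8 * k = 13 \<and> q + step E8 * k = 18"
        using special_chain[OF k l[unfolded shift_insert] c[of k]] .
      with T show ?thesis by blast
    qed
  qed
qed

text \<open>Take \<open>L\<close> to be 30 below the largest element \<open>n\<close>: as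
  \<open>gap T\<close> is at most 30, everything below \<open>L\<close> is forced by
  \<open>n\<close>.\<close>

lemma ideal_bounds:
  assumes "ideal T y"
  shows "\<exists>L. {..<L} \<subseteq> y \<and> y \<subseteq> {..<L + 32}"
proof -
  obtain a N where y: "a \<in> y" "y \<subseteq> {..N}" and c: "closed T y"
    using assms unfolding ideal_def by blast
  define n where "n = Max (y \<inter> {a..N})"
  have fin: "finite (y \<inter> {a..N})" and ne: "a \<in> y \<inter> {a..N}"
    using y by auto
  have n: "n \<in> y" "a \<le> n"
    using Max_in[OF fin] Max_ge[OF fin ne] ne unfolding n_def by blast+
  have max: "m \<le> n" if "m \<in> y" for m
  proof (cases "a \<le> m")
    case True
    then have "m \<in> y \<inter> {a..N}"
      using that y(2) by auto
    then show ?thesis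
      unfolding n_def using fin by (rule Max_ge[rotated])
  next
    case False
    with n(2) show ?thesis
      by linarith
  qed
  have "m \<in> y" if "m < n - 30" for m
    using closed_window[OF c n(1), of m] that gap_le(2)[of T] by linarith
  then have "{..<n - 30} \<subseteq> y"
    by blast
  moreover have "y \<subseteq> {..<n - 30 + 32}"
    using max by (simp add: subset_iff) (metis add_strict_increasing zero_less_numeral order_le_less_trans less_add_same_cancel1)
  ultimately show ?thesis
    by blast
qed

lemma ideal_remove:
  assumes "ideal T y" "closed T (y - {n})"
  shows "ideal T (y - {n})"
proof -
  obtain N where "y \<subseteq> {..N}"
    using assms(1) unfolding ideal_def by (elim conjE exE)
  then have "y - {n} \<subseteq> {..N}"
    by (rule subset_trans[OF Diff_subset])
  then have b: "\<exists>N. y - {n} \<subseteq> {..N}" ..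
  obtain L where "{..<L} \<subseteq> y"
    using ideal_bounds[OF assms(1)] by (elim exE conjE)
  then have "min L n - 1 \<in> y - {n}"
    by (simp add: subset_iff)
  then have "y - {n} \<noteq> {}"
    by blast
  with b show ?thesis
    using assms(2) by (simp add: ideal_def)
qed

definition upto_closed :: "affine_type \<Rightarrow> int \<Rightarrow> int list \<Rightarrow> bool" where
  "upto_closed T b xs \<longleftrightarrow> list_all (\<lambda>x. list_all (\<lambda>m. m < b \<or> m \<in> set xs) (low T x)) xs"

lemma ideal_upto:
  assumes "upto_closed T b xs"
  shows "ideal T (upto_set b xs)"
proof -
  have "set (low T n) \<subseteq> upto_set b xs" if "n \<in> upto_set b xs" for n
  proof (cases "n < b")
    case True
    with low_bounds[of T n] show ?thesis
      by (auto simp: upto_set_def subset_iff)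
  next
    case False
    with that assms show ?thesis
      by (auto simp: upto_set_def upto_closed_def list_all_iff)
  qed
  moreover have "upto_set b xs \<subseteq> {..fold max xs b}"
    using upto_set_le by blast
  moreover have "b - 1 \<in> upto_set b xs"
    by (simp add: upto_set_def)
  ultimately show ?thesis
    unfolding ideal_def closed_def by blast
qed

lemma young_upto: "upto_closed T b xs \<Longrightarrow> young T (upto_set b xs)"
  by (simp add: young_def ideal_upto)

lemma insert_upto_set: "insert n (upto_set b xs) = upto_set b (n # xs)"
  by (auto simp: upto_set_def)

definition upto_equal :: "int \<Rightarrow> int list \<Rightarrow> int \<Rightarrow> int list \<Rightarrow> bool" where
  "upto_equal b xs c ys \<longleftrightarrow>
     list_all (\<lambda>n. (n < b \<or> n \<in> set xs) = (n < c \<or> n \<in> set ys)) ([min b c..max b c] @ xs @ ys)"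

lemma upto_equal: "upto_equal b xs c ys \<Longrightarrow> upto_set b xs = upto_set c ys"
proof (rule set_eqI)
  fix n assume *: "upto_equal b xs c ys"
  show "n \<in> upto_set b xs \<longleftrightarrow> n \<in> upto_set c ys"
  proof (cases "n \<in> set ([min b c..max b c] @ xs @ ys)")
    case True
    with * show ?thesis
      unfolding upto_equal_def upto_set_def list_all_iff by blast
  next
    case False
    then have "n < min b c \<or> max b c < n" "n \<notin> set xs" "n \<notin> set ys"
      by auto
    then show ?thesis
      unfolding upto_set_def by auto
  qed
qed

section \<open>Strings of length two in type E8\<close>

definition on_top :: "affine_type \<Rightarrow> nat \<Rightarrow> int \<Rightarrow> bool" where
  "on_top T i n \<longleftrightarrow> list_ex (\<lambda>m. col T m = i) (low T n)"

lemma on_top_shift [simp]: "on_top T i (n + step T * k) \<longleftrightarrow> on_top T i n"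
  by (simp add: on_top_def list_ex_iff low_shift add.commute[of "step T * k"])

lemma cube_shift [simp]: "cube (blk T (n + step T * k)) = cube (blk T n) + cubes T * k"
  by (simp add: blk_shift move_def translate_block_def rotate_block_def)

text \<open>The last conjunct relates the order of the entries to rule (a): \<open>P\<close> is the
  higher block or, for colour 4, the one on a \<open>5\<close>-block, whereas \<open>Q\<close> is
  the lower one or the one on a \<open>3\<close>-block.\<close>

lemma pairs_young_table:
  "\<forall>(i, P, Q, b, xs)\<in>set pairs. upto_closed E8 b xs \<and> upto_closed E8 b (P # xs) \<and> upto_closed E8 b (Q # xs) \<and>
     upto_closed E8 b (P # Q # xs) \<and>
     (if i = 4 then on_top E8 5 P \<and> \<not> on_top E8 5 Q \<and> on_top E8 3 Q \<and> \<not> on_top E8 3 P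
      else cube (blk E8 Q) < cube (blk E8 P))"
  by code_simp

lemma pair_young:
  assumes "pair i P Q y"
  shows "young E8 y" "young E8 (insert P y)" "young E8 (insert Q y)" "young E8 (insert P (insert Q y))"
    "if i = 4 then on_top E8 5 P \<and> \<not> on_top E8 5 Q \<and> on_top E8 3 Q \<and> \<not> on_top E8 3 P
      else cube (blk E8 Q) < cube (blk E8 P)"
proof -
  obtain b xs where i: "(i, P, Q, b, xs) \<in> set pairs" and y: "y = upto_set b xs"
    using assms unfolding pair_def by blast
  note t = bspec[OF pairs_young_table i, unfolded prod.case]
  show "young E8 y" "young E8 (insert P y)" "young E8 (insert Q y)" "young E8 (insert P (insert Q y))"
    unfolding y insert_upto_set using t by (blast intro: young_upto)+
  show "if i = 4 then on_top E8 5 P \<and> \<not> on_top E8 5 Q \<and> on_top E8 3 Q \<and> \<not> on_top E8 3 P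
      else cube (blk E8 Q) < cube (blk E8 P)"
    using t by blast
qed

text \<open>The columns in the middle of the strings of length 2, with the colours of these strings.\<close>

definition middle_data :: "(nat \<times> int \<times> int list) list" where
  "middle_data = [(2, 16, [17]), (4, 17, []),
     (0, 0, [1, 2, 3, 4, 5, 7, 8, 10, 11, 13, 14, 17, 20, 23, 26, 29, 30]),
     (8, 6, [7, 8, 10, 11, 13, 14, 17, 20, 23, 26, 29]),
     (7, 9, [10, 11, 13, 14, 17, 20, 23, 26]),
     (6, 12, [13, 14, 17, 20, 23]),
     (5, 15, [17, 20]),
     (3, 14, [15, 16, 19]),
     (1, 10, [11, 12, 13, 15, 16, 19, 21])]"

definition middle :: "nat \<Rightarrow> int set \<Rightarrow> bool" where
  "middle i y \<longleftrightarrow> (\<exists>b xs. (i, b, xs) \<in> set middle_data \<and> y = upto_set b xs)"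

text \<open>Adding \<open>P\<close> first gives a middle column of the same colour. Adding
  \<open>Q\<close> first gives a middle column of a different colour, where rule (b) forbids
  removing \<open>Q\<close> again. The one middle column not obtained from a pair lies between the
  two special columns.\<close>

lemma middle_table:
  "\<forall>(i, P, Q, b, xs)\<in>set pairs. list_ex (\<lambda>(j, c, ys). j = i \<and> upto_equal b (P # xs) c ys) middle_data"
  "\<forall>(i, P, Q, b, xs)\<in>set pairs. list_ex (\<lambda>(j, c, ys). j \<noteq> i \<and> upto_equal b (Q # xs) c ys) middle_data"
  "\<forall>(j, c, ys)\<in>set middle_data. (j, c, ys) = (2, 16, [17]) \<or>
     list_ex (\<lambda>(i, P, Q, b, xs). j = i \<and> upto_equal b (P # xs) c ys) pairs"
  by code_simp+

lemma pair_middle: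
  assumes "pair i P Q x"
  shows "middle i (insert P x)" "\<exists>j. j \<noteq> i \<and> middle j (insert Q x)"
proof -
  obtain b xs where i: "(i, P, Q, b, xs) \<in> set pairs" and x: "x = upto_set b xs"
    using assms unfolding pair_def by blast
  have "list_ex (\<lambda>(j, c, ys). j = i \<and> upto_equal b (P # xs) c ys) middle_data"
    using bspec[OF middle_table(1) i] by simp
  then show "middle i (insert P x)"
    unfolding list_ex_iff middle_def x insert_upto_set using upto_equal by fast
  have "list_ex (\<lambda>(j, c, ys). j \<noteq> i \<and> upto_equal b (Q # xs) c ys) middle_data"
    using bspec[OF middle_table(2) i] by simp
  then show "\<exists>j. j \<noteq> i \<and> middle j (insert Q x)"
    unfolding list_ex_iff middle_def x insert_upto_set using upto_equal by fast
qed

lemma middle_cases: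
  assumes "middle i y"
  obtains "i = 2" "y = upto_set 16 [17]" | P Q x where "pair i P Q x" "y = insert P x"
proof -
  obtain c ys where m: "(i, c, ys) \<in> set middle_data" and y: "y = upto_set c ys"
    using assms unfolding middle_def by blast
  have "(i, c, ys) = (2, 16, [17]) \<or>
     list_ex (\<lambda>(i', P, Q, b, xs). i = i' \<and> upto_equal b (P # xs) c ys) pairs"
    using bspec[OF middle_table(3) m] by simp
  then show ?thesis
  proof
    assume "list_ex (\<lambda>(i', P, Q, b, xs). i = i' \<and> upto_equal b (P # xs) c ys) pairs"
    then obtain P Q b xs where "(i, P, Q, b, xs) \<in> set pairs" "upto_equal b (P # xs) c ys"
      unfolding list_ex_iff by fast
    then have "pair i P Q (upto_set b xs)" "y = insert P (upto_set b xs)"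
      unfolding pair_def y insert_upto_set using upto_equal by blast+
    then show ?thesis
      by (rule that(2))
  qed (use that(1) y in simp)
qed

lemma middle_data_missing:
  "\<forall>(i, b, xs)\<in>set middle_data. b \<notin> set xs \<and> 0 \<le> b \<and> b < 30 \<and> (\<forall>(j, c, ys)\<in>set middle_data. b = c \<longrightarrow> i = j)"
  "\<forall>(i, P, Q, b, xs)\<in>set pairs. b \<notin> set xs \<and> 0 \<le> b \<and> b < 30"
  "\<forall>(i, P, Q, b, xs)\<in>set pairs. \<forall>(j, P', Q', c, ys)\<in>set pairs. i = j \<longrightarrow> (P, Q, b) = (P', Q', c)"
  by code_simp+

lemma shifts_equal:
  assumes "missing (shift E8 k y) b" "missing (shift E8 l y) c" "0 \<le> b" "b < 30" "0 \<le> c" "c < 30"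
  shows "k = l" "b = c"
proof -
  have "b - 30 * k = c - 30 * l"
    using missing_unique assms(1,2) unfolding missing_shift by (simp add: step_def)
  then have "b = c + 30 * (k - l)"
    by simp
  with assms(3-6) have "30 * (k - l) < 30 * 1" "30 * (- 1) < 30 * (k - l)"
    by linarith+
  then have "k - l < 1" "- 1 < k - l"
    by (simp_all only: mult_less_cancel_left_pos zero_less_numeral)
  then show "k = l"
    by linarith
  with \<open>b = _\<close> show "b = c"
    by simp
qed

text \<open>The nine middle columns have different first missing blocks, all within one step, so no
  two of them are translates of each other.\<close>

lemma middle_unique:
  assumes "middle i (shift E8 k y)" "middle j (shift E8 l y)"
  shows "i = j"
proof -
  obtain b xs where i: "(i, b, xs) \<in> set middle_data" "shift E8 k y = upto_set b xs"
    using assms(1) unfolding middle_def by blast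
  obtain c ys where j: "(j, c, ys) \<in> set middle_data" "shift E8 l y = upto_set c ys"
    using assms(2) unfolding middle_def by blast
  have b: "b \<notin> set xs" "0 \<le> b" "b < 30" "\<forall>(j, c, ys)\<in>set middle_data. b = c \<longrightarrow> i = j"
    using bspec[OF middle_data_missing(1) i(1), unfolded prod.case] by blast+
  have c: "c \<notin> set ys" "0 \<le> c" "c < 30"
    using bspec[OF middle_data_missing(1) j(1), unfolded prod.case] by blast+
  have "b = c"
    using shifts_equal(2)[of k y b l c] missing_upto b(1-3) c i(2) j(2) by simp
  with bspec[OF b(4) j(1)] show ?thesis
    by simp
qed

lemma pair_unique:
  assumes "pair i P Q (shift E8 k y)" "pair i P' Q' (shift E8 l y)"
  shows "P = P'" "Q = Q'" "k = l"
proof -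
  obtain b xs where i: "(i, P, Q, b, xs) \<in> set pairs" "shift E8 k y = upto_set b xs"
    using assms(1) unfolding pair_def by blast
  obtain c ys where j: "(i, P', Q', c, ys) \<in> set pairs" "shift E8 l y = upto_set c ys"
    using assms(2) unfolding pair_def by blast
  have b: "b \<notin> set xs" "0 \<le> b" "b < 30"
    using bspec[OF middle_data_missing(2) i(1), unfolded prod.case] by blast+
  have c: "c \<notin> set ys" "0 \<le> c" "c < 30"
    using bspec[OF middle_data_missing(2) j(1), unfolded prod.case] by blast+
  show "k = l"
    using shifts_equal(1)[of k y b l c] missing_upto b c i(2) j(2) by simp
  have "i = i \<longrightarrow> (P, Q, b) = (P', Q', c)"
    using bspec[OF bspec[OF middle_data_missing(3) i(1), unfolded prod.case] j(1)] by simp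
  then show "P = P'" "Q = Q'"
    by simp_all
qed

text \<open>Every colour that can be added to such a column can be removed from it as well.\<close>

lemma middle_added_table:
  "\<forall>(i, b, xs)\<in>set middle_data. list_all (\<lambda>n. list_ex (\<lambda>m. col E8 m = col E8 n) (removed E8 b xs)) (added E8 b xs)"
  by code_simp

lemma closed_removed:
  assumes "closed T (upto_set b xs)" "n \<in> set (removed T b xs)"
  shows "closed T (upto_set b xs - {n})" "n \<in> upto_set b xs"
proof -
  have "n \<notin> set (low T m)" if "m \<in> upto_set b xs" for m
  proof
    assume n: "n \<in> set (low T m)"
    then have "m \<in> set [n + 1..n + 6]"
      using low_bounds[of T m] by auto
    with n that assms(2) show False
      by (auto simp: removed_def list_all_iff upto_set_def)
  qed
  with assms(1) show "closed T (upto_set b xs - {n})"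
    unfolding closed_def by blast
  show "n \<in> upto_set b xs"
    using assms(2) by (auto simp: removed_def upto_set_def)
qed

section \<open>The crystal operators on sets of integers\<close>

definition addm :: "affine_type \<Rightarrow> nat \<Rightarrow> int set \<Rightarrow> int set" where
  "addm T i y = {n. col T n = i \<and> n \<notin> y \<and> young T (insert n y)}"

definition remm :: "affine_type \<Rightarrow> nat \<Rightarrow> int set \<Rightarrow> int set" where
  "remm T i y = {n \<in> y. col T n = i \<and> young T (y - {n})}"

definition to_addm :: "affine_type \<Rightarrow> nat \<Rightarrow> int set \<Rightarrow> int \<Rightarrow> bool" where
  "to_addm T i y n \<longleftrightarrow> n \<in> addm T i y \<and> (T = E8 \<and> card (addm T i y) = 2 \<longrightarrow>
     (if i = 4 then on_top T 5 n else (\<forall>m\<in>addm T i y. cube (blk T m) \<le> cube (blk T n))))"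

definition to_remm :: "affine_type \<Rightarrow> nat \<Rightarrow> int set \<Rightarrow> int \<Rightarrow> bool" where
  "to_remm T i y n \<longleftrightarrow> n \<in> remm T i y \<and> (T = E8 \<and> card (remm T i y) = 2 \<longrightarrow>
     (if i = 4 then on_top T 3 n else (\<forall>m\<in>remm T i y. cube (blk T n) \<le> cube (blk T m))))"

definition midm :: "affine_type \<Rightarrow> nat \<Rightarrow> int set \<Rightarrow> bool" where
  "midm T j y \<longleftrightarrow> (\<exists>x. young T x \<and>
     ((\<exists>n. to_addm T j x n \<and> y = insert n x) \<and> addm T j y \<noteq> {} \<or>
      (\<exists>n. to_remm T j x n \<and> y = x - {n}) \<and> remm T j y \<noteq> {}))"

definition fstep :: "affine_type \<Rightarrow> nat \<Rightarrow> int set \<Rightarrow> int \<Rightarrow> bool" where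
  "fstep T i y n \<longleftrightarrow> to_addm T i y n \<and> \<not> (T = E8 \<and> (\<exists>j. j \<noteq> i \<and> midm T j y))"

definition estep :: "affine_type \<Rightarrow> nat \<Rightarrow> int set \<Rightarrow> int \<Rightarrow> bool" where
  "estep T i y n \<longleftrightarrow> to_remm T i y n \<and> \<not> (T = E8 \<and> (\<exists>j. j \<noteq> i \<and> midm T j y))"

lemma addm_iff: "n \<in> addm T i y \<longleftrightarrow> col T n = i \<and> n \<notin> y \<and> young T (insert n y)"
  by (simp add: addm_def)

lemma remm_iff: "n \<in> remm T i y \<longleftrightarrow> n \<in> y \<and> col T n = i \<and> young T (y - {n})"
  by (auto simp: remm_def)

lemma addm_shift: "addm T i (shift T k y) = shift T k (addm T i y)"
proof (rule set_eqI)
  fix n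
  have "insert n (shift T k y) = shift T k (insert (n - step T * k) y)"
    by (simp add: shift_insert)
  then show "n \<in> addm T i (shift T k y) \<longleftrightarrow> n \<in> shift T k (addm T i y)"
    by (simp add: addm_iff mem_shift young_shift)
qed

lemma remm_shift: "remm T i (shift T k y) = shift T k (remm T i y)"
proof (rule set_eqI)
  fix n
  have "shift T k y - {n} = shift T k (y - {n - step T * k})"
    by (simp add: shift_Diff)
  then show "n \<in> remm T i (shift T k y) \<longleftrightarrow> n \<in> shift T k (remm T i y)"
    by (simp add: remm_iff mem_shift young_shift)
qed

lemma card_shift [simp]: "card (shift T k y) = card y"
  unfolding shift_def by (rule card_image) (simp add: inj_on_def)

lemma shift_empty_iff [simp]: "shift T k y = {} \<longleftrightarrow> y = {}"
  by (simp add: shift_def)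

lemma ball_shift: "(\<forall>m\<in>shift T k y. R m) \<longleftrightarrow> (\<forall>m\<in>y. R (m + step T * k))"
  by (simp add: shift_def)

lemma to_addm_shift: "to_addm T i (shift T k y) (n + step T * k) \<longleftrightarrow> to_addm T i y n"
  unfolding to_addm_def addm_shift ball_shift card_shift by (simp add: mem_shift)

lemma to_remm_shift: "to_remm T i (shift T k y) (n + step T * k) \<longleftrightarrow> to_remm T i y n"
  unfolding to_remm_def remm_shift ball_shift card_shift by (simp add: mem_shift)

lemma midm_shiftI:
  assumes "midm T j y"
  shows "midm T j (shift T k y)"
proof -
  obtain x where x: "young T x" and
    "(\<exists>n. to_addm T j x n \<and> y = insert n x) \<and> addm T j y \<noteq> {} \<or>
      (\<exists>n. to_remm T j x n \<and> y = x - {n}) \<and> remm T j y \<noteq> {}"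
    using assms unfolding midm_def by blast
  then have "(\<exists>n. to_addm T j (shift T k x) n \<and> shift T k y = insert n (shift T k x)) \<and> addm T j (shift T k y) \<noteq> {} \<or>
      (\<exists>n. to_remm T j (shift T k x) n \<and> shift T k y = shift T k x - {n}) \<and> remm T j (shift T k y) \<noteq> {}"
    unfolding addm_shift remm_shift shift_empty_iff
    by (metis to_addm_shift to_remm_shift shift_insert shift_Diff)
  moreover have "young T (shift T k x)"
    using x by (simp add: young_shift)
  ultimately show ?thesis
    unfolding midm_def by blast
qed

lemma midm_shift: "midm T j (shift T k y) \<longleftrightarrow> midm T j y"
  using midm_shiftI[of T j y k] midm_shiftI[of T j "shift T k y" "- k"] by auto

lemma pair_data_unique:
  assumes "pair i P Q x" "pair i P' Q' y"
  shows "P' = P" "Q' = Q"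
proof -
  obtain b xs where i: "(i, P, Q, b, xs) \<in> set pairs"
    using assms(1) unfolding pair_def by blast
  obtain c ys where j: "(i, P', Q', c, ys) \<in> set pairs"
    using assms(2) unfolding pair_def by blast
  have "i = i \<longrightarrow> (P, Q, b) = (P', Q', c)"
    using bspec[OF bspec[OF middle_data_missing(3) i, unfolded prod.case] j] by simp
  then show "P' = P" "Q' = Q"
    by simp_all
qed

text \<open>A third addable block \<open>r\<close> would form with \<open>P\<close> a pair over the
  same column. The column determines its pair and the translation, which forces
  \<open>r = Q\<close>.\<close>

lemma paired_add:
  assumes "pair i P Q x"
  shows "addm E8 i x = {P, Q}" "to_addm E8 i x n \<longleftrightarrow> n = P"
proof -
  have PQ: "P \<in> addm E8 i x" "Q \<in> addm E8 i x"
    using pairD[OF assms] pair_young[OF assms] by (simp_all add: addm_iff)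
  have "r = P \<or> r = Q" if r: "r \<in> addm E8 i x" for r
  proof (rule ccontr)
    assume n: "\<not> (r = P \<or> r = Q)"
    then have "paired E8 x P r"
      using PQ r pair_young(1)[OF assms] by (intro two_addable) (auto simp: addm_iff)
    then obtain k P' Q' where k: "pair i P' Q' (shift E8 k x)" "{P + step E8 * k, r + step E8 * k} = {P', Q'}"
      using pairD(4)[OF assms] unfolding paired_def by auto
    have "pair i P Q (shift E8 0 x)"
      using assms by simp
    from pair_unique[OF k(1) this] k(2) n show False
      by (auto simp: doubleton_eq_iff)
  qed
  with PQ show *: "addm E8 i x = {P, Q}"
    by blast
  show "to_addm E8 i x n \<longleftrightarrow> n = P"
    using pair_young(5)[OF assms] pairD(1)[OF assms] unfolding to_addm_def * by (auto split: if_splits)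
qed

text \<open>A third removable block \<open>r\<close> would form, up to translation, the pair
  \<open>{P, Q}\<close> with \<open>P\<close> and also with \<open>Q\<close>. Comparing the two
  translations gives \<open>P = Q\<close>.\<close>

lemma paired_remove:
  assumes "pair i P Q x"
  shows "remm E8 i (insert P (insert Q x)) = {P, Q}" "to_remm E8 i (insert P (insert Q x)) n \<longleftrightarrow> n = Q"
proof -
  let ?y = "insert P (insert Q x)"
  have d: "?y - {P} = insert Q x" "?y - {Q} = insert P x" "?y - {P, Q} = x"
    using pairD[OF assms] by auto
  have PQ: "P \<in> remm E8 i ?y" "Q \<in> remm E8 i ?y"
    using pairD[OF assms] pair_young[OF assms] unfolding remm_iff d by simp_all
  have "r = P \<or> r = Q" if r: "r \<in> remm E8 i ?y" for r
  proof (rule ccontr)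
    assume n: "\<not> (r = P \<or> r = Q)"
    then have "paired E8 (?y - {P, r}) P r"
      using PQ r pair_young(4)[OF assms] by (intro two_removable) (auto simp: remm_iff)
    then obtain k P' Q' where k: "pair i P' Q' (shift E8 k (?y - {P, r}))" "{P + step E8 * k, r + step E8 * k} = {P', Q'}"
      using pairD(4)[OF assms] unfolding paired_def by auto
    have "paired E8 (?y - {Q, r}) Q r"
      using PQ r n pair_young(4)[OF assms] by (intro two_removable) (auto simp: remm_iff)
    then obtain l P'' Q'' where l: "pair i P'' Q'' (shift E8 l (?y - {Q, r}))" "{Q + step E8 * l, r + step E8 * l} = {P'', Q''}"
      using pairD(5)[OF assms] unfolding paired_def by auto
    have "{P + step E8 * k, r + step E8 * k} = {P, Q}" "{Q + step E8 * l, r + step E8 * l} = {P, Q}"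
      using k l pair_data_unique[OF assms] by metis+
    with n pairD(1)[OF assms] show False
      by (auto simp: doubleton_eq_iff)
  qed
  with PQ show *: "remm E8 i ?y = {P, Q}"
    by blast
  show "to_remm E8 i ?y n \<longleftrightarrow> n = Q"
    using pair_young(5)[OF assms] pairD(1)[OF assms] unfolding to_remm_def * by (auto split: if_splits)
qed


lemma addm_pair:
  assumes "young T x" "p \<in> addm T i x" "q \<in> addm T i x" "p \<noteq> q"
  shows "T = E8 \<and> (\<exists>k P Q. pair i P Q (shift E8 k x))"
proof -
  have "paired T x p q"
    using assms by (intro two_addable) (auto simp: addm_iff)
  then show ?thesis
    using assms(2) by (auto simp: paired_def addm_iff)
qed

lemma remm_pair:
  assumes "young T y" "p \<in> remm T i y" "q \<in> remm T i y" "p \<noteq> q"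
  shows "T = E8 \<and> (\<exists>k P Q x. pair i P Q x \<and> shift E8 k y = insert P (insert Q x))"
proof -
  have pq: "paired T (y - {p, q}) p q" "p \<in> y" "q \<in> y" "col T p = i"
    using assms by (auto simp: remm_iff intro: two_removable)
  then obtain k P Q where T: "T = E8" and P: "pair i P Q (shift E8 k (y - {p, q}))"
    "{p + step E8 * k, q + step E8 * k} = {P, Q}"
    unfolding paired_def by auto
  have "y = insert p (insert q (y - {p, q}))"
    using pq by auto
  then have "shift E8 k y = {p + step E8 * k, q + step E8 * k} \<union> shift E8 k (y - {p, q})"
    by (metis insert_is_Un shift_insert Un_insert_left)
  with P T show ?thesis
    by auto
qed

section \<open>The choice made by rule (a)\<close>

text \<open>Two candidates could only come from one of the pairs, where rule (a) admits just
  \<open>P\<close>. Uniqueness makes the \<open>SOME\<close> in \<open>add_block\<close>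
  harmless.\<close>

lemma to_addm_unique:
  assumes "young T x" "to_addm T i x n" "to_addm T i x m"
  shows "n = m"
proof (rule ccontr)
  assume "n \<noteq> m"
  then obtain k P Q where "T = E8" and k: "pair i P Q (shift E8 k x)"
    using addm_pair[OF assms(1), of n i m] assms(2,3) by (auto simp: to_addm_def)
  then have "n + step E8 * k = P" "m + step E8 * k = P"
    using paired_add(2)[OF k] assms(2,3) to_addm_shift by metis+
  with \<open>n \<noteq> m\<close> show False
    by simp
qed

lemma to_remm_unique:
  assumes "young T x" "to_remm T i x n" "to_remm T i x m"
  shows "n = m"
proof (rule ccontr)
  assume "n \<noteq> m"
  then obtain k P Q y where "T = E8" and k: "pair i P Q y" "shift E8 k x = insert P (insert Q y)"
    using remm_pair[OF assms(1), of n i m] assms(2,3) by (auto simp: to_remm_def)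
  then have "n + step E8 * k = Q" "m + step E8 * k = Q"
    using paired_remove(2)[OF k(1)] assms(2,3) to_remm_shift by metis+
  with \<open>n \<noteq> m\<close> show False
    by simp
qed

lemma ex_to_addm:
  assumes "young T x" "addm T i x \<noteq> {}"
  shows "\<exists>n. to_addm T i x n"
proof -
  obtain n where n: "n \<in> addm T i x"
    using assms(2) by blast
  show ?thesis
  proof (cases "addm T i x = {n}")
    case True
    then show ?thesis
      by (intro exI[of _ n]) (simp add: to_addm_def)
  next
    case False
    then obtain m where "m \<in> addm T i x" "n \<noteq> m"
      using n by blast
    with addm_pair[OF assms(1) n this] obtain k P Q where "T = E8" and k: "pair i P Q (shift E8 k x)"
      by blast
    then have "to_addm T i (shift T k x) (P - step T * k + step T * k)"
      using paired_add(2)[OF k] by simp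
    then show ?thesis
      using to_addm_shift by blast
  qed
qed

lemma ex_to_remm:
  assumes "young T x" "remm T i x \<noteq> {}"
  shows "\<exists>n. to_remm T i x n"
proof -
  obtain n where n: "n \<in> remm T i x"
    using assms(2) by blast
  show ?thesis
  proof (cases "remm T i x = {n}")
    case True
    then show ?thesis
      by (intro exI[of _ n]) (simp add: to_remm_def)
  next
    case False
    then obtain m where "m \<in> remm T i x" "n \<noteq> m"
      using n by blast
    with remm_pair[OF assms(1) n this] obtain k P Q y where "T = E8" and k: "pair i P Q y" "shift E8 k x = insert P (insert Q y)"
      by blast
    then have "to_remm T i (shift T k x) (Q - step T * k + step T * k)"
      using paired_remove(2)[OF k(1)] by simp
    then show ?thesis
      using to_remm_shift by blast
  qed
qed

lemma shift_spec1_insert: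
  assumes "shift E8 k x = upto_set 13 [14, 15, 17]" "p + step E8 * k = 13"
  shows "shift E8 k (insert p x) = upto_set 16 [17]"
  unfolding shift_insert assms by (rule special_insert_eqs)

lemma middle_2: "middle 2 (upto_set 16 [17])"
  by (auto simp: middle_def middle_data_def)

lemma col_13: "col E8 13 = 2" "col E8 18 = 2"
  by code_simp+

section \<open>The columns concerned by rule (b)\<close>

lemma step_chain:
  assumes "young E8 x" "p \<notin> x" "young E8 (insert p x)" "q \<notin> insert p x" "young E8 (insert q (insert p x))"
    "col E8 p = i" "col E8 q = i"
  shows "(\<exists>k P Q. pair i P Q (shift E8 k x) \<and> {p + step E8 * k, q + step E8 * k} = {P, Q}) \<or>
    i = 2 \<and> (\<exists>k. shift E8 k (insert p x) = upto_set 16 [17])"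
proof -
  have "paired E8 x p q \<or>
    E8 = E8 \<and> (\<exists>k. shift E8 k x = upto_set 13 [14, 15, 17] \<and> p + step E8 * k = 13 \<and> q + step E8 * k = 18)"
    using assms by (intro two_in_a_row) auto
  then show ?thesis
  proof
    assume "paired E8 x p q"
    then show ?thesis
      using assms(6) unfolding paired_def by auto
  next
    assume "E8 = E8 \<and> (\<exists>k. shift E8 k x = upto_set 13 [14, 15, 17] \<and> p + step E8 * k = 13 \<and> q + step E8 * k = 18)"
    then obtain k where k: "shift E8 k x = upto_set 13 [14, 15, 17]" "p + step E8 * k = 13"
      by blast
    have "i = 2"
      using assms(6) col_shift[of E8 p k] k(2) col_13(1) by metis
    with shift_spec1_insert[OF k] show ?thesis
      by blast
  qed
qed

text \<open>Such a column lies between two consecutive insertions of the same colour, which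
  \<open>step_chain\<close> classifies. In the case of a pair, rule (a) decides that the column
  contains \<open>P\<close> and lacks \<open>Q\<close>, whether it was reached by adding or by
  removing.\<close>

lemma midm_middle:
  assumes "midm E8 j z"
  shows "\<exists>k. middle j (shift E8 k z)"
proof -
  consider x n m where "young E8 x" "to_addm E8 j x n" "z = insert n x" "m \<in> addm E8 j z"
    | y n m where "young E8 y" "to_remm E8 j y n" "z = y - {n}" "m \<in> remm E8 j z"
    using assms unfolding midm_def by blast
  then show ?thesis
  proof cases
    case (1 x n m)
    then have n: "n \<notin> x" "young E8 z" "col E8 n = j" and m: "m \<notin> z" "young E8 (insert m z)" "col E8 m = j"
      by (auto simp: to_addm_def addm_iff)
    from step_chain[of x n m j] 1(1,3) n m
    have "(\<exists>k P Q. pair j P Q (shift E8 k x)) \<or> j = 2 \<and> (\<exists>k. shift E8 k z = upto_set 16 [17])"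
      by auto
    then show ?thesis
    proof (elim disjE exE conjE)
      fix k P Q assume k: "pair j P Q (shift E8 k x)"
      have "n + step E8 * k = P"
        using paired_add(2)[OF k] 1(2) to_addm_shift by metis
      with pair_middle(1)[OF k] 1(3) show ?thesis
        by (metis shift_insert)
    next
      fix k assume "j = 2" "shift E8 k z = upto_set 16 [17]"
      with middle_2 show ?thesis by metis
    qed
  next
    case (2 y n m)
    then have n: "n \<in> y" "young E8 z" "col E8 n = j" and m: "m \<in> z" "young E8 (z - {m})" "col E8 m = j"
      by (auto simp: to_remm_def remm_iff)
    have ins: "insert m (z - {m}) = z" "insert n z = y"
      using n m 2(3) by auto
    have "n \<notin> z"
      using 2(3) by simp
    with step_chain[of "z - {m}" m n j, unfolded ins] 2(1) n m
    have "(\<exists>k P Q. pair j P Q (shift E8 k (z - {m})) \<and> {m + step E8 * k, n + step E8 * k} = {P, Q}) \<or>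
      j = 2 \<and> (\<exists>k. shift E8 k z = upto_set 16 [17])"
      by blast
    then show ?thesis
    proof (elim disjE exE conjE)
      fix k P Q assume k: "pair j P Q (shift E8 k (z - {m}))" "{m + step E8 * k, n + step E8 * k} = {P, Q}"
      have "y = insert m (insert n (z - {m}))"
        using ins by blast
      then have y: "shift E8 k y = insert P (insert Q (shift E8 k (z - {m})))"
        using k(2) by (metis insert_is_Un shift_insert Un_insert_left)
      have "n + step E8 * k = Q"
        using paired_remove(2)[OF k(1)] 2(2) to_remm_shift y by metis
      then have "m + step E8 * k = P"
        using k(2) pairD(1)[OF k(1)] by (auto simp: doubleton_eq_iff)
      then have "shift E8 k z = insert P (shift E8 k (z - {m}))"
        using ins(1) by (metis shift_insert)
      with pair_middle(1)[OF k(1)] show ?thesis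
        by metis
    next
      fix k assume "j = 2" "shift E8 k z = upto_set 16 [17]"
      with middle_2 show ?thesis by metis
    qed
  qed
qed

lemma special_young: "young E8 (upto_set 13 [14, 15, 17])" "young E8 (upto_set 16 [17, 18])" "young E8 (upto_set 16 [17])"
proof -
  have "special spec1" "special spec2"
    unfolding special_def by (metis shift_0)+
  then show "young E8 (upto_set 13 [14, 15, 17])" "young E8 (upto_set 16 [17, 18])"
    by (auto simp: young_def spec1_upto spec2_upto)
  have "upto_closed E8 16 [17]"
    by code_simp
  then show "young E8 (upto_set 16 [17])"
    by (rule young_upto)
qed

lemma to_addm_spec1: "to_addm E8 2 (upto_set 13 [14, 15, 17]) 13"
proof -
  have "addm E8 2 spec1 = {13}"
  proof -
    have "13 \<in> addm E8 2 spec1"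
      using col_13 special_young(3) special_insert_eqs(1)
      by (simp add: addm_iff spec1_upto) (simp add: upto_set_def)
    moreover have "n = 13" if "n \<in> addm E8 2 spec1" for n
      using that special_insert(1)[of n spec1] by (simp add: addm_iff)
    ultimately show ?thesis by blast
  qed
  then show ?thesis
    by (simp add: to_addm_def spec1_upto)
qed

lemma middle_young: "middle i z \<Longrightarrow> young E8 z"
  using special_young(3) pair_young(2) by (metis middle_cases)

lemma middle_midm:
  assumes "middle j (shift E8 k z)"
  shows "midm E8 j z"
proof -
  have "midm E8 j z" if "middle j z" for z
    using that
  proof (cases rule: middle_cases)
    case 1
    have "18 \<in> addm E8 2 (upto_set 16 [17])"
      using col_13 special_young(2) special_insert_eqs(2)
      by (simp add: addm_iff) (simp add: upto_set_def)
    moreover have "upto_set 16 [17] = insert 13 (upto_set 13 [14, 15, 17])"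
      using special_insert_eqs(1) by simp
    ultimately show ?thesis
      using to_addm_spec1 special_young(1) 1 unfolding midm_def by blast
  next
    case (2 P Q x)
    have "Q \<in> addm E8 j (insert P x)"
      using pairD[OF 2(1)] pair_young(4)[OF 2(1)] by (simp add: addm_iff insert_commute)
    moreover have "to_addm E8 j x P"
      using paired_add(2)[OF 2(1)] by simp
    ultimately show ?thesis
      using pair_young(1)[OF 2(1)] 2(2) unfolding midm_def by blast
  qed
  from this[OF assms] show ?thesis
    by (simp only: midm_shift)
qed

lemma midm_unique: "midm E8 i z \<Longrightarrow> midm E8 j z \<Longrightarrow> i = j"
  using midm_middle middle_unique by metis

lemma middle_data_special: "\<forall>(j, b, xs)\<in>set middle_data. b \<noteq> 13 \<and> (b = 16 \<longrightarrow> (j, xs) = (2, [17]))"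
  by code_simp

text \<open>For ordinary insertions this is the evaluated table. The only exceptional insertion into
  a middle column adds 18 to the column between the special ones, and there removing 13 leads to
  \<open>spec1\<close>.\<close>

lemma middle_remm:
  assumes "middle j z" "n \<in> addm E8 i z"
  shows "remm E8 i z \<noteq> {}"
proof -
  obtain b xs where d: "(j, b, xs) \<in> set middle_data" and z: "z = upto_set b xs"
    using assms(1) unfolding middle_def by blast
  have n: "n \<notin> z" "young E8 (insert n z)" "col E8 n = i"
    using assms(2) by (simp_all add: addm_iff)
  have "closed E8 z \<and> closed E8 (insert n z) \<or> (\<exists>k. (shift E8 k z, n + step E8 * k) \<in> set special_steps)"
    using young_insert_disj[OF middle_young[OF assms(1)] n(1,2)] .
  then show ?thesis
  proof (elim disjE exE conjE)
    assume c: "closed E8 z" "closed E8 (insert n z)"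
    then have "n \<in> set (added E8 b xs)"
      using closed_insert_upto n(1) unfolding z by blast
    with bspec[OF middle_added_table d, unfolded prod.case]
    obtain m where m: "m \<in> set (removed E8 b xs)" "col E8 m = col E8 n"
      unfolding list_all_iff list_ex_iff by blast
    have "closed E8 (z - {m})" "m \<in> z"
      using closed_removed c(1) m(1) unfolding z by blast+
    moreover have "ideal E8 z"
      using middle_young[OF assms(1)] c(1) not_closed_special
      unfolding young_def special_def spec1_upto spec2_upto by (auto simp: closed_shift)
    ultimately have "m \<in> remm E8 i z"
      using m(2) n(3) ideal_remove by (auto simp: remm_iff young_def)
    then show ?thesis by blast
  next
    fix k assume k: "(shift E8 k z, n + step E8 * k) \<in> set special_steps"
    then obtain a where a: "a \<in> {13, 16}" "missing (shift E8 k z) a"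
      using missing_special(1) by blast
    have b: "b \<notin> set xs" "0 \<le> b" "b < 30" "b \<noteq> 13" "b = 16 \<longrightarrow> (j, xs) = (2, [17])"
      using bspec[OF middle_data_missing(1) d] bspec[OF middle_data_special d] by simp_all
    have "missing (shift E8 0 z) b"
      using b(1) z missing_upto by simp
    with a b(2-4) have "k = 0" "b = 16"
      using shifts_equal[of k z a 0 b] by auto
    then have "z = upto_set 16 [17]" "(z, n) \<in> set special_steps"
      using b(5) z k by simp_all
    then have z: "z = upto_set 16 [17]" and "n = 18"
      by (auto simp: special_steps_def)
    then have "i = 2"
      using n(3) col_13 by simp
    moreover have "13 \<in> upto_set 16 [17]" "13 \<notin> upto_set 13 [14, 15, 17]"
      by (simp_all add: upto_set_def)
    then have "upto_set 16 [17] - {13} = upto_set 13 [14, 15, 17]"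
      using special_insert_eqs(1) by blast
    ultimately have "13 \<in> remm E8 i z"
      using col_13 special_young(1) \<open>13 \<in> _\<close> by (simp add: remm_iff z)
    then show ?thesis by blast
  qed
qed


lemma remm_middle:
  assumes z: "young E8 z" "m \<in> remm E8 i z" "n \<in> addm E8 i z" and n: "to_remm E8 i (insert n z) n"
  shows "midm E8 i z"
proof -
  have nz: "insert n z - {n} = z"
    using z(3) by (simp add: addm_iff)
  show ?thesis
    unfolding midm_def
  proof (intro exI[of _ "insert n z"] conjI disjI2)
    show "young E8 (insert n z)"
      using z(3) by (simp add: addm_iff)
    show "\<exists>n'. to_remm E8 i (insert n z) n' \<and> z = insert n z - {n'}"
      using n nz by metis
    show "remm E8 i z \<noteq> {}"
      using z(2) by blast
  qed
qed

section \<open>Adding undoes removing\<close>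

text \<open>Two things could go wrong after the removal: rule (b) could block the colour
  \<open>i\<close>, or rule (a) could select another \<open>i\<close>-block. Both would conflict
  with the fact that rule (b) permitted the removal or with the uniqueness of the colour of a middle
  column.\<close>

lemma estep_fstep:
  assumes "young T y" "estep T i y n"
  shows "fstep T i (y - {n}) m \<longleftrightarrow> m = n"
proof -
  have n: "n \<in> y" "young T (y - {n})" "col T n = i" "to_remm T i y n"
    using assms(2) by (auto simp: estep_def to_remm_def remm_iff)
  have ins: "insert n (y - {n}) = y"
    using n by auto
  have add: "n \<in> addm T i (y - {n})"
    using n assms(1) unfolding addm_iff ins by simp
  \<comment> \<open>In a middle column any addable colour is also removable. So
    \<open>y - {n}\<close>, reached by removing an \<open>i\<close>-block, would also be in the
    middle of an \<open>i\<close>-string, and a column is in the middle for one colour only.\<close>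
  have nomid: "\<not> (T = E8 \<and> (\<exists>j. j \<noteq> i \<and> midm T j (y - {n})))"
  proof
    assume "T = E8 \<and> (\<exists>j. j \<noteq> i \<and> midm T j (y - {n}))"
    then obtain j where T: "T = E8" and j: "j \<noteq> i" "midm E8 j (y - {n})"
      by auto
    from midm_middle[OF j(2)] obtain k where k: "middle j (shift E8 k (y - {n}))" ..
    have "n + step E8 * k \<in> addm E8 i (shift E8 k (y - {n}))"
      using add T unfolding addm_shift by (simp add: mem_shift)
    from middle_remm[OF k this] have "remm E8 i (y - {n}) \<noteq> {}"
      by (simp add: remm_shift)
    then have "midm E8 i (y - {n})"
      using remm_middle[of "y - {n}" _ i n, unfolded ins] add n(2,4) T by blast
    with midm_unique j show False by blast
  qed
  have "to_addm T i (y - {n}) l \<longleftrightarrow> l = n" for l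
  proof (cases "addm T i (y - {n}) = {n}")
    case True
    then show ?thesis
      by (auto simp: to_addm_def)
  next
    case False
    then obtain q where q: "q \<in> addm T i (y - {n})" "n \<noteq> q"
      using add by blast
    with addm_pair[OF n(2) add] obtain k P Q where T: "T = E8" and k: "pair i P Q (shift E8 k (y - {n}))"
      by blast
    have l: "to_addm T i (y - {n}) l \<longleftrightarrow> l + step E8 * k = P" for l
      using paired_add(2)[OF k] to_addm_shift T by metis
    have y: "insert (n + step E8 * k) (shift E8 k (y - {n})) = shift E8 k y"
      unfolding shift_insert[symmetric] ins ..
    have "n + step E8 * k \<in> addm E8 i (shift E8 k (y - {n}))"
      using add T unfolding addm_shift by (simp add: mem_shift)
    then have "n + step E8 * k = P \<or> n + step E8 * k = Q"
      unfolding paired_add(1)[OF k] by simp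
    \<comment> \<open>If the removed block were \<open>Q\<close>, then \<open>y\<close> would be the
      pair column with \<open>Q\<close> alone, a middle column of another colour, on which
      \<open>e\<close> of colour \<open>i\<close> vanishes.\<close>
    moreover have "n + step E8 * k \<noteq> Q"
    proof
      assume "n + step E8 * k = Q"
      with pair_middle(2)[OF k] y obtain j where "j \<noteq> i" "middle j (shift E8 k y)"
        by metis
      with middle_midm assms(2) T show False
        unfolding estep_def by blast
    qed
    ultimately show ?thesis
      unfolding l by auto
  qed
  with nomid show ?thesis
    by (simp add: fstep_def)
qed

lemma fstep_unique: "young T y \<Longrightarrow> fstep T i y n \<Longrightarrow> fstep T i y m \<Longrightarrow> n = m"
  unfolding fstep_def using to_addm_unique by blast

text \<open>Every maximal block of a Young column can be removed, with an exception in the middle of strings.\<close>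

lemma ex_estep:
  assumes "young T y" "remm T i y \<noteq> {}" "\<not> (T = E8 \<and> (\<exists>j. j \<noteq> i \<and> midm T j y))"
  shows "\<exists>n. estep T i y n"
  using ex_to_remm[OF assms(1,2)] assms(3) unfolding estep_def by blast

section \<open>Translation from sets of blocks\<close>

definition motion :: "affine_type \<Rightarrow> int \<Rightarrow> bool \<Rightarrow> block \<Rightarrow> block" where
  "motion T c r b = translate_block c (if r then rotate_block T b else b)"

definition place :: "affine_type \<Rightarrow> int \<Rightarrow> bool \<Rightarrow> int \<Rightarrow> block" where
  "place T c r n = motion T c r (blk T n)"

lemma place_0: "place T 0 False = blk T"
  by (rule ext) (simp add: place_def motion_def translate_block_def del: colour_blk)

lemma motion_sel [simp]:
  "cube (motion T c r b) = cube b + c" "colour (motion T c r b) = colour b"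
  "cells (motion T c r b) = (if r then rotate_cell T ` cells b else cells b)"
  by (auto simp: motion_def translate_block_def rotate_block_def)

lemma move_motion: "move T k = motion T (cubes T * k) (twisted T k)"
  by (auto simp: move_def motion_def)

lemma cells_motion: "cells b \<subseteq> grid T \<Longrightarrow> cells (motion T c r b) \<subseteq> grid T"
  using rotate_cell_grid by (auto simp: image_subset_iff)

lemma motion_motion:
  assumes "cells b \<subseteq> grid T"
  shows "motion T c r (motion T c' r' b) = motion T (c + c') (r \<noteq> r') b"
  using rotate_cells_rotate_cells[OF assms] by (intro block.expand) auto

lemma motion_inverse: "cells b \<subseteq> grid T \<Longrightarrow> motion T (- c) r (motion T c r b) = b"
  by (subst motion_motion) (auto intro: block.expand)

lemma cells_place: "cells (place T c r n) \<subseteq> grid T"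
  unfolding place_def by (intro cells_motion cells_blk)

lemma motion_place: "motion T c r (place T c' r' n) = place T (c + c') (r \<noteq> r') n"
  unfolding place_def by (intro motion_motion cells_blk)

lemma motion_place_image: "motion T c r ` place T c' r' ` y = place T (c + c') (r \<noteq> r') ` y"
  by (simp add: image_image motion_place)

lemma inj_place: "inj (place T c r)"
proof (rule injI)
  fix n m assume "place T c r n = place T c r m"
  then have "motion T (- c) r (place T c r n) = motion T (- c) r (place T c r m)"
    by simp
  then have "blk T n = blk T m"
    by (simp add: motion_place place_0)
  then show "n = m"
    using inj_blk by (simp add: inj_eq)
qed

lemma place_image_eq_iff [simp]: "place T c r ` x = place T c r ` y \<longleftrightarrow> x = y"
  by (rule inj_image_eq_iff[OF inj_place])

lemma place_mem_image [simp]: "place T c r n \<in> place T c r ` y \<longleftrightarrow> n \<in> y"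
  by (rule inj_image_mem_iff[OF inj_place])

lemma lies_on_place: "lies_on (place T c r n) (place T c r m) \<longleftrightarrow> m \<in> set (low T n)"
proof -
  have "rotate_cell T ` cells (blk T n) \<inter> rotate_cell T ` cells (blk T m) =
      rotate_cell T ` (cells (blk T n) \<inter> cells (blk T m))"
    using inj_on_rotate_cell cells_blk by (metis inj_on_image_Int)
  then have "lies_on (place T c r n) (place T c r m) \<longleftrightarrow> lies_on (blk T n) (blk T m)"
    by (auto simp: lies_on_def place_def)
  then show ?thesis
    by (simp add: lies_on_blk)
qed

lemma cube_bounded_iff: "(\<exists>K. \<forall>n\<in>y. cube (blk T n) \<le> K) \<longleftrightarrow> (\<exists>N. y \<subseteq> {..N})"
proof
  assume "\<exists>K. \<forall>n\<in>y. cube (blk T n) \<le> K"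
  then obtain K where K: "\<forall>n\<in>y. cube (blk T n) \<le> K" ..
  have "n \<le> step T * (\<bar>K\<bar> + 1)" if "n \<in> y" for n
  proof -
    have "cubes T * (n div step T) < K"
      using cube_blk_bounds(1)[of T n] bspec[OF K that] by linarith
    moreover have "n div step T \<le> cubes T * (n div step T)" if "0 \<le> n div step T"
      using that cubes_pos[of T] by (simp add: mult_le_cancel_right1)
    ultimately have "n div step T \<le> \<bar>K\<bar>"
      by linarith
    then have "step T * (n div step T) \<le> step T * \<bar>K\<bar>"
      using step_pos[of T] by (intro mult_left_mono) auto
    moreover have "n mod step T < step T"
      using step_pos[of T] by simp
    ultimately have "step T * (n div step T) + n mod step T \<le> step T * (\<bar>K\<bar> + 1)"
      by (simp only: distrib_left)
    then show ?thesis
      by simp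
  qed
  then show "\<exists>N. y \<subseteq> {..N}"
    by (intro exI[of _ "step T * (\<bar>K\<bar> + 1)"]) blast
next
  assume "\<exists>N. y \<subseteq> {..N}"
  then obtain N where N: "y \<subseteq> {..N}" ..
  have "cube (blk T n) \<le> cubes T * (N div step T) + cubes T" if "n \<in> y" for n
  proof -
    have "n div step T \<le> N div step T"
      using that N step_pos[of T] by (intro zdiv_mono1) auto
    then have "cubes T * (n div step T) \<le> cubes T * (N div step T)"
      using cubes_pos[of T] by (intro mult_left_mono) auto
    with cube_blk_bounds(2)[of T n] show ?thesis
      by linarith
  qed
  then show "\<exists>K. \<forall>n\<in>y. cube (blk T n) \<le> K"
    by blast
qed

lemma supported_column_place: "supported_column (range (place T c r)) (place T c r ` y) \<longleftrightarrow> ideal T y"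
proof -
  have "(\<exists>K. \<forall>n\<in>y. cube (blk T n) + c \<le> K) \<longleftrightarrow> (\<exists>K. \<forall>n\<in>y. cube (blk T n) \<le> K)"
  proof
    assume "\<exists>K. \<forall>n\<in>y. cube (blk T n) + c \<le> K"
    then obtain K where "\<forall>n\<in>y. cube (blk T n) + c \<le> K" ..
    then have "\<forall>n\<in>y. cube (blk T n) \<le> K - c" by auto
    then show "\<exists>K. \<forall>n\<in>y. cube (blk T n) \<le> K" ..
  next
    assume "\<exists>K. \<forall>n\<in>y. cube (blk T n) \<le> K"
    then obtain K where "\<forall>n\<in>y. cube (blk T n) \<le> K" ..
    then have "\<forall>n\<in>y. cube (blk T n) + c \<le> K + c" by auto
    then show "\<exists>K. \<forall>n\<in>y. cube (blk T n) + c \<le> K" ..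
  qed
  then have "(\<exists>K. \<forall>b\<in>place T c r ` y. cube b \<le> K) \<longleftrightarrow> (\<exists>N. y \<subseteq> {..N})"
    by (simp add: cube_bounded_iff place_def)
  then show ?thesis
    by (auto simp: supported_column_def ideal_def closed_def lies_on_place subset_iff)
qed

lemma equiv_columns_iff: "equiv_columns T y y' \<longleftrightarrow> (\<exists>c r. y' = motion T c r ` y)"
proof -
  have "motion T c False ` y = translate_block c ` y" "motion T c True ` y = translate_block c ` rotate_block T ` y" for c
    by (auto simp: motion_def image_image)
  then show ?thesis
    unfolding equiv_columns_def by (metis (full_types))
qed

lemma equiv_columns_place_left:
  "equiv_columns T (place T c r ` y) z \<longleftrightarrow> equiv_columns T (blk T ` y) z"
proof
  assume "equiv_columns T (place T c r ` y) z"
  then obtain c' r' where "z = motion T c' r' ` place T c r ` y"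
    unfolding equiv_columns_iff by blast
  also have "\<dots> = motion T (c' + c) (r' \<noteq> r) ` place T 0 False ` y"
    unfolding motion_place_image by simp
  finally show "equiv_columns T (blk T ` y) z"
    unfolding equiv_columns_iff place_0 by blast
next
  assume "equiv_columns T (blk T ` y) z"
  then obtain c' r' where "z = motion T c' r' ` place T 0 False ` y"
    unfolding equiv_columns_iff place_0 by blast
  also have "\<dots> = motion T (c' - c) (r' \<noteq> r) ` place T c r ` y"
    unfolding motion_place_image by (cases r; cases r'; simp)
  finally show "equiv_columns T (place T c r ` y) z"
    unfolding equiv_columns_iff by blast
qed

lemma equiv_columns_place_right:
  "equiv_columns T (blk T ` x) (place T c r ` y) \<longleftrightarrow> equiv_columns T (blk T ` x) (blk T ` y)"
proof
  assume "equiv_columns T (blk T ` x) (place T c r ` y)"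
  then obtain c' r' where "place T c r ` y = motion T c' r' ` place T 0 False ` x"
    unfolding equiv_columns_iff place_0 by blast
  then have "motion T (- c) r ` place T c r ` y = motion T (- c) r ` motion T c' r' ` place T 0 False ` x"
    by simp
  then have "blk T ` y = motion T (c' - c) (r' \<noteq> r) ` place T 0 False ` x"
    unfolding motion_place_image by (cases r; cases r'; simp add: place_0)
  then show "equiv_columns T (blk T ` x) (blk T ` y)"
    unfolding equiv_columns_iff place_0 by blast
next
  assume "equiv_columns T (blk T ` x) (blk T ` y)"
  then obtain c' r' where "place T 0 False ` y = motion T c' r' ` place T 0 False ` x"
    unfolding equiv_columns_iff place_0 by blast
  then have "motion T c r ` place T 0 False ` y = motion T c r ` motion T c' r' ` place T 0 False ` x"
    by simp
  then have "place T c r ` y = motion T (c + c') (r \<noteq> r') ` place T 0 False ` x"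
    unfolding motion_place_image by simp
  then show "equiv_columns T (blk T ` x) (place T c r ` y)"
    unfolding equiv_columns_iff place_0 by blast
qed

lemma blk_shift_image: "blk T ` shift T k y = move T k ` blk T ` y"
  by (auto simp: shift_def image_image blk_shift)

text \<open>A column contains blocks of colour 0, and these determine the motion: there is one per step.\<close>

lemma equiv_columns_blk:
  assumes "n \<in> y" "col T n = 0"
  shows "equiv_columns T (blk T ` y) (blk T ` z) \<longleftrightarrow> (\<exists>k. z = shift T k y)"
proof
  assume "equiv_columns T (blk T ` y) (blk T ` z)"
  then obtain c r where z: "blk T ` z = motion T c r ` blk T ` y"
    unfolding equiv_columns_iff by blast
  \<comment> \<open>Motions preserve colours, so a \<open>0\<close>-block goes to a
    \<open>0\<close>-block, and any two of these differ by a whole number of steps.\<close>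
  then obtain m where m: "motion T c r (blk T n) = blk T m"
    using assms(1) by blast
  then have "col T m = 0"
    using assms(2) by (metis colour_blk motion_sel(2))
  then obtain p q where n: "n = 0 + step T * p" and m': "m = 0 + step T * q"
    using assms(2) by (auto simp: col_eq_0_iff dvd_def)
  have eq: "motion T (c + cubes T * p) (r \<noteq> twisted T p) (blk T 0) = motion T (cubes T * q) (twisted T q) (blk T 0)"
    using m unfolding n m' blk_shift move_motion by (simp only: motion_motion[OF cells_blk])
  have "cube (blk T 0) + (c + cubes T * p) = cube (blk T 0) + cubes T * q"
    using arg_cong[OF eq, of cube] by simp
  then have c: "c = cubes T * (q - p)"
    by (simp add: right_diff_distrib)
  \<comment> \<open>The \<open>0\<close>-block is not symmetric under the rotation, so its image
    also tells whether the motion rotates.\<close>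
  have asym: "rotate_cell T ` cells (blk T 0) \<noteq> cells (blk T 0)"
    by (cases T; hypsubst; code_simp)
  have "(r \<noteq> twisted T p) = twisted T q"
    using arg_cong[OF eq, of cells] asym by (auto split: if_splits)
  then have "r = twisted T (q - p)"
    by (auto simp: twisted_def)
  with c z have "blk T ` z = blk T ` shift T (q - p) y"
    by (simp add: blk_shift_image move_motion)
  then show "\<exists>k. z = shift T k y"
    using inj_image_eq_iff[OF inj_blk] by blast
next
  assume "\<exists>k. z = shift T k y"
  then show "equiv_columns T (blk T ` y) (blk T ` z)"
    unfolding equiv_columns_iff using blk_shift_image move_motion by metis
qed

lemma young_bounds:
  assumes "young T y"
  shows "\<exists>L. {..<L} \<subseteq> y \<and> y \<subseteq> {..<L + 32}"
proof (cases "ideal T y")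
  case True
  then show ?thesis
    by (rule ideal_bounds)
next
  case False
  then have "special y"
    using assms by (simp add: young_def)
  then obtain k u where y: "y = shift E8 k u" and "u = spec1 \<or> u = spec2"
    unfolding special_def by blast
  then have u: "{..<13} \<subseteq> u" "u \<subseteq> {..<45}"
    by (auto simp: spec1_def spec2_def)
  have "{..<13 + step E8 * k} \<subseteq> y" "y \<subseteq> {..<13 + step E8 * k + 32}"
    using u unfolding y by (auto simp: mem_shift subset_iff)
  then show ?thesis
    by blast
qed

lemma young_has_0:
  assumes "young T y"
  obtains n where "n \<in> y" "col T n = 0"
proof -
  obtain L where L: "{..<L} \<subseteq> y"
    using young_bounds[OF assms] by blast
  have "step T * ((L - 1) div step T) \<le> L - 1"
    using step_pos[of T] by (metis mult.commute div_mult_mod_eq le_add_same_cancel1 pos_mod_sign)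
  with L have "step T * ((L - 1) div step T) \<in> y"
    by auto
  moreover have "col T (step T * ((L - 1) div step T)) = 0"
    by (simp add: col_eq_0_iff)
  ultimately show ?thesis
    by (rule that)
qed


section \<open>The special columns as sets of integers\<close>

lemma cube_table:
  "\<forall>n\<in>set [0..29]. cube (blk E8 n) \<le> 4 \<longleftrightarrow> n \<le> 12"
  "\<forall>n\<in>set [0..29]. cube (blk E8 n) \<le> 5 \<longleftrightarrow> n \<le> 15"
  "\<forall>n\<in>set [0..29]. cube (blk E8 n) \<le> 6 \<longleftrightarrow> n \<le> 17"
  "\<forall>n\<in>set [0..29]. cube (blk E8 n) \<le> 7 \<longleftrightarrow> n \<le> 20"
  by code_simp+

lemma col_table:
  "col E8 13 = 2" "col E8 14 = 3" "col E8 15 = 5" "col E8 18 = 2" "col E8 19 = 3" "col E8 20 = 5"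
  by code_simp+

lemma cells_16_17: "cells (blk E8 17) = UNIV \<times> {4..6}" "cells (blk E8 16) \<noteq> UNIV \<times> {4..6}"
proof -
  have c17: "cells (blk E8 17) = set [(Upper, 4), (Upper, 5), (Upper, 6), (Lower, 4), (Lower, 5), (Lower, 6)]"
    by code_simp
  have c16: "(Upper, 1) \<in> cells (blk E8 16)"
    by code_simp
  have "{4..6 :: nat} = set [4, 5, 6]"
    by auto
  then have "set [(Upper, 4 :: nat), (Upper, 5), (Upper, 6), (Lower, 4), (Lower, 5), (Lower, 6)] = UNIV \<times> {4..6}"
    by (simp only: row_UNIV) force
  with c17 show "cells (blk E8 17) = UNIV \<times> {4..6}"
    by (rule trans)
  show "cells (blk E8 16) \<noteq> UNIV \<times> {4..6}"
  proof
    assume "cells (blk E8 16) = UNIV \<times> {4..6}"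
    with c16 have "(1 :: nat) \<in> {4..6}"
      by blast
    then show False by simp
  qed
qed

lemma special_table:
  assumes "n \<in> set [0..29]"
  shows "(cube (blk E8 n) \<le> 4 \<or> cube (blk E8 n) = 5 \<and> col E8 n \<in> {5, 3} \<or>
       cube (blk E8 n) = 6 \<and> cells (blk E8 n) = UNIV \<times> {4..6}) \<longleftrightarrow> n \<le> 12 \<or> n = 14 \<or> n = 15 \<or> n = 17"
  "(cube (blk E8 n) \<le> 5 \<or> cube (blk E8 n) = 6 \<and> cells (blk E8 n) = UNIV \<times> {4..6} \<or>
       cube (blk E8 n) = 7 \<and> col E8 n = 2) \<longleftrightarrow> n \<le> 15 \<or> n = 17 \<or> n = 18"
proof -
  note c = bspec[OF cube_table(1) assms] bspec[OF cube_table(2) assms] bspec[OF cube_table(3) assms] bspec[OF cube_table(4) assms]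
  have "cube (blk E8 n) = 5 \<longleftrightarrow> cube (blk E8 n) \<le> 5 \<and> \<not> cube (blk E8 n) \<le> 4"
    by linarith
  moreover have "n \<le> 15 \<and> \<not> n \<le> 12 \<longleftrightarrow> n = 13 \<or> n = 14 \<or> n = 15"
    by arith
  ultimately have c5: "cube (blk E8 n) = 5 \<longleftrightarrow> n = 13 \<or> n = 14 \<or> n = 15"
    unfolding c by (rule trans)
  have "cube (blk E8 n) = 6 \<longleftrightarrow> cube (blk E8 n) \<le> 6 \<and> \<not> cube (blk E8 n) \<le> 5"
    by linarith
  moreover have "n \<le> 17 \<and> \<not> n \<le> 15 \<longleftrightarrow> n = 16 \<or> n = 17"
    by arith
  ultimately have c6: "cube (blk E8 n) = 6 \<longleftrightarrow> n = 16 \<or> n = 17"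
    unfolding c by (rule trans)
  have "cube (blk E8 n) = 7 \<longleftrightarrow> cube (blk E8 n) \<le> 7 \<and> \<not> cube (blk E8 n) \<le> 6"
    by linarith
  moreover have "n \<le> 20 \<and> \<not> n \<le> 17 \<longleftrightarrow> n = 18 \<or> n = 19 \<or> n = 20"
    by arith
  ultimately have c7: "cube (blk E8 n) = 7 \<longleftrightarrow> n = 18 \<or> n = 19 \<or> n = 20"
    unfolding c by (rule trans)
  have 17: "(n = 16 \<or> n = 17) \<and> cells (blk E8 n) = UNIV \<times> {4..6} \<longleftrightarrow> n = 17"
    using cells_16_17 by blast
  have i: "(n = 13 \<or> n = 14 \<or> n = 15) \<and> col E8 n \<in> {5, 3} \<longleftrightarrow> n = 14 \<or> n = 15"
    by (auto simp: col_table)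
  have j: "(n = 18 \<or> n = 19 \<or> n = 20) \<and> col E8 n = 2 \<longleftrightarrow> n = 18"
    by (auto simp: col_table)
  show "(cube (blk E8 n) \<le> 4 \<or> cube (blk E8 n) = 5 \<and> col E8 n \<in> {5, 3} \<or>
       cube (blk E8 n) = 6 \<and> cells (blk E8 n) = UNIV \<times> {4..6}) \<longleftrightarrow> n \<le> 12 \<or> n = 14 \<or> n = 15 \<or> n = 17"
    unfolding c(1) c5 c6 17 i by blast
  show "(cube (blk E8 n) \<le> 5 \<or> cube (blk E8 n) = 6 \<and> cells (blk E8 n) = UNIV \<times> {4..6} \<or>
       cube (blk E8 n) = 7 \<and> col E8 n = 2) \<longleftrightarrow> n \<le> 15 \<or> n = 17 \<or> n = 18"
    unfolding c(2) c6 c7 17 j by blast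
qed

lemma cube_blk_E8: "n < 0 \<Longrightarrow> cube (blk E8 n) \<le> 0" "30 \<le> n \<Longrightarrow> 11 \<le> cube (blk E8 n)"
proof -
  have c: "cubes E8 = 10" "step E8 = 30"
    by (simp_all add: cubes_def step_def)
  show "cube (blk E8 n) \<le> 0" if "n < 0"
  proof -
    have "n div 30 < 0"
      using that by simp
    then show ?thesis
      using cube_blk_bounds(2)[of E8 n] unfolding c by linarith
  qed
  show "11 \<le> cube (blk E8 n)" if "30 \<le> n"
  proof -
    have "1 \<le> n div 30"
      using zdiv_mono1[OF that, of 30] by simp
    then show ?thesis
      using cube_blk_bounds(1)[of E8 n] unfolding c by linarith
  qed
qed

lemma special1_blk: "special1 = blk E8 ` spec1"
proof -
  have "blk E8 n \<in> special1 \<longleftrightarrow> n \<in> spec1" for n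
  proof -
    consider "n < 0" | "n \<in> set [0..29]" | "30 \<le> n"
      by (cases "n < 0"; cases "30 \<le> n") auto
    then show ?thesis
    proof cases
      case 2
      have "blk E8 n \<in> column_pattern E8"
        using range_blk by blast
      then show ?thesis
        using special_table(1)[OF 2] unfolding special1_def mem_Collect_eq
        by (simp add: spec1_def disj_ac)
    qed (use cube_blk_E8[of n] range_blk in \<open>auto simp: special1_def spec1_def\<close>)
  qed
  moreover have "special1 \<subseteq> range (blk E8)"
    unfolding range_blk by (auto simp: special1_def)
  ultimately show ?thesis
    by blast
qed

lemma special2_blk: "special2 = blk E8 ` spec2"
proof -
  have "blk E8 n \<in> special2 \<longleftrightarrow> n \<in> spec2" for n
  proof -
    consider "n < 0" | "n \<in> set [0..29]" | "30 \<le> n"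
      by (cases "n < 0"; cases "30 \<le> n") auto
    then show ?thesis
    proof cases
      case 2
      have "blk E8 n \<in> column_pattern E8"
        using range_blk by blast
      then show ?thesis
        using special_table(2)[OF 2] unfolding special2_def mem_Collect_eq
        by (simp add: spec2_def disj_ac)
    qed (use cube_blk_E8[of n] range_blk in \<open>auto simp: special2_def spec2_def\<close>)
  qed
  moreover have "special2 \<subseteq> range (blk E8)"
    unfolding range_blk by (auto simp: special2_def)
  ultimately show ?thesis
    by blast
qed

lemma young_column_place: "young_column T (range (place T c r)) (place T c r ` y) \<longleftrightarrow> young T y"
proof -
  \<comment> \<open>Block 0 is a \<open>0\<close>-block in both special columns; its presence turns
    equivalence with them into translation.\<close>
  have "col E8 0 = 0" "0 \<in> spec1" "0 \<in> spec2"
    by (simp_all add: col_eq_0_iff spec1_def spec2_def)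
  then have "equiv_columns E8 special1 (place E8 c r ` y) \<or> equiv_columns E8 special2 (place E8 c r ` y) \<longleftrightarrow> special y"
    unfolding special1_blk special2_blk equiv_columns_place_right special_def
    using equiv_columns_blk[of 0 spec1 E8 y] equiv_columns_blk[of 0 spec2 E8 y] by blast
  moreover have "place T c r ` y \<subseteq> range (place T c r)"
    by blast
  ultimately show ?thesis
    unfolding young_column_def young_def supported_column_place by blast
qed

lemma young_column_subset: "young_column T P y \<Longrightarrow> y \<subseteq> P"
  by (auto simp: young_column_def supported_column_def)

lemma young_columnE:
  assumes "young_column T (range (place T c r)) z"
  obtains y where "z = place T c r ` y" "young T y"
proof -
  obtain y where "z = place T c r ` y"
    using young_column_subset[OF assms] by (auto simp: subset_image_iff)
  then show ?thesis
    using that assms young_column_place by blast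
qed

lemma young_column_blk: "young_column T (column_pattern T) (blk T ` y) \<longleftrightarrow> young T y"
  using young_column_place[of T 0 False y] by (simp add: place_0 range_blk)

lemma young_column_blkE:
  assumes "young_column T (column_pattern T) z"
  obtains y where "z = blk T ` y" "young T y"
  using young_columnE[of T 0 False z] assms by (auto simp: place_0 range_blk)

section \<open>Equivalence classes as orbits of translations\<close>

definition cl :: "affine_type \<Rightarrow> int set \<Rightarrow> block set set" where
  "cl T y = column_class T (blk T ` y)"

lemma column_class_place: "column_class T (place T c r ` y) = cl T y"
  unfolding column_class_def cl_def equiv_columns_place_left ..

lemma mem_cl_iff:
  assumes "young T y"
  shows "z \<in> cl T y \<longleftrightarrow> (\<exists>k. z = blk T ` shift T k y)"
proof -
  obtain n where n: "n \<in> y" "col T n = 0"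
    using young_has_0[OF assms] .
  show ?thesis
  proof
    assume "z \<in> cl T y"
    then have z: "young_column T (column_pattern T) z" "equiv_columns T (blk T ` y) z"
      by (simp_all add: cl_def column_class_def)
    from z(1) obtain x where x: "z = blk T ` x"
      by (rule young_column_blkE)
    have "\<exists>k. x = shift T k y"
      using z(2) unfolding x equiv_columns_blk[OF n] .
    then show "\<exists>k. z = blk T ` shift T k y"
      unfolding x by (elim exE) (rule exI, rule arg_cong)
  next
    assume "\<exists>k. z = blk T ` shift T k y"
    then obtain k where k: "z = blk T ` shift T k y" ..
    have "equiv_columns T (blk T ` y) z"
      unfolding k equiv_columns_blk[OF n] by blast
    moreover have "young_column T (column_pattern T) z"
      unfolding k young_column_blk young_shift by (rule assms)
    ultimately show "z \<in> cl T y"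
      unfolding cl_def column_class_def mem_Collect_eq by (intro conjI)
  qed
qed

lemma cl_eq_iff:
  assumes "young T y" "young T z"
  shows "cl T y = cl T z \<longleftrightarrow> (\<exists>k. z = shift T k y)"
proof
  assume eq: "cl T y = cl T z"
  have "blk T ` shift T 0 z \<in> cl T y"
    unfolding eq mem_cl_iff[OF assms(2)] by (rule exI, rule refl)
  then obtain k where "blk T ` z = blk T ` shift T k y"
    unfolding mem_cl_iff[OF assms(1)] shift_0 ..
  then have "z = shift T k y"
    unfolding inj_image_eq_iff[OF inj_blk] .
  then show "\<exists>k. z = shift T k y" ..
next
  assume "\<exists>k. z = shift T k y"
  then obtain k where k: "z = shift T k y" ..
  have "w \<in> cl T y \<longleftrightarrow> w \<in> cl T z" for w
  proof -
    have 1: "w = blk T ` shift T j y \<Longrightarrow> w = blk T ` shift T (j - k) z" for j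
      by (simp add: k)
    have 2: "w = blk T ` shift T j z \<Longrightarrow> w = blk T ` shift T (j + k) y" for j
      by (simp add: k)
    show ?thesis
      unfolding mem_cl_iff[OF assms(1)] mem_cl_iff[OF assms(2)] by (rule iffI; erule exE; rule exI; erule 1 2)
  qed
  then show "cl T y = cl T z"
    by (rule set_eqI)
qed

lemma cl_shift: "young T y \<Longrightarrow> cl T (shift T k y) = cl T y"
  using cl_eq_iff[of T y "shift T k y"] young_shift by blast

lemma classes_cl: "classes T = cl T ` {y. young T y}"
proof
  show "classes T \<subseteq> cl T ` {y. young T y}"
  proof
    fix c assume "c \<in> classes T"
    then obtain z where "young_column T (column_pattern T) z" "c = column_class T z"
      unfolding classes_def by blast
    then show "c \<in> cl T ` {y. young T y}"
      unfolding cl_def by (metis (mono_tags) imageI mem_Collect_eq young_column_blkE)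
  qed
  show "cl T ` {y. young T y} \<subseteq> classes T"
    unfolding classes_def cl_def using young_column_blk by blast
qed

lemma some_mem_cl:
  assumes "young T y"
  obtains k where "(SOME z. z \<in> cl T y) = blk T ` shift T k y"
proof -
  have "blk T ` shift T 0 y \<in> cl T y"
    unfolding mem_cl_iff[OF assms] by (rule exI, rule refl)
  then have "(SOME z. z \<in> cl T y) \<in> cl T y"
    by (rule someI)
  from iffD1[OF mem_cl_iff[OF assms] this] show ?thesis
    by (elim exE) (rule that)
qed

lemma blk_eq_iff: "blk T n = blk T m \<longleftrightarrow> n = m"
  by (rule inj_eq[OF inj_blk])

lemma blk_mem: "blk T n \<in> blk T ` y \<longleftrightarrow> n \<in> y"
  by (rule inj_image_mem_iff[OF inj_blk])

lemma blk_insert: "insert (blk T n) (blk T ` y) = blk T ` insert n y"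
  by (rule image_insert[symmetric])

lemma blk_Diff: "blk T ` y - {blk T n} = blk T ` (y - {n})"
  by (simp add: image_set_diff[OF inj_blk])

lemma blk_pattern: "blk T n \<in> column_pattern T"
  unfolding range_blk[symmetric] by (rule rangeI)

lemma eq_image_blk:
  assumes "A \<subseteq> column_pattern T" "\<And>n. blk T n \<in> A \<longleftrightarrow> n \<in> y"
  shows "A = blk T ` y"
proof
  show "A \<subseteq> blk T ` y"
  proof
    fix b assume b: "b \<in> A"
    then have "b \<in> range (blk T)"
      unfolding range_blk using assms(1) by (rule rev_subsetD)
    then obtain n where "b = blk T n" ..
    with b assms(2)[of n] show "b \<in> blk T ` y"
      by simp
  qed
  show "blk T ` y \<subseteq> A"
    using assms(2) by (auto simp: image_subset_iff)
qed

section \<open>The operators on blocks and on classes\<close>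

lemma addable_blk: "addable T i (blk T ` y) = blk T ` addm T i y"
proof (rule eq_image_blk)
  show "addable T i (blk T ` y) \<subseteq> column_pattern T"
    unfolding addable_def by (rule Collect_restrict)
  show "blk T n \<in> addable T i (blk T ` y) \<longleftrightarrow> n \<in> addm T i y" for n
    unfolding addable_def addm_iff mem_Collect_eq blk_insert young_column_blk blk_mem colour_blk
    by (simp add: blk_pattern)
qed

lemma removable_blk: "removable T i (blk T ` y) = blk T ` remm T i y"
proof (rule eq_image_blk)
  show "removable T i (blk T ` y) \<subseteq> column_pattern T"
    unfolding removable_def range_blk[symmetric] by auto
  show "blk T n \<in> removable T i (blk T ` y) \<longleftrightarrow> n \<in> remm T i y" for n
    unfolding removable_def remm_iff mem_Collect_eq blk_Diff young_column_blk blk_mem colour_blk ..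
qed

lemma card_blk [simp]: "card (blk T ` y) = card y"
  by (rule card_image) (meson inj_blk inj_on_subset subset_UNIV)

lemma on_top_blk: "on_top_of_colour T i (blk T n) \<longleftrightarrow> on_top T i n"
  unfolding on_top_of_colour_def on_top_def range_blk[symmetric] list_ex_iff
  by (auto simp: lies_on_blk)

lemma ball_blk: "(\<forall>b\<in>blk T ` y. R b) \<longleftrightarrow> (\<forall>n\<in>y. R (blk T n))"
  by simp

lemma to_add_blk: "to_add T i (blk T ` y) (blk T n) \<longleftrightarrow> to_addm T i y n"
  unfolding to_add_def to_addm_def addable_blk card_blk blk_mem ball_blk on_top_blk ..

lemma to_addE:
  assumes "to_add T i (blk T ` y) b"
  obtains n where "b = blk T n" "to_addm T i y n"
proof -
  have "b \<in> blk T ` addm T i y"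
    using assms unfolding to_add_def addable_blk by (rule conjunct1)
  then obtain n where "b = blk T n"
    by blast
  with that assms show ?thesis
    by (simp only: to_add_blk)
qed

lemma to_remove_blk: "to_remove T i (blk T ` y) (blk T n) \<longleftrightarrow> to_remm T i y n"
  unfolding to_remove_def to_remm_def removable_blk card_blk blk_mem ball_blk on_top_blk ..

lemma to_removeE:
  assumes "to_remove T i (blk T ` y) b"
  obtains n where "b = blk T n" "to_remm T i y n"
proof -
  have "b \<in> blk T ` remm T i y"
    using assms unfolding to_remove_def removable_blk by (rule conjunct1)
  then obtain n where "b = blk T n"
    by blast
  with that assms show ?thesis
    by (simp only: to_remove_blk)
qed

lemma add_block_blk:
  assumes "young T y"
  shows "add_block T i (blk T ` y) = Some z \<longleftrightarrow> (\<exists>n. to_addm T i y n \<and> z = blk T ` insert n y)"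
proof (cases "\<exists>n. to_addm T i y n")
  case True
  then obtain n where n: "to_addm T i y n" ..
  have "to_add T i (blk T ` y) = (\<lambda>b. b = blk T n)"
  proof (rule ext, rule iffI)
    fix b
    assume "to_add T i (blk T ` y) b"
    then obtain m where "b = blk T m" "to_addm T i y m"
      by (rule to_addE)
    with to_addm_unique[OF assms n] show "b = blk T n"
      by simp
  next
    fix b
    assume "b = blk T n"
    with n show "to_add T i (blk T ` y) b"
      by (simp only: to_add_blk)
  qed
  then have eq: "(\<exists>b. to_add T i (blk T ` y) b) = True" "(SOME b. to_add T i (blk T ` y) b) = blk T n"
    by auto
  have res: "add_block T i (blk T ` y) = Some (blk T ` insert n y)"
    unfolding add_block_def eq by (simp only: if_True blk_insert)
  show ?thesis
  proof
    assume "add_block T i (blk T ` y) = Some z"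
    then have "z = blk T ` insert n y"
      unfolding res option.inject by (rule sym)
    with n show "\<exists>n. to_addm T i y n \<and> z = blk T ` insert n y"
      by (intro exI conjI)
  next
    assume "\<exists>n. to_addm T i y n \<and> z = blk T ` insert n y"
    then obtain m where "to_addm T i y m" "z = blk T ` insert m y"
      by (elim exE conjE)
    with to_addm_unique[OF assms n] res show "add_block T i (blk T ` y) = Some z"
      by (simp only:)
  qed
next
  case False
  then have "\<not> (\<exists>b. to_add T i (blk T ` y) b)"
    by (blast elim: to_addE)
  with False show ?thesis
    unfolding add_block_def by auto
qed

lemma remove_block_blk:
  assumes "young T y"
  shows "remove_block T i (blk T ` y) = Some z \<longleftrightarrow> (\<exists>n. to_remm T i y n \<and> z = blk T ` (y - {n}))"
proof (cases "\<exists>n. to_remm T i y n")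
  case True
  then obtain n where n: "to_remm T i y n" ..
  have "to_remove T i (blk T ` y) = (\<lambda>b. b = blk T n)"
  proof (rule ext, rule iffI)
    fix b
    assume "to_remove T i (blk T ` y) b"
    then obtain m where "b = blk T m" "to_remm T i y m"
      by (rule to_removeE)
    with to_remm_unique[OF assms n] show "b = blk T n"
      by simp
  next
    fix b
    assume "b = blk T n"
    with n show "to_remove T i (blk T ` y) b"
      by (simp only: to_remove_blk)
  qed
  then have eq: "(\<exists>b. to_remove T i (blk T ` y) b) = True" "(SOME b. to_remove T i (blk T ` y) b) = blk T n"
    by auto
  have res: "remove_block T i (blk T ` y) = Some (blk T ` (y - {n}))"
    unfolding remove_block_def eq by (simp only: if_True blk_Diff)
  show ?thesis
  proof
    assume "remove_block T i (blk T ` y) = Some z"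
    then have "z = blk T ` (y - {n})"
      unfolding res option.inject by (rule sym)
    with n show "\<exists>n. to_remm T i y n \<and> z = blk T ` (y - {n})"
      by (intro exI conjI)
  next
    assume "\<exists>n. to_remm T i y n \<and> z = blk T ` (y - {n})"
    then obtain m where "to_remm T i y m" "z = blk T ` (y - {m})"
      by (elim exE conjE)
    with to_remm_unique[OF assms n] res show "remove_block T i (blk T ` y) = Some z"
      by (simp only:)
  qed
next
  case False
  then have "\<not> (\<exists>b. to_remove T i (blk T ` y) b)"
    by (blast elim: to_removeE)
  with False show ?thesis
    unfolding remove_block_def by auto
qed

lemma mid_string_blk: "mid_string T j (blk T ` y) \<longleftrightarrow> midm T j y"
proof -
  have "(add_block T j (blk T ` x) = Some (blk T ` y) \<and> addable T j (blk T ` y) \<noteq> {} \<or>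
       remove_block T j (blk T ` x) = Some (blk T ` y) \<and> removable T j (blk T ` y) \<noteq> {}) \<longleftrightarrow>
     ((\<exists>n. to_addm T j x n \<and> y = insert n x) \<and> addm T j y \<noteq> {} \<or>
      (\<exists>n. to_remm T j x n \<and> y = x - {n}) \<and> remm T j y \<noteq> {})" if "young T x" for x
    unfolding add_block_blk[OF that] remove_block_blk[OF that] addable_blk removable_blk image_is_empty
      inj_image_eq_iff[OF inj_blk] ..
  note eq = this
  show ?thesis
  proof
    assume "mid_string T j (blk T ` y)"
    then obtain z where z: "young_column T (column_pattern T) z"
      "add_block T j z = Some (blk T ` y) \<and> addable T j (blk T ` y) \<noteq> {} \<or>
       remove_block T j z = Some (blk T ` y) \<and> removable T j (blk T ` y) \<noteq> {}"
      unfolding mid_string_def by (elim exE conjE)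
    from z(1) obtain x where x: "z = blk T ` x" "young T x"
      by (rule young_column_blkE)
    show "midm T j y"
      unfolding midm_def using x(2) z(2)[unfolded x(1) eq[OF x(2)]] by (intro exI conjI)
  next
    assume "midm T j y"
    then obtain x where x: "young T x"
      "(\<exists>n. to_addm T j x n \<and> y = insert n x) \<and> addm T j y \<noteq> {} \<or>
       (\<exists>n. to_remm T j x n \<and> y = x - {n}) \<and> remm T j y \<noteq> {}"
      unfolding midm_def by (elim exE conjE)
    have "young_column T (column_pattern T) (blk T ` x)"
      unfolding young_column_blk by (rule x(1))
    with x(2)[folded eq[OF x(1)]] show "mid_string T j (blk T ` y)"
      unfolding mid_string_def by (intro exI conjI)
  qed
qed

lemma f_column_blk:
  assumes "young T y"
  shows "f_column T i (blk T ` y) = Some z \<longleftrightarrow> (\<exists>n. fstep T i y n \<and> z = blk T ` insert n y)"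
  unfolding f_column_def mid_string_blk fstep_def using add_block_blk[OF assms, of i z]
  by (cases "T = E8 \<and> (\<exists>j. j \<noteq> i \<and> midm T j y)") auto

lemma e_column_blk:
  assumes "young T y"
  shows "e_column T i (blk T ` y) = Some z \<longleftrightarrow> (\<exists>n. estep T i y n \<and> z = blk T ` (y - {n}))"
  unfolding e_column_def mid_string_blk estep_def using remove_block_blk[OF assms, of i z]
  by (cases "T = E8 \<and> (\<exists>j. j \<noteq> i \<and> midm T j y)") auto

lemma fstep_shift: "fstep T i (shift T k y) (n + step T * k) \<longleftrightarrow> fstep T i y n"
  by (simp add: fstep_def to_addm_shift midm_shift)

lemma estep_shift: "estep T i (shift T k y) (n + step T * k) \<longleftrightarrow> estep T i y n"
  by (simp add: estep_def to_remm_shift midm_shift)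

lemma fstep_young: "fstep T i y n \<Longrightarrow> young T (insert n y) \<and> n \<notin> y \<and> col T n = i"
  by (simp add: fstep_def to_addm_def addm_iff)

lemma estep_young: "estep T i y n \<Longrightarrow> young T (y - {n}) \<and> n \<in> y \<and> col T n = i"
  by (simp add: estep_def to_remm_def remm_iff)

text \<open>The representative chosen by \<open>SOME\<close> is a translate of \<open>y\<close>, and
  the operators commute with translations, so the choice has no effect on the resulting
  class.\<close>

lemma f_op_cl:
  assumes "young T y"
  shows "f_op T i (cl T y) = Some d \<longleftrightarrow> (\<exists>n. fstep T i y n \<and> d = cl T (insert n y))"
proof -
  obtain k where k: "(SOME z. z \<in> cl T y) = blk T ` shift T k y"
    using some_mem_cl[OF assms] .
  have "f_op T i (cl T y) = Some d \<longleftrightarrow> (\<exists>n. fstep T i (shift T k y) n \<and> d = cl T (insert n (shift T k y)))"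
    unfolding f_op_def k using f_column_blk[of T "shift T k y" i] assms
    by (auto simp: young_shift cl_def)
  also have "\<dots> \<longleftrightarrow> (\<exists>n. fstep T i (shift T k y) (n + step T * k) \<and> d = cl T (insert (n + step T * k) (shift T k y)))"
    by (metis diff_add_cancel)
  also have "\<dots> \<longleftrightarrow> (\<exists>n. fstep T i y n \<and> d = cl T (insert n y))"
    unfolding fstep_shift shift_insert[symmetric] using cl_shift fstep_young by metis
  finally show ?thesis .
qed

lemma e_op_cl:
  assumes "young T y"
  shows "e_op T i (cl T y) = Some d \<longleftrightarrow> (\<exists>n. estep T i y n \<and> d = cl T (y - {n}))"
proof -
  obtain k where k: "(SOME z. z \<in> cl T y) = blk T ` shift T k y"
    using some_mem_cl[OF assms] .
  have "e_op T i (cl T y) = Some d \<longleftrightarrow> (\<exists>n. estep T i (shift T k y) n \<and> d = cl T (shift T k y - {n}))"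
    unfolding e_op_def k using e_column_blk[of T "shift T k y" i] assms
    by (auto simp: young_shift cl_def)
  also have "\<dots> \<longleftrightarrow> (\<exists>n. estep T i (shift T k y) (n + step T * k) \<and> d = cl T (shift T k y - {n + step T * k}))"
    by (metis diff_add_cancel)
  also have "\<dots> \<longleftrightarrow> (\<exists>n. estep T i y n \<and> d = cl T (y - {n}))"
    unfolding estep_shift shift_Diff[symmetric] using cl_shift estep_young by metis
  finally show ?thesis .
qed

section \<open>Strings and the energy function\<close>

definition lengths :: "('a \<Rightarrow> 'a option) \<Rightarrow> 'a \<Rightarrow> nat set" where
  "lengths f x = {m. iterate f m x \<noteq> None}"

lemma iterate_Suc: "iterate f (Suc m) x = Option.bind (iterate f m x) f"
  by (simp add: iterate_def)

lemma iterate_None: fixes f :: "'a \<Rightarrow> 'a option" shows "((\<lambda>z. Option.bind z f) ^^ m) None = None"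
  by (induction m) simp_all

lemma lengths_None: "f x = None \<Longrightarrow> lengths f x = {0}"
proof -
  assume "f x = None"
  then have "iterate f (Suc m) x = None" for m
    by (simp add: iterate_def funpow_Suc_right iterate_None del: funpow.simps)
  then have "m \<in> lengths f x \<longleftrightarrow> m = 0" for m
    by (cases m) (simp_all add: lengths_def, simp add: iterate_def)
  then show ?thesis
    by blast
qed

lemma lengths_Some: "f x = Some d \<Longrightarrow> lengths f x = insert 0 (Suc ` lengths f d)"
proof -
  assume "f x = Some d"
  then have "iterate f (Suc m) x = iterate f m d" for m
    by (simp add: iterate_def funpow_Suc_right del: funpow.simps)
  then have "m \<in> lengths f x \<longleftrightarrow> m \<in> insert 0 (Suc ` lengths f d)" for m
    by (cases m) (simp_all add: lengths_def image_iff, simp add: iterate_def)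
  then show ?thesis
    by blast
qed

lemma Max_lengths_Some:
  assumes "f x = Some d" "finite (lengths f d)"
  shows "Max (lengths f x) = Suc (Max (lengths f d))"
proof -
  have "0 \<in> lengths f d"
    by (simp add: lengths_def iterate_def)
  then have ne: "lengths f d \<noteq> {}"
    by blast
  have "Max (Suc ` lengths f d) = Suc (Max (lengths f d))"
    using mono_Max_commute[of Suc "lengths f d"] assms(2) ne by (simp add: mono_Suc)
  then show ?thesis
    unfolding lengths_Some[of f, OF assms(1)] using assms(2) ne by simp
qed

text \<open>If the completely filled parts of the columns were more than 95 apart,
  \<open>y - x\<close> would contain two consecutive integers of which only the first is a multiple
  of the step; their colours differ. The numbers leave some room and serve only to bound the lengths
  of strings.\<close>

lemma single_coloured_bound:
  assumes "young T x" "young T y" "x \<subseteq> y" "\<forall>n\<in>y - x. col T n = i"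
  shows "finite (y - x)" "card (y - x) \<le> 130"
proof -
  obtain L where L: "{..<L} \<subseteq> x" "x \<subseteq> {..<L + 32}"
    using young_bounds[OF assms(1)] by blast
  obtain M where M: "{..<M} \<subseteq> y" "y \<subseteq> {..<M + 32}"
    using young_bounds[OF assms(2)] by blast
  have s: "1 < step T" "step T \<le> 30"
    by (cases T; simp add: step_def)+
  have "M \<le> L + 95"
  proof (rule ccontr)
    assume far: "\<not> M \<le> L + 95"
    \<comment> \<open>The first multiple of the step above \<open>L + 32\<close>, hence a
      \<open>0\<close>-block above all of \<open>x\<close>.\<close>
    define p where "p = step T * ((L + 32) div step T + 1)"
    have "L + 32 = step T * ((L + 32) div step T) + (L + 32) mod step T"
      by simp
    moreover have "0 \<le> (L + 32) mod step T" "(L + 32) mod step T < step T"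
      using s by simp_all
    ultimately have "L + 32 \<le> p" "p + 1 < M"
      unfolding p_def distrib_left using far s by linarith+
    then have "p \<in> y - x" "p + 1 \<in> y - x"
      using L M by auto
    then have "col T p = col T (p + 1)"
      using assms(4) by metis
    moreover have "step T dvd p"
      by (simp add: p_def)
    ultimately have "step T dvd 1"
      using col_eq_0_iff by (metis dvd_add_right_iff)
    with s show False
      by simp
  qed
  then have sub: "y - x \<subseteq> {L..<L + 127}"
    using L M by force
  then show "finite (y - x)"
    by (rule finite_subset) simp
  have "card (y - x) \<le> card {L..<L + 127}"
    by (rule card_mono[OF _ sub]) simp
  then show "card (y - x) \<le> 130"
    by simp
qed

lemma iterate_e_op:
  assumes "young T y" "iterate (e_op T i) m (cl T y) = Some d"
  shows "\<exists>x. young T x \<and> d = cl T x \<and> x \<subseteq> y \<and> (\<forall>n\<in>y - x. col T n = i) \<and> card (y - x) = m"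
  using assms(2)
proof (induction m arbitrary: d)
  case 0
  then show ?case
    using assms(1) by (intro exI[of _ y]) (simp add: iterate_def)
next
  case (Suc m)
  then obtain c where "iterate (e_op T i) m (cl T y) = Some c" and c: "e_op T i c = Some d"
    by (cases "iterate (e_op T i) m (cl T y)") (simp_all add: iterate_Suc)
  with Suc.IH obtain x where x: "young T x" "c = cl T x" "x \<subseteq> y" "\<forall>n\<in>y - x. col T n = i" "card (y - x) = m"
    by blast
  from c obtain n where n: "estep T i x n" "d = cl T (x - {n})"
    unfolding x(2) e_op_cl[OF x(1)] by blast
  note n' = estep_young[OF n(1)]
  have eq: "y - (x - {n}) = insert n (y - x)"
    using n' x(3) by blast
  have "card (insert n (y - x)) = Suc m"
    using single_coloured_bound(1)[OF x(1) assms(1) x(3,4)] n' x(5) by simp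
  with n n' x eq show ?case
    by (intro exI[of _ "x - {n}"]) auto
qed

lemma iterate_f_op:
  assumes "young T y" "iterate (f_op T i) m (cl T y) = Some d"
  shows "\<exists>x. young T x \<and> d = cl T x \<and> y \<subseteq> x \<and> (\<forall>n\<in>x - y. col T n = i) \<and> card (x - y) = m"
  using assms(2)
proof (induction m arbitrary: d)
  case 0
  then show ?case
    using assms(1) by (intro exI[of _ y]) (simp add: iterate_def)
next
  case (Suc m)
  then obtain c where "iterate (f_op T i) m (cl T y) = Some c" and c: "f_op T i c = Some d"
    by (cases "iterate (f_op T i) m (cl T y)") (simp_all add: iterate_Suc)
  with Suc.IH obtain x where x: "young T x" "c = cl T x" "y \<subseteq> x" "\<forall>n\<in>x - y. col T n = i" "card (x - y) = m"
    by blast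
  from c obtain n where n: "fstep T i x n" "d = cl T (insert n x)"
    unfolding x(2) f_op_cl[OF x(1)] by blast
  note n' = fstep_young[OF n(1)]
  have eq: "insert n x - y = insert n (x - y)"
    using n' x(3) by blast
  have "card (insert n (x - y)) = Suc m"
    using single_coloured_bound(1)[OF assms(1) x(1,3,4)] n' x(5) by simp
  with n n' x eq show ?case
    by (intro exI[of _ "insert n x"]) auto
qed

text \<open>This makes the maxima that define \<open>phi\<close> and \<open>eps\<close> meaningful:
  a string changes a column only by blocks of one colour, so its length is bounded.\<close>

lemma finite_lengths:
  assumes "young T y"
  shows "finite (lengths (e_op T i) (cl T y))" "finite (lengths (f_op T i) (cl T y))"
proof -
  have "m \<le> 130" if "m \<in> lengths (e_op T i) (cl T y)" for m
    using iterate_e_op[OF assms] single_coloured_bound(2)[OF _ assms] that unfolding lengths_def by blast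
  then show "finite (lengths (e_op T i) (cl T y))"
    by (meson finite_nat_set_iff_bounded_le)
  have "m \<le> 130" if "m \<in> lengths (f_op T i) (cl T y)" for m
    using iterate_f_op[OF assms] single_coloured_bound(2)[OF assms] that unfolding lengths_def by blast
  then show "finite (lengths (f_op T i) (cl T y))"
    by (meson finite_nat_set_iff_bounded_le)
qed

lemma eps_lengths: "eps T i c = Max (lengths (e_op T i) c)" and phi_lengths: "phi T i c = Max (lengths (f_op T i) c)"
  by (simp_all add: eps_def phi_def lengths_def)

text \<open>The statements on \<open>f_op\<close> and \<open>phi\<close> rest on
  \<open>estep_fstep\<close>; passing to \<open>cl T (y - {n})\<close> shortens the
  \<open>e\<close>-string by one and lengthens the \<open>f\<close>-string by one.\<close>

lemma estep_ops:
  assumes "young T y" "estep T i y n"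
  shows "e_op T i (cl T y) = Some (cl T (y - {n}))" "f_op T i (cl T (y - {n})) = Some (cl T y)"
    "eps T i (cl T y) = Suc (eps T i (cl T (y - {n})))" "phi T i (cl T (y - {n})) = Suc (phi T i (cl T y))"
proof -
  note n = estep_young[OF assms(2)]
  show e: "e_op T i (cl T y) = Some (cl T (y - {n}))"
    using e_op_cl[OF assms(1)] assms(2) by blast
  have "insert n (y - {n}) = y"
    using n by blast
  then show f: "f_op T i (cl T (y - {n})) = Some (cl T y)"
    using f_op_cl[of T "y - {n}" i "cl T y"] estep_fstep[OF assms, of n] n by auto
  show "eps T i (cl T y) = Suc (eps T i (cl T (y - {n})))"
    unfolding eps_lengths by (rule Max_lengths_Some[OF e finite_lengths(1)]) (use n in blast)
  show "phi T i (cl T (y - {n})) = Suc (phi T i (cl T y))"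
    unfolding phi_lengths by (rule Max_lengths_Some[OF f finite_lengths(2)[OF assms(1)]])
qed

lemma eps_pos:
  assumes "young T y" "0 < eps T i (cl T y)"
  obtains n where "estep T i y n"
proof -
  have "e_op T i (cl T y) \<noteq> None"
  proof
    assume "e_op T i (cl T y) = None"
    from lengths_None[of "e_op T i", OF this] show False
      using assms(2) unfolding eps_lengths by simp
  qed
  with that show ?thesis
    using e_op_cl[OF assms(1)] by blast
qed

lemma phi_eq_0:
  assumes "young T y" "\<not> (\<exists>n. fstep T i y n)"
  shows "phi T i (cl T y) = 0"
proof -
  have "f_op T i (cl T y) = None"
    using f_op_cl[OF assms(1), of i] assms(2) by (cases "f_op T i (cl T y)") auto
  from lengths_None[of "f_op T i", OF this] show ?thesis
    unfolding phi_lengths by simp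
qed

lemma fstep_phi:
  assumes "young T y" "fstep T i y n"
  shows "phi T i (cl T y) = Suc (phi T i (cl T (insert n y)))"
proof -
  have "f_op T i (cl T y) = Some (cl T (insert n y))"
    using f_op_cl[OF assms(1)] assms(2) by blast
  from Max_lengths_Some[OF this finite_lengths(2)] show ?thesis
    unfolding phi_lengths using fstep_young[OF assms(2)] by blast
qed

lemma cl_classes: "young T y \<Longrightarrow> cl T y \<in> classes T"
  unfolding classes_cl by blast

section \<open>The energy function under removal of a block\<close>

text \<open>The conditions on \<open>H\<close> concern \<open>f\<close>, so the tensor operator is
  applied to the pair after the removal. There \<open>eps\<close> of the right factor has dropped by
  one, so it is still at least \<open>phi\<close> of the left factor, and \<open>f\<close> restores
  the block on the right.\<close>

lemma energy_right:
  assumes "energy_function T H" "young T x" "young T y" "estep T i y n" "phi T i (cl T x) < eps T i (cl T y)"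
  shows "H (cl T x, cl T (y - {n})) = H (cl T x, cl T y) + (if i = 0 then 1 else 0)"
proof -
  note ops = estep_ops[OF assms(3,4)]
  have f: "f_tensor T i (cl T x, cl T (y - {n})) = Some (cl T x, cl T y)"
    using ops assms(5) by (simp add: f_tensor_def)
  have i: "i \<in> index_set T"
    using estep_young[OF assms(4)] col_index by blast
  have c: "cl T x \<in> classes T" "cl T (y - {n}) \<in> classes T"
    using assms(2) estep_young[OF assms(4)] cl_classes by blast+
  show ?thesis
  proof (cases "i = 0")
    case True
    then have "H (cl T x, cl T y) = H (cl T x, cl T (y - {n})) - 1"
      using assms(1) c f ops(2) unfolding energy_function_def by blast
    with True show ?thesis by simp
  next
    case False
    then have "H (cl T x, cl T y) = H (cl T x, cl T (y - {n}))"
      using assms(1) c f i unfolding energy_function_def by blast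
    with False show ?thesis by simp
  qed
qed

text \<open>After the removal \<open>phi\<close> of the left factor is one larger and thus exceeds
  \<open>eps\<close> of the right factor, so \<open>f\<close> acts on the left and restores the
  block there.\<close>

lemma energy_left:
  assumes "energy_function T H" "young T x" "young T y" "estep T i y n" "eps T i (cl T x) \<le> phi T i (cl T y)"
  shows "H (cl T (y - {n}), cl T x) = H (cl T y, cl T x) - (if i = 0 then 1 else 0)"
proof -
  note ops = estep_ops[OF assms(3,4)]
  have f: "f_tensor T i (cl T (y - {n}), cl T x) = Some (cl T y, cl T x)"
    using ops assms(5) by (simp add: f_tensor_def)
  have i: "i \<in> index_set T"
    using estep_young[OF assms(4)] col_index by blast
  have c: "cl T x \<in> classes T" "cl T (y - {n}) \<in> classes T"
    using assms(2) estep_young[OF assms(4)] cl_classes by blast+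
  show ?thesis
  proof (cases "i = 0")
    case True
    then have "H (cl T y, cl T x) = H (cl T (y - {n}), cl T x) + 1"
      using assms(1) c f ops(2) unfolding energy_function_def by blast
    with True show ?thesis by simp
  next
    case False
    then have "H (cl T y, cl T x) = H (cl T (y - {n}), cl T x)"
      using assms(1) c f i unfolding energy_function_def by blast
    with False show ?thesis by simp
  qed
qed

text \<open>A translation moves the filled part of a column so that it ends within one step; what
  lies above it is a subset of a window of length 32.\<close>

lemma finite_classes: "finite (classes T)"
proof -
  let ?F = "(\<lambda>(L, S). {..<L} \<union> S) ` ({0..<step T} \<times> Pow {0..<step T + 32})"
  have "cl T y \<in> cl T ` ?F" if y: "young T y" for y
  proof -
    obtain L where L: "{..<L} \<subseteq> y" "y \<subseteq> {..<L + 32}"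
      using young_bounds[OF y] by blast
    define k where "k = L div step T"
    define l where "l = L mod step T"
    have l: "L = l + step T * k" "0 \<le> l" "l < step T"
      using step_pos[of T] by (simp_all add: k_def l_def)
    have z: "{..<l} \<subseteq> shift T (- k) y" "shift T (- k) y \<subseteq> {..<l + 32}"
      using L unfolding l(1) by (auto simp: mem_shift subset_iff)
    then have "shift T (- k) y = {..<l} \<union> (shift T (- k) y \<inter> {l..<l + 32})"
      by auto
    moreover have "shift T (- k) y \<inter> {l..<l + 32} \<in> Pow {0..<step T + 32}"
      using l by auto
    ultimately have "shift T (- k) y \<in> ?F"
      using l by (intro image_eqI[of _ _ "(l, shift T (- k) y \<inter> {l..<l + 32})"]) auto
    then show ?thesis
      using cl_shift[OF y, of "- k"] by (metis imageI)
  qed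
  then have "classes T \<subseteq> cl T ` ?F"
    unfolding classes_cl by blast
  then show ?thesis
    by (rule finite_subset) simp
qed

section \<open>The ground state wall\<close>

text \<open>The offsets are negative because cube \<open>k\<close> of a wall column is a later cube
  of the column pattern: number \<open>k + 8 * r\<close> in type E6, and number
  \<open>k + 4\<close>, rotated, in the odd columns of type E7.\<close>

definition wall_place :: "affine_type \<Rightarrow> nat \<Rightarrow> int \<Rightarrow> block" where
  "wall_place T r = place T (case T of E6 \<Rightarrow> - 8 * int r | E7 \<Rightarrow> if even r then 0 else - 4 | E8 \<Rightarrow> 0) (T = E7 \<and> odd r)"

lemma cube_section_E7: "cube_section E7 k \<in> set (sections E7)"
proof -
  have "nat ((k - 1) mod 8) < length (sections E7)"
    by (simp add: length_sections cubes_def nat_less_iff)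
  then have "sections E7 ! nat ((k - 1) mod 8) \<in> set (sections E7)"
    by (rule nth_mem)
  then show ?thesis
    by (simp add: cube_section_def Let_def length_sections cubes_def)
qed

lemma wall_pattern_place: "wall_pattern T r = range (wall_place T r)"
proof -
  have E6: "wall_pattern E6 r = range (place E6 (- 8 * int r) False)"
  proof (intro set_eqI iffI)
    fix b assume "b \<in> wall_pattern E6 r"
    then have "Block (cube b + 8 * int r) (cells b) (colour b) \<in> column_pattern E6"
      by (simp add: wall_pattern_def column_pattern_def pattern_def wall_section_def)
    then obtain n where "Block (cube b + 8 * int r) (cells b) (colour b) = blk E6 n"
      unfolding range_blk[symmetric] by blast
    then have "b = place E6 (- 8 * int r) False n"
      by (intro block.expand) (simp add: place_def del: colour_blk, metis block.sel add_diff_cancel_right')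
    then show "b \<in> range (place E6 (- 8 * int r) False)"
      by blast
  next
    fix b assume "b \<in> range (place E6 (- 8 * int r) False)"
    then obtain n where "b = place E6 (- 8 * int r) False n" ..
    with blk_pattern[of E6 n] show "b \<in> wall_pattern E6 r"
      by (simp add: wall_pattern_def column_pattern_def pattern_def wall_section_def place_def)
  qed
  have E7: "wall_pattern E7 r = range (place E7 (- 4) True)" if "odd r"
  proof -
    have mem: "b \<in> wall_pattern E7 r \<longleftrightarrow>
      (\<exists>S. (S, colour b) \<in> section_blocks (cube_section E7 (cube b + 4)) \<and> cells b = rotate_cell E7 ` S)" for b
      using that section_blocks_rotate[OF cube_section_E7[of "cube b + 4"]]
      by (auto simp: wall_pattern_def pattern_def wall_section_def image_iff intro: rev_bexI)
    show ?thesis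
    proof (intro set_eqI iffI)
      fix b assume "b \<in> wall_pattern E7 r"
      then obtain S where S: "(S, colour b) \<in> section_blocks (cube_section E7 (cube b + 4))" "cells b = rotate_cell E7 ` S"
        unfolding mem by blast
      then have "Block (cube b + 4) S (colour b) \<in> column_pattern E7"
        by (simp add: column_pattern_def pattern_def)
      then obtain n where n: "Block (cube b + 4) S (colour b) = blk E7 n"
        unfolding range_blk[symmetric] by blast
      have "b = place E7 (- 4) True n"
        unfolding place_def n[symmetric] using S(2) by (intro block.expand) simp
      then show "b \<in> range (place E7 (- 4) True)"
        by blast
    next
      fix b assume "b \<in> range (place E7 (- 4) True)"
      then obtain n where b: "b = place E7 (- 4) True n" ..
      have "(cells (blk E7 n), colour (blk E7 n)) \<in> section_blocks (cube_section E7 (cube (blk E7 n)))"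
        using blk_pattern[of E7 n] by (simp add: column_pattern_def pattern_def)
      then show "b \<in> wall_pattern E7 r"
        unfolding mem b place_def by auto
    qed
  qed
  have "wall_pattern T r = column_pattern T" if "T = E7 \<and> even r \<or> T = E8"
    using that by (auto simp: wall_pattern_def column_pattern_def wall_section_def pattern_def)
  with E6 E7 show ?thesis
    by (cases T) (auto simp: wall_place_def place_0 range_blk)
qed

text \<open>
  The column \<open>r\<close> of the ground state wall is generated by its top block.  The data are for the
  residues of \<open>r\<close>: in type E6 the pattern has period 3 up to a translation by four steps.
\<close>

definition residue :: "affine_type \<Rightarrow> nat \<Rightarrow> nat" where
  "residue T r = (case T of E6 \<Rightarrow> r mod 3 | E7 \<Rightarrow> r mod 2 | E8 \<Rightarrow> 0)"

text \<open>The entries are the first missing block, the blocks present beyond it, and the top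
  block. The starting values reflect the offsets of the columns: for example, cube 0 of column 1 in
  type E6 is cube 8 of the pattern and ends at number 15; the three-cell block is 16, so 17 is the
  first missing one.\<close>

definition ground_data :: "affine_type \<Rightarrow> nat \<Rightarrow> int \<times> int list \<times> int" where
  "ground_data T r = (case T of
     E6 \<Rightarrow> if r = 0 then (0, [1, 3, 5], 5) else if r = 1 then (17, [18, 20], 20) else (32, [33, 34, 36], 36)
   | E7 \<Rightarrow> if r = 0 then (0, [1, 2, 4, 6, 8, 11], 11) else (11, [12, 14, 16, 18], 18)
   | E8 \<Rightarrow> (0, [1, 2, 3, 4, 5, 7, 8, 10, 11, 13, 14, 17, 20, 23, 26, 29, 30], 30))"

definition ground_shift :: "affine_type \<Rightarrow> nat \<Rightarrow> int" where
  "ground_shift T r = (if T = E6 then 4 * int (r div 3) else 0)"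

definition ground_base :: "affine_type \<Rightarrow> nat \<Rightarrow> int set" where
  "ground_base T r = (case ground_data T (residue T r) of (b, xs, p) \<Rightarrow> upto_set b xs)"

definition ground_top :: "affine_type \<Rightarrow> nat \<Rightarrow> int" where
  "ground_top T r = (case ground_data T (residue T r) of (b, xs, p) \<Rightarrow> p)"

definition gset :: "affine_type \<Rightarrow> nat \<Rightarrow> int set" where
  "gset T r = shift T (ground_shift T r) (ground_base T r)"

definition upper_pos :: "affine_type \<Rightarrow> block \<Rightarrow> bool" where
  "upper_pos T b \<longleftrightarrow> (case T of
     E6 \<Rightarrow> cube b = 1 \<and> card (cells b) = 3 \<or>
           cube b = 2 \<and> cells b = set [(Upper, 2), (Lower, 2)] \<or>
           cube b = 3 \<and> card (cells b) = 1
   | E7 \<Rightarrow> cube b = 1 \<and> card (cells b) \<noteq> 1 \<or>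
           cube b = 2 \<and> cells b = set [(Upper, 2), (Upper, 3), (Lower, 2), (Lower, 3)] \<or>
           cube b = 3 \<and> (Upper, 3) \<in> cells b \<and> (Lower, 3) \<in> cells b \<or>
           cube b = 4 \<and> cells b = set [(Upper, 3), (Lower, 3)] \<or>
           cube b = 5 \<and> card (cells b) = 1
   | E8 \<Rightarrow> cube b = 1 \<and> colour b \<in> set [7, 5, 2] \<or>
           cube b = 2 \<and> colour b \<in> set [6, 4] \<or>
           cube b = 3 \<and> colour b \<in> set [5, 3] \<or>
           cube b = 4 \<and> colour b \<in> set [4, 1] \<or>
           cube b = 5 \<and> colour b \<in> set [2, 3] \<or>
           cube b = 6 \<and> cells b = set [(Upper, 4), (Upper, 5), (Upper, 6), (Lower, 4), (Lower, 5), (Lower, 6)] \<or>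
           cube b = 7 \<and> colour b = 5 \<or>
           cube b = 8 \<and> colour b = 6 \<or>
           cube b = 9 \<and> colour b = 7 \<or>
           cube b = 10 \<and> colour b = 8 \<or>
           cube b = 11 \<and> colour b = 0)"

lemma times_sets:
  "UNIV \<times> {2 :: nat} = set [(Upper, 2), (Lower, 2)]" "UNIV \<times> {3 :: nat} = set [(Upper, 3), (Lower, 3)]"
  "UNIV \<times> {2..3 :: nat} = set [(Upper, 2), (Upper, 3), (Lower, 2), (Lower, 3)]"
  "UNIV \<times> {4..6 :: nat} = set [(Upper, 4), (Upper, 5), (Upper, 6), (Lower, 4), (Lower, 5), (Lower, 6)]"
proof -
  have "{4..6 :: nat} = set [4, 5, 6]" "{2..3 :: nat} = set [2, 3]"
    by auto
  then show
    "UNIV \<times> {2 :: nat} = set [(Upper, 2), (Lower, 2)]" "UNIV \<times> {3 :: nat} = set [(Upper, 3), (Lower, 3)]"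
    "UNIV \<times> {2..3 :: nat} = set [(Upper, 2), (Upper, 3), (Lower, 2), (Lower, 3)]"
    "UNIV \<times> {4..6 :: nat} = set [(Upper, 4), (Upper, 5), (Upper, 6), (Lower, 4), (Lower, 5), (Lower, 6)]"
    by (simp_all only: row_UNIV) force+
qed

lemma ground_upper_pos: "ground_upper T b \<longleftrightarrow> upper_pos T b"
  unfolding ground_upper_def upper_pos_def times_sets
  by (cases T) (simp_all only: affine_type.case list.set insert_subset empty_subsetI simp_thms)

lemma upper_pos_cube: "upper_pos T b \<Longrightarrow> cube b \<le> (case T of E6 \<Rightarrow> 3 | E7 \<Rightarrow> 5 | E8 \<Rightarrow> 11)"
  unfolding upper_pos_def by (cases T) (simp_all only: affine_type.case, auto)

text \<open>Three columns of type E6 amount to 24 cubes, which is four steps of six cubes; four is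
  even, so no rotation appears. In type E7 the arrangement of columns repeats after two, in type E8
  after one.\<close>

lemma wall_place_residue: "wall_place T r (n + step T * ground_shift T r) = wall_place T (residue T r) n"
proof (cases T)
  case E6
  have "r = 3 * (r div 3) + r mod 3"
    by simp
  then have r: "int r = 3 * int (r div 3) + int (r mod 3)"
    by (metis of_nat_add of_nat_mult of_nat_numeral)
  have "place E6 (- 8 * int r) False (n + step E6 * (4 * int (r div 3))) =
      motion E6 (- 8 * int r) False (motion E6 (24 * int (r div 3)) False (blk E6 n))"
    unfolding place_def blk_shift move_motion by (simp add: cubes_def twisted_def)
  also have "\<dots> = motion E6 (- 8 * int r + 24 * int (r div 3)) False (blk E6 n)"
    using motion_motion[OF cells_blk, of E6 "- 8 * int r" False "24 * int (r div 3)" False n] by simp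
  also have "- 8 * int r + 24 * int (r div 3) = - 8 * int (r mod 3)"
    using r by linarith
  finally show ?thesis
    by (simp add: E6 wall_place_def ground_shift_def residue_def place_def)
next
  case E7
  then show ?thesis
    by (auto simp: wall_place_def ground_shift_def residue_def odd_iff_mod_2_eq_one even_iff_mod_2_eq_zero)
next
  case E8
  then show ?thesis
    by (simp add: wall_place_def ground_shift_def residue_def)
qed

definition in_ground :: "affine_type \<Rightarrow> block \<Rightarrow> bool" where
  "in_ground T b \<longleftrightarrow> cube b \<le> 0 \<or> upper_pos T b"

text \<open>The number of steps after which the ground state column certainly contains no more
  blocks, so that only a finite range is left to evaluation.\<close>

definition window_end :: "affine_type \<Rightarrow> nat \<Rightarrow> int" where
  "window_end T r = (case T of E6 \<Rightarrow> if r = 0 then 1 else if r = 1 then 2 else 4 | E7 \<Rightarrow> if r = 0 then 1 else 2 | E8 \<Rightarrow> 2)"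

definition ground_ok :: "affine_type \<Rightarrow> nat \<Rightarrow> bool" where
  "ground_ok T r \<longleftrightarrow> (case ground_data T r of (b, xs, p) \<Rightarrow>
     list_all (\<lambda>n. in_ground T (wall_place T r n) = (n < b \<or> n \<in> set xs)) [0..step T * window_end T r - 1] \<and>
     upto_closed T b xs \<and> removed T b xs = [p] \<and> p \<in> set xs \<and> b \<notin> set xs \<and> 0 \<le> b \<and> list_all (\<lambda>n. n < step T * window_end T r) (b # xs))"

lemma ground_ok_table: "ground_ok E6 0" "ground_ok E6 1" "ground_ok E6 2" "ground_ok E7 0" "ground_ok E7 1" "ground_ok E8 0"
  by code_simp+

lemma residue_cases:
  "(T, residue T r) \<in> {(E6, 0), (E6, 1), (E6, 2), (E7, 0), (E7, 1), (E8, 0)}"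
  by (cases T) (auto simp: residue_def)

lemma ground_ok: "ground_ok T (residue T r)"
  using residue_cases[of T r] ground_ok_table by auto

lemma ground_dataE:
  obtains b xs p where "ground_data T (residue T r) = (b, xs, p)" "ground_base T r = upto_set b xs" "ground_top T r = p"
    "\<forall>n\<in>set [0..step T * window_end T (residue T r) - 1]. in_ground T (wall_place T (residue T r) n) \<longleftrightarrow> n < b \<or> n \<in> set xs"
    "upto_closed T b xs" "removed T b xs = [p]" "p \<in> set xs" "b \<notin> set xs" "0 \<le> b"
    "\<forall>n\<in>set (b # xs). n < step T * window_end T (residue T r)"
proof -
  obtain b xs p where d: "ground_data T (residue T r) = (b, xs, p)"
    by (rule prod_cases3)
  note ok = ground_ok[of T r, unfolded ground_ok_def d prod.case list_all_iff]
  show ?thesis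
    by (rule that[OF d]) (use ok in \<open>(simp add: ground_base_def ground_top_def d; fail) | blast\<close>)+
qed

lemma wall_place_outside:
  "n < 0 \<Longrightarrow> in_ground T (wall_place T (residue T r) n)"
  "step T * window_end T (residue T r) \<le> n \<Longrightarrow> \<not> in_ground T (wall_place T (residue T r) n)"
proof -
  define c where "c = (case T of E6 \<Rightarrow> - 8 * int (residue T r) | E7 \<Rightarrow> if even (residue T r) then 0 else - 4 | E8 \<Rightarrow> 0)"
  have cube: "cube (wall_place T (residue T r) n) = cube (blk T n) + c"
    by (simp add: wall_place_def place_def c_def)
  have c: "c \<le> 0" "(case T of E6 \<Rightarrow> 3 | E7 \<Rightarrow> 5 | E8 \<Rightarrow> 11) < cubes T * window_end T (residue T r) + 1 + c"
    using residue_cases[of T r] by (auto simp: c_def cubes_def window_end_def)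
  show "in_ground T (wall_place T (residue T r) n)" if "n < 0"
  proof -
    have "n div step T < 0"
      using that step_pos[of T] by (simp add: pos_imp_zdiv_neg_iff)
    then have "n div step T \<le> - 1"
      by simp
    then have "cubes T * (n div step T) \<le> cubes T * - 1"
      using cubes_pos[of T] by (intro mult_left_mono) auto
    then show ?thesis
      using cube_blk_bounds(2)[of T n] c(1) unfolding in_ground_def cube by linarith
  qed
  show "\<not> in_ground T (wall_place T (residue T r) n)" if "step T * window_end T (residue T r) \<le> n"
  proof -
    have "window_end T (residue T r) = (step T * window_end T (residue T r)) div step T"
      using step_pos[of T] by simp
    also have "\<dots> \<le> n div step T"
      using that step_pos[of T] by (intro zdiv_mono1) auto
    finally have "cubes T * window_end T (residue T r) \<le> cubes T * (n div step T)"
      using cubes_pos[of T] by (intro mult_left_mono) auto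
    then have "(case T of E6 \<Rightarrow> 3 | E7 \<Rightarrow> 5 | E8 \<Rightarrow> 11) < cube (wall_place T (residue T r) n)"
      using cube_blk_bounds(1)[of T n] c(2) unfolding cube by linarith
    moreover have "(0 :: int) \<le> (case T of E6 \<Rightarrow> 3 | E7 \<Rightarrow> 5 | E8 \<Rightarrow> 11)"
      by (cases T) simp_all
    ultimately show ?thesis
      using upper_pos_cube[of T "wall_place T (residue T r) n"] unfolding in_ground_def by linarith
  qed
qed

lemma ground_gset: "ground T r = wall_place T r ` gset T r"
proof -
  obtain b xs p where d: "ground_base T r = upto_set b xs"
    "\<forall>n\<in>set [0..step T * window_end T (residue T r) - 1]. in_ground T (wall_place T (residue T r) n) \<longleftrightarrow> n < b \<or> n \<in> set xs"
    "0 \<le> b" "\<forall>n\<in>set (b # xs). n < step T * window_end T (residue T r)"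
    by (rule ground_dataE[of T r]) blast
  have base: "in_ground T (wall_place T (residue T r) n) \<longleftrightarrow> n \<in> upto_set b xs" for n
  proof -
    consider "n < 0" | "n \<in> set [0..step T * window_end T (residue T r) - 1]" | "step T * window_end T (residue T r) \<le> n"
      by fastforce
    then show ?thesis
    proof cases
      case 1
      with wall_place_outside(1)[OF 1] d(3) show ?thesis
        by (simp add: upto_set_def)
    next
      case 2
      from bspec[OF d(2) this] show ?thesis
        by (simp add: upto_set_def)
    next
      case 3
      have "n \<notin> upto_set b xs"
        using d(4) 3 by (auto simp: upto_set_def)
      with wall_place_outside(2)[OF 3] show ?thesis
        by simp
    qed
  qed
  have "wall_place T r n \<in> ground T r \<longleftrightarrow> n \<in> gset T r" for n
  proof -
    have "wall_place T r n \<in> wall_pattern T r"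
      unfolding wall_pattern_place by (rule rangeI)
    then have in_ground: "wall_place T r n \<in> ground T r \<longleftrightarrow> in_ground T (wall_place T r n)"
      by (simp add: ground_def in_ground_def ground_upper_pos)
    have eq: "wall_place T r n = wall_place T (residue T r) (n - step T * ground_shift T r)"
      using wall_place_residue[of T r "n - step T * ground_shift T r"] by simp
    show ?thesis
      unfolding in_ground unfolding eq base gset_def mem_shift d(1) ..
  qed
  moreover have "ground T r \<subseteq> range (wall_place T r)"
    unfolding wall_pattern_place[symmetric] by (auto simp: ground_def)
  ultimately show ?thesis
    by (auto simp: subset_iff image_iff) (metis rangeE rangeI)+
qed

lemma young_gset: "young T (gset T r)" and ideal_gset: "ideal T (gset T r)"
proof -
  obtain b xs p where "ground_base T r = upto_set b xs" "upto_closed T b xs"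
    by (rule ground_dataE[of T r]) blast
  then have "ideal T (ground_base T r)"
    using ideal_upto by simp
  then show "ideal T (gset T r)"
    by (simp add: gset_def ideal_shift)
  then show "young T (gset T r)"
    by (simp add: young_def)
qed

text \<open>The column of the ground state wall has a single maximal block.\<close>

definition peak :: "affine_type \<Rightarrow> nat \<Rightarrow> int" where
  "peak T r = ground_top T r + step T * ground_shift T r"

text \<open>A block carrying nothing inside the column could be removed from the closed set, and the
  evaluated list of removable blocks contains only the top.\<close>

lemma peak_gset:
  "peak T r \<in> gset T r" "n \<in> gset T r \<Longrightarrow> n \<noteq> peak T r \<Longrightarrow> \<exists>m\<in>gset T r. n \<in> set (low T m)"
proof -
  obtain b xs p where d: "ground_base T r = upto_set b xs" "ground_top T r = p" "removed T b xs = [p]" "p \<in> set xs"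
    by (rule ground_dataE[of T r]) blast
  then show "peak T r \<in> gset T r"
    by (simp add: gset_def mem_shift peak_def upto_set_def)
  show "\<exists>m\<in>gset T r. n \<in> set (low T m)" if n: "n \<in> gset T r" "n \<noteq> peak T r"
  proof (rule ccontr)
    assume no: "\<not> (\<exists>m\<in>gset T r. n \<in> set (low T m))"
    have "closed T (gset T r - {n})"
      using ideal_gset[of T r] no unfolding ideal_def closed_def by blast
    then have "closed T (shift T (- ground_shift T r) (gset T r - {n}))"
      by (simp only: closed_shift)
    then have "closed T (upto_set b xs - {n - step T * ground_shift T r})"
      by (simp add: shift_Diff gset_def d(1))
    moreover have "n - step T * ground_shift T r \<in> upto_set b xs"
      using n(1) by (simp add: gset_def mem_shift d(1))
    ultimately have "n - step T * ground_shift T r \<in> set (removed T b xs)"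
      by (rule closed_remove_upto)
    with n(2) d(2,3) show False
      by (simp add: peak_def)
  qed
qed


section \<open>Columns generated by a single maximal block\<close>

text \<open>Induction on the distance from the upper bound: any block other than \<open>p\<close> is
  directly below a larger one of \<open>y\<close>, which is already known to lie in
  \<open>z\<close>.\<close>

lemma generated_subset:
  assumes "closed T z" "p \<in> z" "y \<subseteq> {..N}" "\<And>n. n \<in> y \<Longrightarrow> n \<noteq> p \<Longrightarrow> \<exists>m\<in>y. n \<in> set (low T m)"
  shows "y \<subseteq> z"
proof
  fix n assume "n \<in> y"
  then show "n \<in> z"
  proof (induction "nat (N - n)" arbitrary: n rule: less_induct)
    case less
    show ?case
    proof (cases "n = p")
      case False
      then obtain m where m: "m \<in> y" "n \<in> set (low T m)"
        using assms(4) less.prems by blast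
      have "n \<in> {m - 6..m - 1}"
        using conjunct1[OF conjunct2[OF low_bounds[of T m]]] m(2) by (rule subsetD)
      moreover have "m \<le> N"
        using m(1) assms(3) by auto
      ultimately have "m \<in> z"
        using less.hyps[of m] m(1) by simp
      with m(2) assms(1) show ?thesis
        unfolding closed_def by blast
    qed (use assms(2) in simp)
  qed
qed

lemma ex_maximal:
  assumes "ideal T y"
  shows "\<exists>n\<in>y. \<forall>m\<in>y. n \<notin> set (low T m)"
proof -
  obtain L where L: "{..<L} \<subseteq> y" "y \<subseteq> {..<L + 32}"
    using ideal_bounds[OF assms] by blast
  have fin: "finite (y \<inter> {L - 1..L + 32})" and ne: "L - 1 \<in> y \<inter> {L - 1..L + 32}"
    using L by auto
  define n where "n = Max (y \<inter> {L - 1..L + 32})"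
  have n: "n \<in> y" "L - 1 \<le> n"
    using Max_in[OF fin] Max_ge[OF fin ne] ne unfolding n_def by blast+
  have max: "m \<le> n" if "m \<in> y" for m
  proof (cases "L - 1 \<le> m")
    case True
    then have "m \<in> y \<inter> {L - 1..L + 32}"
      using that L(2) by auto
    then show ?thesis
      unfolding n_def using fin by (rule Max_ge[rotated])
  qed (use n in linarith)
  show ?thesis
  proof (intro bexI[OF _ n(1)] ballI notI)
    fix m assume m: "m \<in> y" "n \<in> set (low T m)"
    have "n \<in> {m - 6..m - 1}"
      using conjunct1[OF conjunct2[OF low_bounds[of T m]]] m(2) by (rule subsetD)
    with max[OF m(1)] show False
      by simp
  qed
qed

lemma maximal_remm:
  assumes "ideal T y" "n \<in> y" "\<forall>m\<in>y. n \<notin> set (low T m)"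
  shows "n \<in> remm T (col T n) y"
proof -
  have "closed T (y - {n})"
    using assms unfolding ideal_def closed_def by blast
  from ideal_remove[OF assms(1) this] show ?thesis
    using assms(2) by (simp add: remm_iff young_def)
qed

definition colour_ok :: "affine_type \<Rightarrow> nat \<Rightarrow> bool" where
  "colour_ok T r \<longleftrightarrow> (case ground_data T r of (b, xs, p) \<Rightarrow>
     list_all (\<lambda>n. col T n = col T p \<longrightarrow> n = p mod step T) [0..step T - 1])"

text \<open>The tops have the colours 6, 1, 0 in type E6, 7, 0 in type E7 and 0 in type E8. These
  are nodes of mark 1 in the affine diagram, and each occurs once per step.\<close>

lemma peak_colour:
  assumes "col T n = col T (peak T r)"
  shows "\<exists>k. n = peak T r + step T * k"
proof -
  have "colour_ok E6 0" "colour_ok E6 1" "colour_ok E6 2" "colour_ok E7 0" "colour_ok E7 1" "colour_ok E8 0"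
    by code_simp+
  then have "colour_ok T (residue T r)"
    using residue_cases[of T r] by auto
  moreover obtain b xs where "ground_data T (residue T r) = (b, xs, ground_top T r)"
    by (rule ground_dataE[of T r]) blast
  ultimately have ok: "\<forall>n\<in>set [0..step T - 1]. col T n = col T (ground_top T r) \<longrightarrow> n = ground_top T r mod step T"
    by (simp add: colour_ok_def list_all_iff)
  have "n mod step T \<in> set [0..step T - 1]"
    using step_pos[of T] by simp
  moreover have "col T (n mod step T) = col T (ground_top T r)"
    using assms by (simp add: peak_def) (simp add: col_def)
  ultimately have "n mod step T = ground_top T r mod step T"
    using ok by blast
  then have "step T dvd n - ground_top T r"
    by (rule mod_eq_dvd_iff[THEN iffD1])
  then obtain k where "n - ground_top T r = step T * k" ..
  then have "n = peak T r + step T * (k - ground_shift T r)"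
    by (simp add: peak_def right_diff_distrib)
  then show ?thesis ..
qed

text \<open>A column whose only maximal block has the colour of the peak is a shifted ground state column.\<close>

lemma single_maximal:
  assumes y: "ideal T y"
    and max: "\<And>n. n \<in> y \<Longrightarrow> \<forall>m\<in>y. n \<notin> set (low T m) \<Longrightarrow> n = p"
    and p: "col T p = col T (peak T r)"
  shows "\<exists>k. y = shift T k (gset T r)"
proof -
  obtain k where k: "p = peak T r + step T * k"
    using peak_colour[OF p] ..
  define g where "g = shift T k (gset T r)"
  have "p \<in> y"
    using ex_maximal[OF y] max by blast
  have g: "ideal T g"
    unfolding g_def using ideal_gset by (simp add: ideal_shift)
  have pg: "p \<in> g"
    using peak_gset(1) by (simp add: g_def mem_shift k)
  obtain N M where N: "y \<subseteq> {..N}" "g \<subseteq> {..M}"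
    using y g unfolding ideal_def by (elim conjE exE)
  have cover_g: "\<exists>m\<in>g. n \<in> set (low T m)" if n: "n \<in> g" "n \<noteq> p" for n
  proof -
    have "n - step T * k \<in> gset T r" "n - step T * k \<noteq> peak T r"
      using n by (auto simp: g_def mem_shift k)
    from peak_gset(2)[OF this] obtain m where "m \<in> gset T r" "n - step T * k \<in> set (low T m)"
      by blast
    then have "n \<in> set (low T (m + step T * k))"
      unfolding low_shift by (intro image_eqI[of _ _ "n - step T * k"]) auto
    moreover have "m + step T * k \<in> g"
      using \<open>m \<in> gset T r\<close> by (simp add: g_def mem_shift)
    ultimately show ?thesis ..
  qed
  have "y \<subseteq> g"
    using g pg N(1) max by (intro generated_subset[of T g p y N]) (auto simp: ideal_def)
  moreover have "g \<subseteq> y"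
    using y \<open>p \<in> y\<close> N(2) cover_g by (intro generated_subset[of T y p g M]) (auto simp: ideal_def)
  ultimately show ?thesis
    unfolding g_def by blast
qed

section \<open>Perfectness at level one\<close>

definition added_ok :: "affine_type \<Rightarrow> nat \<Rightarrow> nat \<Rightarrow> bool" where
  "added_ok T r r' \<longleftrightarrow> (case ground_data T r of (b, xs, p) \<Rightarrow> case ground_data T r' of (c, ys, q) \<Rightarrow>
     list_all (\<lambda>n. col T n = col T p) (added T c ys))"

text \<open>A ground state column can only receive the colour that can be removed from its right
  neighbour; this is the matching of \<open>phi\<close> and \<open>eps\<close> along the ground
  state, read off from the table for one period of columns.\<close>

lemma added_colour:
  assumes "T \<noteq> E8" "n \<in> addm T i (gset T (Suc r))"
  shows "i = col T (peak T r)"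
proof -
  have tab: "added_ok E6 0 1" "added_ok E6 1 2" "added_ok E6 2 0" "added_ok E7 0 1" "added_ok E7 1 0"
    by code_simp+
  have "(T, residue T r, residue T (Suc r)) \<in> {(E6, 0, 1), (E6, 1, 2), (E6, 2, 0), (E7, 0, 1), (E7, 1, 0)}"
    using assms(1) by (cases T) (auto simp: residue_def mod_Suc)
  then have ok: "added_ok T (residue T r) (residue T (Suc r))"
    using tab by auto
  obtain b xs where d: "ground_data T (residue T r) = (b, xs, ground_top T r)"
    by (rule ground_dataE[of T r]) blast
  obtain c ys q where d': "ground_data T (residue T (Suc r)) = (c, ys, q)" "ground_base T (Suc r) = upto_set c ys"
    by (rule ground_dataE[of T "Suc r"]) blast
  define k where "k = ground_shift T (Suc r)"
  have "n \<in> addm T i (shift T k (upto_set c ys))"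
    using assms(2) by (simp add: gset_def k_def d'(2))
  then have n: "n - step T * k \<in> addm T i (upto_set c ys)"
    by (simp add: addm_shift mem_shift)
  then have "closed T (insert (n - step T * k) (upto_set c ys))" "n - step T * k \<notin> upto_set c ys"
    using assms(1) young_closed by (auto simp: addm_iff)
  then have "n - step T * k \<in> set (added T c ys)"
    by (rule closed_insert_upto)
  moreover have "\<forall>n\<in>set (added T c ys). col T n = col T (ground_top T r)"
    using ok by (simp add: added_ok_def d d'(1) list_all_iff)
  ultimately have "col T (n - step T * k) = col T (ground_top T r)"
    by blast
  then show ?thesis
    using n by (simp add: addm_iff peak_def)
qed

lemma estep_eps_pos: "young T y \<Longrightarrow> estep T i y n \<Longrightarrow> 0 < eps T i (cl T y)"
  using estep_ops(3) by simp

text \<open>Every maximal block of \<open>y\<close> is removable, so its colour has positive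
  \<open>eps\<close> and must be addable to the ground state column on the left. Hence all maximal
  blocks have the colour of the peak, and as equal colours are comparable there is only one of
  them.\<close>

lemma perfect_not_E8:
  assumes T: "T \<noteq> E8" and y: "young T y" and phi: "\<And>i. eps T i (cl T y) \<le> phi T i (cl T (gset T (Suc r)))"
  shows "\<exists>k. y = shift T k (gset T r)"
proof -
  have id: "ideal T y"
    using y T by (simp add: young_def)
  have c: "col T n = col T (peak T r)" "n \<in> remm T (col T n) y" if n: "n \<in> y" "\<forall>m\<in>y. n \<notin> set (low T m)" for n
  proof -
    show r: "n \<in> remm T (col T n) y"
      using maximal_remm[OF id n] .
    then obtain m where "estep T (col T n) y m"
      using ex_estep[OF y, of "col T n"] T by blast
    then have "0 < phi T (col T n) (cl T (gset T (Suc r)))"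
      using estep_eps_pos[OF y] phi[of "col T n"] by fastforce
    then obtain l where "fstep T (col T n) (gset T (Suc r)) l"
      using phi_eq_0[OF young_gset] by (metis less_irrefl)
    then have "l \<in> addm T (col T n) (gset T (Suc r))"
      by (simp add: fstep_def to_addm_def)
    from added_colour[OF T this] show "col T n = col T (peak T r)" .
  qed
  obtain p where p: "p \<in> y" "\<forall>m\<in>y. p \<notin> set (low T m)"
    using ex_maximal[OF id] by blast
  have "n = p" if n: "n \<in> y" "\<forall>m\<in>y. n \<notin> set (low T m)" for n
  proof (rule ccontr)
    assume "n \<noteq> p"
    moreover have "n \<in> remm T (col T p) y"
      using c[OF n] c(1)[OF p] by simp
    ultimately show False
      using remm_pair[OF y _ c(2)[OF p]] T by blast
  qed
  from single_maximal[OF id this c(1)[OF p]] show ?thesis .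
qed

lemma pair_0: "pair 0 30 0 (upto_set 0 [1, 2, 3, 4, 5, 7, 8, 10, 11, 13, 14, 17, 20, 23, 26, 29])"
  unfolding pair_def pairs_def by (intro exI conjI[OF _ refl]) simp

text \<open>The upper \<open>0\<close>-block of the \<open>0\<close>-pair is present and the lower
  one is missing: the ground state column is the middle of the \<open>0\<close>-string.\<close>

lemma gset_E8: "gset E8 r = insert 30 (upto_set 0 [1, 2, 3, 4, 5, 7, 8, 10, 11, 13, 14, 17, 20, 23, 26, 29])"
  unfolding insert_upto_set by (auto simp: gset_def ground_shift_def ground_base_def ground_data_def residue_def upto_set_def)

lemma middle_0:
  assumes "middle 0 z"
  shows "z = gset E8 r"
  using assms
proof (cases rule: middle_cases)
  case 1
  then show ?thesis by simp
next
  case (2 P Q x)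
  then obtain b xs where m: "(0, P, Q, b, xs) \<in> set pairs" "x = upto_set b xs"
    unfolding pair_def by blast
  from m(1) have "(P, b, xs) = (30, 0, [1, 2, 3, 4, 5, 7, 8, 10, 11, 13, 14, 17, 20, 23, 26, 29])"
    by (simp add: pairs_def)
  with 2(2) m(2) show ?thesis
    by (simp add: gset_E8)
qed

lemma midm_gset_E8: "midm E8 0 (gset E8 r)"
  using middle_midm[of 0 0] pair_middle(1)[OF pair_0] by (simp add: gset_E8)

text \<open>In the middle of the \<open>0\<close>-string all \<open>f\<close> of other colours
  vanish by rule (b). Two further \<open>0\<close>-steps would identify the column with a translate
  of the start of that string; both have first missing block 0, so they would be equal, but only one
  of them contains block 30.\<close>

lemma phi_gset_E8:
  shows "i \<noteq> 0 \<Longrightarrow> phi E8 i (cl E8 (gset E8 r)) = 0" and "phi E8 0 (cl E8 (gset E8 r)) \<le> 1"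
proof -
  show "phi E8 i (cl E8 (gset E8 r)) = 0" if "i \<noteq> 0"
  proof (rule phi_eq_0[OF young_gset])
    have "\<exists>j. j \<noteq> i \<and> midm E8 j (gset E8 r)"
      using that midm_gset_E8 by (intro exI[of _ 0]) auto
    then show "\<not> (\<exists>n. fstep E8 i (gset E8 r) n)"
      unfolding fstep_def by blast
  qed
  show "phi E8 0 (cl E8 (gset E8 r)) \<le> 1"
  proof (cases "\<exists>n. fstep E8 0 (gset E8 r) n")
    case False
    from phi_eq_0[OF young_gset this] show ?thesis by simp
  next
    case True
    then obtain n where n: "fstep E8 0 (gset E8 r) n" ..
    note n' = fstep_young[OF n]
    have "\<not> (\<exists>m. fstep E8 0 (insert n (gset E8 r)) m)"
    proof
      assume "\<exists>m. fstep E8 0 (insert n (gset E8 r)) m"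
      then obtain m where m: "fstep E8 0 (insert n (gset E8 r)) m" ..
      note m' = fstep_young[OF m]
      obtain k P Q where k: "pair 0 P Q (shift E8 k (gset E8 r))"
        using step_chain[OF young_gset, of n r m 0] n' m' by auto
      let ?u = "upto_set 0 [1, 2, 3, 4, 5, 7, 8, 10, 11, 13, 14, 17, 20, 23, 26, 29]"
      from k obtain b xs where b: "(0, P, Q, b, xs) \<in> set pairs" "shift E8 k (gset E8 r) = upto_set b xs"
        unfolding pair_def by blast
      from b(1) have "b = 0 \<and> xs = [1, 2, 3, 4, 5, 7, 8, 10, 11, 13, 14, 17, 20, 23, 26, 29]"
        by (simp add: pairs_def)
      with b(2) have u: "shift E8 k (gset E8 r) = ?u"
        by simp
      have "missing (shift E8 k (gset E8 r)) 0"
        unfolding u by (rule missing_upto) simp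
      moreover have "missing (shift E8 0 (gset E8 r)) 0"
        unfolding shift_0 gset_E8 insert_upto_set by (rule missing_upto) simp
      ultimately have "k = 0"
        by (rule shifts_equal(1)) simp_all
      with u have "insert 30 ?u = ?u"
        by (simp add: gset_E8)
      then have "30 \<in> ?u"
        by blast
      then show False
        by (simp add: upto_set_def)
    qed
    from phi_eq_0[OF _ this] fstep_phi[OF young_gset n] n' show ?thesis
      by simp
  qed
qed

lemma remm_middle_ne:
  assumes "middle i (shift E8 k y)"
  shows "remm E8 i y \<noteq> {}"
proof -
  have "remm E8 i (shift E8 k y) \<noteq> {}"
    using assms
  proof (cases rule: middle_cases)
    case 1
    have "shift E8 k y - {13} = upto_set 13 [14, 15, 17]"
      using 1(2) special_insert_eqs(1) by (auto simp: upto_set_def)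
    moreover have "13 \<in> shift E8 k y"
      using 1(2) by (simp add: upto_set_def)
    ultimately have "13 \<in> remm E8 2 (shift E8 k y)"
      using special_young(1) col_13 unfolding remm_iff by simp
    with 1(1) show ?thesis by blast
  next
    case (2 P Q x)
    have "insert P x - {P} = x"
      using pairD(2)[OF 2(1)] by blast
    then have "P \<in> remm E8 i (shift E8 k y)"
      using 2 pairD(4)[OF 2(1)] pair_young(1)[OF 2(1)] unfolding remm_iff by simp
    then show ?thesis by blast
  qed
  then show ?thesis
    by (simp add: remm_shift)
qed

text \<open>Needed to exclude special columns in the perfectness argument: they lose the
  \<open>4\<close>-block 17 or the \<open>2\<close>-block 18, and so are not confined to colour
  0.\<close>

lemma special_remm:
  assumes "special y"
  obtains i where "i \<noteq> 0" "remm E8 i y \<noteq> {}"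
proof -
  obtain k u where u: "y = shift E8 k u" "u = spec1 \<or> u = spec2"
    using assms unfolding special_def by blast
  have c: "col E8 17 = 4"
    by code_simp
  have "upto_closed E8 13 [14, 15]"
    by code_simp
  then have pre: "young E8 (upto_set 13 [14, 15])"
    by (rule young_upto)
  from u(2) show ?thesis
  proof
    assume s: "u = spec1"
    have "spec1 - {17} = upto_set 13 [14, 15]" "17 \<in> spec1"
      by (auto simp: spec1_def upto_set_def)
    then have "17 \<in> remm E8 4 u"
      using pre c unfolding remm_iff s by simp
    with that[of 4] show ?thesis
      unfolding u(1) remm_shift by auto
  next
    assume s: "u = spec2"
    have "spec2 - {18} = upto_set 16 [17]" "18 \<in> spec2"
      by (auto simp: spec2_def upto_set_def)
    then have "18 \<in> remm E8 2 u"
      using special_young(3) col_13 unfolding remm_iff s by simp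
    with that[of 2] show ?thesis
      unfolding u(1) remm_shift by auto
  qed
qed

text \<open>Only colour 0 may be removable, and at most once. A middle column admits removal of its
  own colour, so that colour is 0 and the column is the ground state one. Otherwise \<open>y\<close>
  is an ideal whose maximal blocks all have colour 0: a single one generates a translate of the
  ground state column, and two form the \<open>0\<close>-pair, which makes \<open>eps\<close> at
  least 2.\<close>

lemma perfect_E8:
  assumes y: "young E8 y" and phi: "\<And>i. eps E8 i (cl E8 y) \<le> phi E8 i (cl E8 (gset E8 (Suc r)))"
  shows "\<exists>k. y = shift E8 k (gset E8 r)"
proof -
  have no: "\<not> estep E8 i y n" if "i \<noteq> 0" for i n
    using estep_eps_pos[OF y] phi[of i] phi_gset_E8(1)[OF that] by fastforce
  show ?thesis
  proof (cases "\<exists>j. midm E8 j y")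
    case True
    then obtain j where j: "midm E8 j y" ..
    from midm_middle[OF this] obtain k where k: "middle j (shift E8 k y)" ..
    obtain n where "estep E8 j y n"
      using ex_estep[OF y remm_middle_ne[OF k]] midm_unique j by blast
    with no have "j = 0" by blast
    with k have "shift E8 k y = gset E8 r"
      using middle_0 by blast
    then have "y = shift E8 (- k) (gset E8 r)"
      by (rule shift_eqD)
    then show ?thesis ..
  next
    case False
    then have ex: "\<exists>n. estep E8 i y n" if "remm E8 i y \<noteq> {}" for i
      using ex_estep[OF y that] by blast
    with no have rem0: "remm E8 i y = {}" if "i \<noteq> 0" for i
      using that by blast
    with special_remm have "\<not> special y"
      by blast
    then have id: "ideal E8 y"
      using y by (simp add: young_def)
    have c: "col E8 n = 0" "n \<in> remm E8 0 y" if n: "n \<in> y" "\<forall>m\<in>y. n \<notin> set (low E8 m)" for n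
    proof -
      have r: "n \<in> remm E8 (col E8 n) y"
        using maximal_remm[OF id n] .
      then show c: "col E8 n = 0"
        using rem0[of "col E8 n"] by blast
      from r show "n \<in> remm E8 0 y"
        unfolding c .
    qed
    obtain p where p: "p \<in> y" "\<forall>m\<in>y. p \<notin> set (low E8 m)"
      using ex_maximal[OF id] by blast
    have cp: "col E8 (peak E8 r) = 0"
      by (simp add: peak_def ground_top_def ground_data_def residue_def col_eq_0_iff ground_shift_def step_def)
    show ?thesis
    proof (cases "\<forall>n\<in>remm E8 0 y. n = p")
      case True
      then have "n = p" if "n \<in> y" "\<forall>m\<in>y. n \<notin> set (low E8 m)" for n
        using c(2)[OF that] by blast
      moreover have "col E8 p = col E8 (peak E8 r)"
        using c(1)[OF p] cp by simp
      ultimately show ?thesis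
        using single_maximal[OF id] by blast
    next
      case False
      then obtain q where "q \<in> remm E8 0 y" "q \<noteq> p"
        by blast
      then obtain k P Q x where k: "pair 0 P Q x" "shift E8 k y = insert P (insert Q x)"
        using remm_pair[OF y _ c(2)[OF p], of q] by auto
      obtain n where n: "estep E8 0 y n"
        using ex[of 0] c(2)[OF p] by blast
      then have "to_remm E8 0 (shift E8 k y) (n + step E8 * k)"
        by (simp only: estep_def to_remm_shift)
      then have "n + step E8 * k = Q"
        unfolding k(2) paired_remove(2)[OF k(1)] .
      then have "shift E8 k (y - {n}) = insert P x"
        using pairD[OF k(1)] unfolding shift_Diff k(2) by auto
      then have m: "middle 0 (shift E8 k (y - {n}))"
        using pair_middle(1)[OF k(1)] by simp
      have yn: "young E8 (y - {n})"
        using estep_young[OF n] by blast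
      have "\<not> (E8 = E8 \<and> (\<exists>j. j \<noteq> 0 \<and> midm E8 j (y - {n})))"
        using midm_unique[OF middle_midm[OF m]] by blast
      from ex_estep[OF yn remm_middle_ne[OF m] this] obtain n' where "estep E8 0 (y - {n}) n'" ..
      then have "0 < eps E8 0 (cl E8 (y - {n}))"
        by (rule estep_eps_pos[OF yn])
      then have "2 \<le> eps E8 0 (cl E8 y)"
        using estep_ops(3)[OF y n] by simp
      with phi[of 0] phi_gset_E8(2)[of "Suc r"] show ?thesis
        by linarith
    qed
  qed
qed

lemma perfect:
  assumes "young T y" "\<And>i. eps T i (cl T y) \<le> phi T i (cl T (gset T (Suc r)))"
  shows "\<exists>k. y = shift T k (gset T r)"
  using perfect_E8[of y r] perfect_not_E8[of T y r] assms by (cases "T = E8") auto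

section \<open>Reduced walls\<close>

definition zeros :: "affine_type \<Rightarrow> int \<Rightarrow> int set \<Rightarrow> int set" where
  "zeros T N x = {n \<in> x. N \<le> n \<and> col T n = 0}"

definition zc :: "affine_type \<Rightarrow> nat \<Rightarrow> int set \<Rightarrow> int" where
  "zc T r x = int (card {n \<in> x - gset T r. col T n = 0}) - int (card {n \<in> gset T r - x. col T n = 0})"

lemma card_Diff_Diff:
  assumes "finite A" "finite B"
  shows "int (card (A - B)) - int (card (B - A)) = int (card A) - int (card B)"
proof -
  have "card A = card (A - B) + card (A \<inter> B)" "card B = card (B - A) + card (A \<inter> B)"
    using assms card_Diff_subset_Int[of A B] card_Diff_subset_Int[of B A] card_mono[of A "A \<inter> B"] card_mono[of B "A \<inter> B"]
    by (auto simp: Int_commute)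
  then show ?thesis by simp
qed

lemma finite_zeros: "x \<subseteq> {..<M} \<Longrightarrow> finite (zeros T N x)"
  by (rule finite_subset[of _ "{N..<M}"]) (auto simp: zeros_def)

text \<open>Below a common cutoff both columns are full, so the signed difference is a difference of
  two finite counts above it.\<close>

lemma zc_zeros:
  assumes "young T x" "{..<N} \<subseteq> x" "{..<N} \<subseteq> gset T r"
  shows "zc T r x = int (card (zeros T N x)) - int (card (zeros T N (gset T r)))"
proof -
  have "N \<le> n" if "n \<notin> x \<or> n \<notin> gset T r" for n
    using assms(2,3) that by (meson lessThan_iff not_le subsetD)
  then have "{n \<in> x - gset T r. col T n = 0} = zeros T N x - zeros T N (gset T r)"
    "{n \<in> gset T r - x. col T n = 0} = zeros T N (gset T r) - zeros T N x"
    unfolding zeros_def by blast+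
  moreover have "finite (zeros T N x)" "finite (zeros T N (gset T r))"
    using young_bounds[OF assms(1)] young_bounds[OF young_gset[of T r]] finite_zeros by blast+
  ultimately show ?thesis
    unfolding zc_def using card_Diff_Diff by simp
qed

lemma zc_gset: "zc T r (gset T r) = 0"
  by (simp add: zc_def)

lemma zc_remove:
  assumes "young T y" "young T (y - {n})" "n \<in> y"
  shows "zc T r (y - {n}) = zc T r y - (if col T n = 0 then 1 else 0)"
proof -
  obtain L where L: "{..<L} \<subseteq> y - {n}"
    using young_bounds[OF assms(2)] by blast
  obtain G where G: "{..<G} \<subseteq> gset T r"
    using young_bounds[OF young_gset] by blast
  obtain M where M: "y \<subseteq> {..<M}"
    using young_bounds[OF assms(1)] by blast
  define N where "N = min L G"
  have "{..<N} \<subseteq> {..<L}" "{..<N} \<subseteq> {..<G}"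
    by (simp_all add: N_def)
  note N = subset_trans[OF this(1) L] subset_trans[OF this(2) G]
  have "N \<le> n"
    using N(1) by (meson Diff_iff insertI1 lessThan_iff not_le subsetD)
  then have Z: "zeros T N (y - {n}) = zeros T N y - {n}" "n \<in> zeros T N y \<longleftrightarrow> col T n = 0"
    using assms(3) unfolding zeros_def by blast+
  have zc: "zc T r y = int (card (zeros T N y)) - int (card (zeros T N (gset T r)))"
    "zc T r (y - {n}) = int (card (zeros T N y - {n})) - int (card (zeros T N (gset T r)))"
    using zc_zeros[OF assms(1) subset_trans[OF N(1) Diff_subset] N(2)] zc_zeros[OF assms(2) N] unfolding Z(1) .
  show ?thesis
  proof (cases "col T n = 0")
    case True
    then have "card (zeros T N y) = Suc (card (zeros T N y - {n}))"
      using Z(2) finite_zeros[OF M] by (intro card.remove) auto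
    with True zc show ?thesis
      by simp
  next
    case False
    then have "zeros T N y - {n} = zeros T N y"
      using Z(2) by simp
    with False zc show ?thesis
      by simp
  qed
qed

text \<open>The \<open>0\<close>-blocks above the cutoff move to \<open>0\<close>-blocks above it,
  and the \<open>0\<close>-block at the cutoff itself is new, being filled in from below.\<close>

lemma zc_shift_less:
  assumes y: "young T y" and k: "0 < k"
  shows "zc T r y < zc T r (shift T k y)"
proof -
  obtain L where L: "{..<L} \<subseteq> y" "y \<subseteq> {..<L + 32}"
    using young_bounds[OF y] by blast
  obtain G where G: "{..<G} \<subseteq> gset T r"
    using young_bounds[OF young_gset] by blast
  \<comment> \<open>Rounded down to a multiple of the step, so that the cutoff is itself a
    \<open>0\<close>-block.\<close>
  define N where "N = step T * (min L G div step T)"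
  have "N \<le> min L G"
    unfolding N_def using step_pos[of T] by (metis mult.commute div_mult_mod_eq le_add_same_cancel1 pos_mod_sign)
  then have "{..<N} \<subseteq> {..<L}" "{..<N} \<subseteq> {..<G}"
    by simp_all
  note N = subset_trans[OF this(1) L(1)] subset_trans[OF this(2) G]
  have s: "0 < step T * k"
    using k step_pos[of T] by simp
  have sub: "{..<N + step T * k} \<subseteq> shift T k y"
    using N(1) by (auto simp: mem_shift subset_iff)
  then have Ns: "{..<N} \<subseteq> shift T k y"
    using s by (auto simp: subset_iff)
  have "insert N ((\<lambda>n. n + step T * k) ` zeros T N y) \<subseteq> zeros T N (shift T k y)"
    using s sub by (auto simp: zeros_def mem_shift N_def col_eq_0_iff subset_iff)
  moreover have "finite (zeros T N (shift T k y))"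
    using L(2) by (intro finite_zeros[of _ "L + 32 + step T * k"]) (auto simp: mem_shift subset_iff)
  ultimately have "card (insert N ((\<lambda>n. n + step T * k) ` zeros T N y)) \<le> card (zeros T N (shift T k y))"
    by (rule card_mono[rotated])
  moreover have "N \<notin> (\<lambda>n. n + step T * k) ` zeros T N y"
    using s by (auto simp: zeros_def)
  moreover have "finite (zeros T N y)"
    using L(2) by (rule finite_zeros)
  moreover have "card ((\<lambda>n. n + step T * k) ` zeros T N y) = card (zeros T N y)"
    by (rule card_image) (simp add: inj_on_def)
  ultimately have "card (zeros T N y) < card (zeros T N (shift T k y))"
    by simp
  then show ?thesis
    using zc_zeros[OF y N] zc_zeros[OF _ Ns N(2)] y by (simp add: young_shift)
qed

lemma zc_shift_inj:
  assumes "young T y" "zc T r (shift T k y) = zc T r y"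
  shows "k = 0"
proof (rule ccontr)
  assume "k \<noteq> 0"
  then consider "0 < k" | "0 < - k" by linarith
  then show False
  proof cases
    case 1
    from zc_shift_less[OF assms(1) this, of r] assms(2) show False by simp
  next
    case 2
    have "young T (shift T k y)"
      using assms(1) by (simp add: young_shift)
    from zc_shift_less[OF this 2, of r] assms(2) show False by simp
  qed
qed

section \<open>Descent in the finite set of reduced walls\<close>

definition reduced :: "affine_type \<Rightarrow> (block set set \<times> block set set \<Rightarrow> int) \<Rightarrow> (nat \<Rightarrow> int set) \<Rightarrow> bool" where
  "reduced T H y \<longleftrightarrow> (\<forall>r. H (cl T (y (Suc r)), cl T (y r)) - zc T (Suc r) (y (Suc r)) + zc T r (y r)
     = H (cl T (gset T (Suc r)), cl T (gset T r)))"

definition walls :: "affine_type \<Rightarrow> (block set set \<times> block set set \<Rightarrow> int) \<Rightarrow> nat \<Rightarrow> (nat \<Rightarrow> int set) set" where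
  "walls T H R = {y. (\<forall>r. young T (y r)) \<and> (\<forall>r\<ge>R. y r = gset T r) \<and> reduced T H y}"

text \<open>In a reduced wall a column is determined by its class and the column to its left.\<close>

lemma reduced_column_unique:
  assumes "reduced T H x" "reduced T H y" "young T (x r)" "young T (y r)"
    "x (Suc r) = y (Suc r)" "cl T (x r) = cl T (y r)"
  shows "x r = y r"
proof -
  obtain k where k: "y r = shift T k (x r)"
    using assms(6) unfolding cl_eq_iff[OF assms(3,4)] ..
  have "H (cl T (x (Suc r)), cl T (x r)) - zc T (Suc r) (x (Suc r)) + zc T r (x r)
      = H (cl T (y (Suc r)), cl T (y r)) - zc T (Suc r) (y (Suc r)) + zc T r (y r)"
    using assms(1)[unfolded reduced_def, rule_format, of r] assms(2)[unfolded reduced_def, rule_format, of r]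
    by (rule trans[OF _ sym])
  then have "zc T r (y r) = zc T r (x r)"
    unfolding assms(5,6) by linarith
  then have "zc T r (shift T k (x r)) = zc T r (x r)"
    unfolding k .
  then have "k = 0"
    by (rule zc_shift_inj[OF assms(3)])
  then show ?thesis
    by (simp add: k)
qed

text \<open>The finitely many classes in the columns below \<open>R\<close> determine the wall: the
  columns are recovered from left to right, starting at the ground state column
  \<open>R\<close>.\<close>

lemma finite_walls: "finite (walls T H R)"
proof -
  define code where "code y = map (\<lambda>r. cl T (y r)) [0..<R]" for y
  have "inj_on code (walls T H R)"
  proof (rule inj_onI)
    fix x y assume xy: "x \<in> walls T H R" "y \<in> walls T H R" and eq: "code x = code y"
    have x: "young T (x r)" "R \<le> r \<Longrightarrow> x r = gset T r" "reduced T H x"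
      and y: "young T (y r)" "R \<le> r \<Longrightarrow> y r = gset T r" "reduced T H y" for r
      using xy by (simp_all add: walls_def)
    have "x r = y r" for r
    proof (induction "R - r" arbitrary: r)
      case 0
      then show ?case
        using x(2)[of r] y(2)[of r] by simp
    next
      case (Suc d)
      then have "r < R" and eq_Suc: "x (Suc r) = y (Suc r)"
        by simp_all
      have "code x ! r = code y ! r"
        by (simp only: eq)
      then have "cl T (x r) = cl T (y r)"
        using \<open>r < R\<close> by (simp add: code_def)
      then show ?case
        by (rule reduced_column_unique[OF x(3) y(3) x(1) y(1) eq_Suc])
    qed
    then show "x = y" ..
  qed
  moreover have "code ` walls T H R \<subseteq> {cs. set cs \<subseteq> classes T \<and> length cs = R}"
  proof (rule image_subsetI)
    fix y assume "y \<in> walls T H R"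
    then have "cl T (y r) \<in> classes T" for r
      by (intro cl_classes) (simp add: walls_def)
    then show "code y \<in> {cs. set cs \<subseteq> classes T \<and> length cs = R}"
      by (simp add: code_def image_subset_iff)
  qed
  then have "finite (code ` walls T H R)"
    using finite_lists_length_eq[OF finite_classes, of T R] by (rule finite_subset)
  ultimately show ?thesis
    by (rule finite_imageD[rotated])
qed

lemma reduced_gset: "reduced T H (gset T)"
  by (simp add: reduced_def zc_gset)

text \<open>
  A reduced wall other than the ground state wall has a column from which some crystal operator removes
  a block so that the wall remains reduced: by the tensor product rule, the operator acts on the
  pairs consisting of this column and one of its neighbours by removing the same block.
\<close>

lemma walls_descend:
  assumes H: "energy_function T H" and y: "y \<in> walls T H R" "y \<noteq> gset T"
  shows "\<exists>x\<in>walls T H R. x \<le> y \<and> x \<noteq> y"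
proof -
  have young: "young T (y r)" and tail: "R \<le> r \<Longrightarrow> y r = gset T r" and red: "reduced T H y" for r
    using y(1) by (auto simp: walls_def)
  define D where "D = {r. y r \<noteq> gset T r}"
  have sub: "D \<subseteq> {..<R}"
  proof
    fix t assume "t \<in> D"
    then have "\<not> R \<le> t"
      using tail[of t] by (auto simp: D_def)
    then show "t \<in> {..<R}"
      by simp
  qed
  then have fin: "finite D"
    by (rule finite_subset) simp
  have ne: "D \<noteq> {}"
    using y(2) unfolding D_def by auto
  define r where "r = Max D"
  have "r \<in> D"
    unfolding r_def using fin ne by (rule Max_in)
  have "Suc r \<notin> D"
    using Max_ge[OF fin, of "Suc r"] unfolding r_def by fastforce
  then have nxt: "y (Suc r) = gset T (Suc r)"
    by (simp add: D_def)
  \<comment> \<open>A translate of the ground state column has the same class and the same left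
    neighbour as the ground state column, so reducedness would make it equal to that column.\<close>
  have "\<not> (\<exists>k. y r = shift T k (gset T r))"
  proof
    assume "\<exists>k. y r = shift T k (gset T r)"
    then obtain k where "y r = shift T k (gset T r)" ..
    then have "cl T (y r) = cl T (gset T r)"
      by (simp add: cl_shift[OF young_gset])
    then have "y r = gset T r"
      by (rule reduced_column_unique[OF red reduced_gset young young_gset nxt])
    with \<open>r \<in> D\<close> show False
      by (simp add: D_def)
  qed
  moreover have "\<exists>k. y r = shift T k (gset T r)"
    if "\<not> (\<exists>i. phi T i (cl T (y (Suc r))) < eps T i (cl T (y r)))"
  proof (rule perfect[OF young])
    show "eps T i (cl T (y r)) \<le> phi T i (cl T (gset T (Suc r)))" for i
      using that unfolding nxt by (simp add: not_less)
  qed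
  ultimately obtain i where i: "phi T i (cl T (y (Suc r))) < eps T i (cl T (y r))"
    by blast
  \<comment> \<open>Columns are numbered from the right, so this is the rightmost possible column.
    Its minimality provides the opposite inequality for the pair formed with the column on its
    right.\<close>
  define s where "s = (LEAST s. phi T i (cl T (y (Suc s))) < eps T i (cl T (y s)))"
  have s: "phi T i (cl T (y (Suc s))) < eps T i (cl T (y s))"
    unfolding s_def using i by (rule LeastI)
  have "s \<le> r"
    unfolding s_def using i by (rule Least_le)
  have below: "eps T i (cl T (y t)) \<le> phi T i (cl T (y s))" if "Suc t = s" for t
    using not_less_Least[of t "\<lambda>s. phi T i (cl T (y (Suc s))) < eps T i (cl T (y s))"] that
    unfolding s_def[symmetric] by (auto simp: not_less)
  obtain n where n: "estep T i (y s) n"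
    using eps_pos[OF young, of i s] s by auto
  note n' = estep_young[OF n]
  define x where "x = y(s := y s - {n})"
  have "reduced T H x"
    unfolding reduced_def
  proof
    fix t
    have yt: "H (cl T (y (Suc t)), cl T (y t)) - zc T (Suc t) (y (Suc t)) + zc T t (y t)
      = H (cl T (gset T (Suc t)), cl T (gset T t))"
      using red unfolding reduced_def by blast
    have zc: "zc T s (x s) = zc T s (y s) - (if i = 0 then 1 else 0)"
      using zc_remove[OF young, of s n s] n' by (simp add: x_def)
    \<comment> \<open>Only the pairs with left members \<open>s + 1\<close> and \<open>s\<close>
      involve the changed column. For colour 0 the change of \<open>H\<close> is opposite in the two
      pairs, as is the sign of \<open>zc T s (x s)\<close>.\<close>
    consider "t = s" | "Suc t = s" | "t \<noteq> s" "Suc t \<noteq> s"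
      by blast
    then show "H (cl T (x (Suc t)), cl T (x t)) - zc T (Suc t) (x (Suc t)) + zc T t (x t)
      = H (cl T (gset T (Suc t)), cl T (gset T t))"
    proof cases
      case 1
      have "H (cl T (y (Suc s)), cl T (y s - {n})) = H (cl T (y (Suc s)), cl T (y s)) + (if i = 0 then 1 else 0)"
        by (rule energy_right[OF H young young n s])
      with yt zc show ?thesis
        by (simp add: 1 x_def split: if_splits)
    next
      case 2
      have "H (cl T (y s - {n}), cl T (y t)) = H (cl T (y s), cl T (y t)) - (if i = 0 then 1 else 0)"
        by (rule energy_left[OF H young young n below[OF 2]])
      moreover have "t \<noteq> s"
        using 2 by auto
      ultimately show ?thesis
        using yt zc by (simp add: 2 x_def split: if_splits)
    next
      case 3
      with yt show ?thesis
        by (simp add: x_def)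
    qed
  qed
  moreover have "s < R"
    using \<open>s \<le> r\<close> \<open>r \<in> D\<close> sub by auto
  ultimately have "x \<in> walls T H R"
    using young tail n' by (auto simp: walls_def x_def)
  moreover have "x \<le> y" "x \<noteq> y"
    using n' by (auto simp: x_def le_fun_def fun_eq_iff)
  ultimately show ?thesis
    by blast
qed

lemma gset_le_walls:
  assumes "energy_function T H" "y \<in> walls T H R"
  shows "gset T \<le> y"
proof (rule ccontr)
  assume "\<not> gset T \<le> y"
  define B where "B = {z \<in> walls T H R. \<not> gset T \<le> z}"
  have "finite B" "B \<noteq> {}"
    using finite_walls assms(2) \<open>\<not> gset T \<le> y\<close> unfolding B_def by auto
  \<comment> \<open>A counterexample minimal under inclusion. The smaller reduced wall below it is
    then not a counterexample, and containing the ground state passes from it to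
    \<open>m\<close>.\<close>
  then obtain m where m: "m \<in> B" "\<And>z. z \<in> B \<Longrightarrow> z \<le> m \<Longrightarrow> m = z"
    using finite_has_minimal[of B] by blast
  have "m \<in> walls T H R" "m \<noteq> gset T"
    using m(1) by (auto simp: B_def)
  from walls_descend[OF assms(1) this] obtain x where x: "x \<in> walls T H R" "x \<le> m" "x \<noteq> m"
    by blast
  with m(2)[of x] have "gset T \<le> x"
    by (auto simp: B_def)
  with x(2) m(1) show False
    by (auto simp: B_def)
qed

lemma colour_wall_place [simp]: "colour (wall_place T r n) = col T n"
  by (simp add: wall_place_def place_def)

lemma inj_wall_place: "inj (wall_place T r)"
  unfolding wall_place_def by (rule inj_place)

lemma zero_content_wall_place:
  assumes "Y r = wall_place T r ` y"
  shows "zero_content T Y r = zc T r y"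
proof -
  have c: "card {b \<in> wall_place T r ` A - wall_place T r ` B. colour b = 0} = card {n \<in> A - B. col T n = 0}" for A B
  proof -
    have "{b \<in> wall_place T r ` A - wall_place T r ` B. colour b = 0} = wall_place T r ` {n \<in> A - B. col T n = 0}"
      unfolding image_set_diff[OF inj_wall_place, symmetric] by auto
    then show ?thesis
      by (simp add: card_image inj_on_subset[OF inj_wall_place])
  qed
  show ?thesis
    unfolding zero_content_def zc_def assms ground_gset c ..
qed

theorem corollary4p5:
  fixes T :: affine_type
    and H :: "block set set \<times> block set set \<Rightarrow> int"
    and Y :: "nat \<Rightarrow> block set"
  assumes "energy_function T H"
    and "young_wall T Y"
    and "reduced_wall T H Y"
  shows "\<forall>r. ground T r \<subseteq> Y r"
proof -
  have "\<exists>x. Y r = wall_place T r ` x \<and> young T x" for r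
  proof -
    have "young_column T (range (wall_place T r)) (Y r)"
      using assms(2) by (simp add: young_wall_def flip: wall_pattern_place)
    then show ?thesis
      unfolding wall_place_def by (rule young_columnE) blast
  qed
  then obtain y where y: "\<And>r. Y r = wall_place T r ` y r" "\<And>r. young T (y r)"
    by metis
  have cl: "column_class T (wall_place T r ` x) = cl T x" for r x
    unfolding wall_place_def by (rule column_class_place)
  have "reduced T H y"
    unfolding reduced_def
  proof
    fix r
    show "H (cl T (y (Suc r)), cl T (y r)) - zc T (Suc r) (y (Suc r)) + zc T r (y r)
      = H (cl T (gset T (Suc r)), cl T (gset T r))"
      using assms(3) unfolding reduced_wall_def ground_gset zero_content_wall_place[of Y _ T, OF y(1)] y(1) cl by blast
  qed
  moreover obtain R where "\<forall>r\<ge>R. y r = gset T r"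
  proof -
    let ?D = "{(r, b). b \<in> (Y r - ground T r) \<union> (ground T r - Y r)}"
    have "finite (fst ` ?D)"
      using assms(2) by (simp add: young_wall_def)
    then obtain R where R: "\<forall>r\<in>fst ` ?D. r < R"
      using finite_nat_set_iff_bounded by blast
    have "y r = gset T r" if "R \<le> r" for r
    proof -
      have "r \<notin> fst ` ?D"
        using R that by (meson leD)
      then have "Y r = ground T r"
        by (force simp: image_iff)
      then show ?thesis
        unfolding y(1) ground_gset inj_image_eq_iff[OF inj_wall_place] .
    qed
    then show ?thesis
      using that by blast
  qed
  ultimately have "y \<in> walls T H R"
    using y(2) by (simp add: walls_def)
  then have "gset T \<le> y"
    by (rule gset_le_walls[OF assms(1)])
  then show ?thesis
    unfolding y(1) ground_gset by (auto simp: le_fun_def)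
qed

end
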